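(* Assume that $\varphi$ is non-contractive, let $(S,\iota)$ be a free analytic 1-submanifold of $M$ with $S\notin\mathcal F(S)$, assume that $S$ is negative, and let $\Sigma\in\mathcal M(S)$ be compact with $\Sigma\subset\mathrm{int}[S]$. Define $\sigma\colon\mathbb Z_{\neq0}\to\{-1,1\}$ by $\sigma(n):=(-1)^{n-1}$ if $n>0$ and $\sigma(n):=(-1)^n$ if $n<0$. 1) Let $S\cong U(1)$ with $\Sigma$-decomposition $\Sigma_0,\dots,\Sigma_n$, $[g_0],\dots,[g_n]$, and set $g_{-1}:=g_n$. Then $[g_k]=[g_{\sigma(1)}\cdot\ldots\cdot g_{\sigma(k)}]$ for all $1\le k\le n$. 2) Let $S\cong D$ (an interval) with $\Sigma$-decomposition $(\{\Sigma_n\}_{n\in\mathfrak n},\{[g_n]\}_{n\in\mathfrak n})$. Then $[g_n]=[g_{\sigma(\mathrm{sign}(n))}\cdot\ldots\cdot g_{\sigma(n)}]$ for all $n\in\mathfrak n\setminus\{0\}$, where the product has $|n|$ factors $g_{\sigma(j)}$ with $j$ running through $\mathrm{sign}(n)\cdot1,\ \mathrm{sign}(n)\cdot2,\dots,\ n$ in this order.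
   Context: Basic setting. Manifolds and Lie groups are finite-dimensional, Hausdorff, real analytic, without boundary unless stated otherwise, and not assumed second countable. $\varphi\colon G\times M\to M$, $(g,x)\mapsto g\cdot x$, is a left action of a Lie group $G$ on an analytic manifold $M$ such that $g\mapsto g\cdot x$ is continuous for each $x\in M$. $\varphi$ is analytic in $M$ if $x\mapsto g\cdot x$ is analytic for each $g\in G$; it is non-contractive if it is analytic in $M$ and for each $C\subseteq M$ with $|C|\ge 2$ and each $x\in M\setminus C$ there is a neighbourhood $U$ of $x$ with $g\cdot C\not\subseteq U$ for all $g\in G$. An analytic 1-submanifold $(S,\iota)$ of $M$ consists of a connected, Hausdorff, second countable 1-dimensional analytic manifold $S$ with (possibly empty) boundary and an injective analytic immersion $\iota\colon S\to M$. There is a homeomorphism $\upsilon\colon B\to S$ where either $B=U(1)$ (written $S\cong U(1)$) or $B=D\subseteq\mathbb R$ is a nondegenerate interval (written $S\cong D$). A segment is a connected subset of $S$ with more than one point; $\mathrm{Seg}(S)$ is the set of segments. For $\Sigma\in\mathrm{Seg}(S)$: $\mathrm{int}[\Sigma]:=\upsilon(\text{topological interior of }\upsilon^{-1}(\Sigma)\text{ in }U(1)\text{ resp. }\mathbb R)$ and $\partial_\Sigma:=\Sigma\setminus\mathrm{int}[\Sigma]$. A boundary segment of $\Sigma$ is a segment $\Sigma'\subseteq\Sigma$ with $\Sigma\setminus\Sigma'$ connected (possibly empty). The symbol $\subset$ means proper inclusion. $g\cdot\iota$ denotes $z\mapsto g\cdot\iota(z)$; $G_x$ is the stabilizer of $x\in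 M$, $G_z:=G_{\iota(z)}$ for $z\in S$, $G_S:=\bigcap_{z\in S}G_{\iota(z)}$, $\mathcal H(S):=G/G_S$ (left cosets), and $[g]\in\mathcal H(S)$ is the class of $g$. For $\Sigma,\Sigma'\in\mathrm{Seg}(S)$ and $g\in G$, write $g\cdot\iota|_\Sigma\sim_\circ\iota|_{\Sigma'}$ if $g\cdot\iota(O)=\iota(O')$ for open (in $S$) segments $O\subseteq\Sigma$, $O'\subseteq\Sigma'$ on which $\iota$ is an embedding. $\Sigma\in\mathrm{Seg}(S)$ is a free segment, $\Sigma\in\mathcal F(S)$, if for $g\in G$: $g\cdot\iota|_\Sigma\sim_\circ\iota|_\Sigma\Leftrightarrow g\in G_S$. $\mathcal M(S)$ is the set of inclusion-maximal elements of $\mathcal F(S)$. $(S,\iota)$ is free if $\mathcal F(S)\neq\emptyset$. Negative. Let $\Sigma\in\mathcal M(S)$ be compact with $\Sigma\subset S$. For $z\in\partial_\Sigma\cap\mathrm{int}[S]$ (this set is non-empty) let $[g_z]\neq[e]$ be the unique class in $\mathcal H(S)$ for which there exist a compact segment $\Sigma_b\subseteq\Sigma$ with $b\in\partial_\Sigma\cap\partial_{\Sigma_b}$ and a compact $\Sigma_z\in\mathcal F(S)$ with $\Sigma\cap\Sigma_z=\partial_\Sigma\cap\partial_{\Sigma_z}=\{z\}$ such that $g_z\cdot\iota(\Sigma_b)=\iota(\Sigma_z)$ and $g_z\cdot\iota(b)=\iota(z)$. $\Sigma$ is negative if $g_z\in G_z$ for every $z\in\partial_\Sigma\cap\mathrm{int}[S]$.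 $S$ is called negative if $S$ admits no $z$-decomposition and each compact $\Sigma\in\mathcal M(S)$ is negative. Here (only for $S\cong D$, $z\in\mathrm{int}[S]$) a $z$-decomposition is a class $[e]\neq[g]\in\mathcal H(S)$ with $g\in G_z$ such that there are compact segments $K_\pm\subseteq S$ with $g\cdot\iota(K_-)=\iota(K_+)$, $K_-\cap K_+=\{z\}$, and $\Sigma_\pm\in\mathcal F(S)$ for the unique boundary segments $\Sigma_\pm$ of $S$ with $S=\Sigma_-\cup\Sigma_+$, $\Sigma_-\cap\Sigma_+=\{z\}$, $K_\pm\subseteq\Sigma_\pm$. $\Sigma$-decomposition, $S\cong U(1)$. For $\Sigma\in\mathcal M(S)$, $\Sigma\subset S$: a $\Sigma$-decomposition consists of (compact) $\Sigma_0,\dots,\Sigma_n\in\mathcal M(S)$, $n\ge1$, and classes $[g_0],\dots,[g_n]\in\mathcal H(S)$ with $\Sigma_0=\Sigma$, $S=\bigcup_{k=0}^n\Sigma_k$, $g_k\cdot\iota(\Sigma_0)=\iota(\Sigma_k)$ for $0\le k\le n$; if $n=1$, $\Sigma_0\cap\Sigma_1=\partial_{\Sigma_0}\cap\partial_{\Sigma_1}$ consists of the two boundary points of $\Sigma_0$ and $\Sigma_1$; if $n\ge2$, $\Sigma_p\cap\Sigma_q=\partial_{\Sigma_p}\cap\partial_{\Sigma_q}$ is a singleton for $|p-q|\in\{1,n\}$ and empty for $2\le|p-q|\le n-1$. $\Sigma$-decomposition, $S\cong D$. For compact $\Sigma\in\mathcal M(S)$, $\Sigma\subset\mathrm{int}[S]$: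 a $\Sigma$-decomposition is a pair $(\{\Sigma_n\}_{n\in\mathfrak n},\{[g_n]\}_{n\in\mathfrak n})$ with $\mathfrak n=\{n\in\mathbb Z\mid\mathfrak n_-\le n\le\mathfrak n_+\}$, $\mathfrak n_\pm\in\mathbb Z_{\ne0}\cup\{-\infty,\infty\}$, $\mathfrak n_-<0<\mathfrak n_+$, $[g_n]\in\mathcal H(S)$, and segments $\Sigma_n$ on which $\iota$ is an embedding, such that: $\Sigma_0=\Sigma$, and $\Sigma_{\mathfrak n_\pm}$ is a boundary segment of $S$ if $\mathfrak n_\pm\ne\pm\infty$; $\Sigma_p\cap\Sigma_q=\partial_{\Sigma_p}\cap\partial_{\Sigma_q}$ is a singleton for $|p-q|=1$ and empty for $|p-q|\ge2$; $g_n\cdot\iota(\Sigma_0)=\iota(\Sigma_n)$ for $\mathfrak n_-<n<\mathfrak n_+$, and $g_{\mathfrak n_\pm}\cdot\iota(\Sigma_\pm)=\iota(\Sigma_{\mathfrak n_\pm})$ if $\mathfrak n_\pm\neq\pm\infty$, for certain boundary segments $\Sigma_\pm$ of $\Sigma_0$. *)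

theory Defs
  imports "HOL-Analysis.Analysis" "HOL-Algebra.Group_Action"
    "HOL-Library.Extended"
begin

section \<open>Real analytic maps and manifolds\<close>

text \<open>
  Around each point of \<open>U\<close>, the map agrees on \<open>U\<close> with a power series that converges on a full ball
  of the ambient space. Multi-indices are functions on \<^term>\<open>Basis\<close>. The definition is used for \<open>U\<close>
  relatively open in a linear subspace or in the half-line \<open>[0,\<infinity>)\<close>; there it is the usual notion of
  analyticity (up to the boundary in the second case).
\<close>

definition real_analytic_on :: "('a::euclidean_space \<Rightarrow> 'b::euclidean_space) \<Rightarrow> 'a set \<Rightarrow> bool" where
  "real_analytic_on f U \<longleftrightarrow>
     (\<forall>x\<in>U. \<exists>r>0. \<exists>c :: ('a \<Rightarrow> nat) \<Rightarrow> 'b. \<exists>F.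
        (\<forall>y\<in>ball x r.
           ((\<lambda>\<alpha>. (\<Prod>b\<in>Basis. ((y - x) \<bullet> b) ^ \<alpha> b) *\<^sub>R c \<alpha>) has_sum F y) (Basis \<rightarrow>\<^sub>E UNIV)) \<and>
        (\<forall>y\<in>U \<inter> ball x r. f y = F y))"

text \<open>
  Charts take values in relatively open subsets of a common model set: a linear subspace of a Euclidean
  space for manifolds without boundary (so that dimension 0 is included), and \<open>[0,\<infinity>)\<close> for
  1-dimensional manifolds with possibly empty boundary.
\<close>

record ('a, 'e) charted =
  mtop :: "'a topology"
  atlas :: "('a set \<times> ('a \<Rightarrow> 'e)) set"
  model :: "'e set"

abbreviation pts :: "('a, 'e) charted \<Rightarrow> 'a set" where
  "pts M \<equiv> topspace (mtop M)"

definition analytic_atlas :: "('a, 'e::euclidean_space) charted \<Rightarrow> bool" where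
  "analytic_atlas M \<longleftrightarrow>
     (\<forall>(U, f)\<in>atlas M. openin (mtop M) U \<and> openin (top_of_set (model M)) (f ` U) \<and>
        homeomorphic_map (subtopology (mtop M) U) (top_of_set (f ` U)) f) \<and>
     (\<Union>(U, f)\<in>atlas M. U) = pts M \<and>
     (\<forall>(U, f)\<in>atlas M. \<forall>(W, h)\<in>atlas M. real_analytic_on (h \<circ> inv_into U f) (f ` (U \<inter> W)))"

definition analytic_manifold :: "('a, 'e::euclidean_space) charted \<Rightarrow> bool" where
  "analytic_manifold M \<longleftrightarrow> subspace (model M) \<and> analytic_atlas M \<and> Hausdorff_space (mtop M)"

definition analytic_1_manifold_with_boundary :: "('a, real) charted \<Rightarrow> bool" where
  "analytic_1_manifold_with_boundary S \<longleftrightarrow>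
     model S = {0..} \<and> analytic_atlas S \<and> Hausdorff_space (mtop S)"

definition analytic_map ::
    "('a, 'e::euclidean_space) charted \<Rightarrow> ('b, 'f::euclidean_space) charted \<Rightarrow> ('a \<Rightarrow> 'b) \<Rightarrow> bool" where
  "analytic_map M N k \<longleftrightarrow> continuous_map (mtop M) (mtop N) k \<and>
     (\<forall>(U, f)\<in>atlas M. \<forall>(W, h)\<in>atlas N.
        real_analytic_on (h \<circ> k \<circ> inv_into U f) (f ` {x \<in> U. k x \<in> W}))"

definition prod_charted :: "('a, 'e) charted \<Rightarrow> ('b, 'f) charted \<Rightarrow> ('a \<times> 'b, 'e \<times> 'f) charted" where
  "prod_charted M N = \<lparr> mtop = prod_topology (mtop M) (mtop N),
     atlas = {(U \<times> W, map_prod f h) | U f W h. (U, f) \<in> atlas M \<and> (W, h) \<in> atlas N},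
     model = model M \<times> model N \<rparr>"

definition lie_group :: "('g, 'b) monoid_scheme \<Rightarrow> ('g, 'l::euclidean_space) charted \<Rightarrow> bool" where
  "lie_group G \<Gamma> \<longleftrightarrow> group G \<and> analytic_manifold \<Gamma> \<and> pts \<Gamma> = carrier G \<and>
     analytic_map (prod_charted \<Gamma> \<Gamma>) \<Gamma> (\<lambda>(x, y). x \<otimes>\<^bsub>G\<^esub> y) \<and>
     analytic_map \<Gamma> \<Gamma> (\<lambda>x. inv\<^bsub>G\<^esub> x)"


section \<open>Group actions\<close>

definition analytic_in_M ::
    "('g, 'b) monoid_scheme \<Rightarrow> ('g \<Rightarrow> 'm \<Rightarrow> 'm) \<Rightarrow> ('m, 'e::euclidean_space) charted \<Rightarrow> bool" where
  "analytic_in_M G \<phi> M \<longleftrightarrow> (\<forall>g\<in>carrier G. analytic_map M M (\<phi> g))"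

definition non_contractive ::
    "('g, 'b) monoid_scheme \<Rightarrow> ('g \<Rightarrow> 'm \<Rightarrow> 'm) \<Rightarrow> ('m, 'e::euclidean_space) charted \<Rightarrow> bool" where
  "non_contractive G \<phi> M \<longleftrightarrow> analytic_in_M G \<phi> M \<and>
     (\<forall>C x. C \<subseteq> pts M \<and> (\<exists>a\<in>C. \<exists>b\<in>C. a \<noteq> b) \<and> x \<in> pts M - C \<longrightarrow>
        (\<exists>U. openin (mtop M) U \<and> x \<in> U \<and> (\<forall>g\<in>carrier G. \<not> \<phi> g ` C \<subseteq> U)))"


section \<open>Analytic 1-submanifolds\<close>

definition analytic_1_submanifold ::
    "('m, 'e::euclidean_space) charted \<Rightarrow> ('s, real) charted \<Rightarrow> ('s \<Rightarrow> 'm) \<Rightarrow> bool" where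
  "analytic_1_submanifold M S \<iota> \<longleftrightarrow>
     analytic_1_manifold_with_boundary S \<and> pts S \<noteq> {} \<and>
     connected_space (mtop S) \<and> second_countable (mtop S) \<and>
     analytic_map S M \<iota> \<and> inj_on \<iota> (pts S) \<and>
     (\<forall>z\<in>pts S. \<forall>(U, f)\<in>atlas S. \<forall>(W, h)\<in>atlas M. z \<in> U \<and> \<iota> z \<in> W \<longrightarrow>
        (\<exists>D. D \<noteq> 0 \<and> ((h \<circ> \<iota> \<circ> inv_into U f) has_vector_derivative D)
                       (at (f z) within f ` {x \<in> U. \<iota> x \<in> W})))"

definition nondegenerate_interval :: "real set \<Rightarrow> bool" where
  "nondegenerate_interval D \<longleftrightarrow> is_interval D \<and> (\<exists>a\<in>D. \<exists>b\<in>D. a \<noteq> b)"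

abbreviation U1 :: "complex set" where
  "U1 \<equiv> sphere 0 1"

definition circle_type :: "('s, real) charted \<Rightarrow> bool" where
  "circle_type S \<longleftrightarrow> top_of_set U1 homeomorphic_space mtop S"

definition interval_type :: "('s, real) charted \<Rightarrow> bool" where
  "interval_type S \<longleftrightarrow> (\<exists>D. nondegenerate_interval D \<and> top_of_set D homeomorphic_space mtop S)"

definition is_seg :: "('s, real) charted \<Rightarrow> 's set \<Rightarrow> bool" where
  "is_seg S \<Sigma> \<longleftrightarrow> connectedin (mtop S) \<Sigma> \<and> (\<exists>a\<in>\<Sigma>. \<exists>b\<in>\<Sigma>. a \<noteq> b)"

text \<open>
  The result does not depend on the parametrization \<open>\<upsilon>\<close> (nor on \<open>D\<close>), since homeomorphisms between
  intervals preserve interiors in the real line; this is why \<open>\<upsilon>\<close> may be quantified existentially.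
\<close>

definition seg_int :: "('s, real) charted \<Rightarrow> 's set \<Rightarrow> 's set" where
  "seg_int S \<Sigma> = {z.
     (\<exists>\<upsilon>. homeomorphic_map (top_of_set U1) (mtop S) \<upsilon> \<and>
        z \<in> \<upsilon> ` (top_of_set U1 interior_of (U1 \<inter> \<upsilon> -` \<Sigma>))) \<or>
     (\<exists>D \<upsilon>. nondegenerate_interval D \<and> homeomorphic_map (top_of_set D) (mtop S) \<upsilon> \<and>
        z \<in> \<upsilon> ` interior (D \<inter> \<upsilon> -` \<Sigma>))}"

definition seg_bd :: "('s, real) charted \<Rightarrow> 's set \<Rightarrow> 's set" where
  "seg_bd S \<Sigma> = \<Sigma> - seg_int S \<Sigma>"

definition boundary_seg :: "('s, real) charted \<Rightarrow> 's set \<Rightarrow> 's set \<Rightarrow> bool" where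
  "boundary_seg S \<Sigma> \<Sigma>' \<longleftrightarrow> is_seg S \<Sigma>' \<and> \<Sigma>' \<subseteq> \<Sigma> \<and> connectedin (mtop S) (\<Sigma> - \<Sigma>')"

definition embeds_on ::
    "('m, 'e) charted \<Rightarrow> ('s, real) charted \<Rightarrow> ('s \<Rightarrow> 'm) \<Rightarrow> 's set \<Rightarrow> bool" where
  "embeds_on M S \<iota> A \<longleftrightarrow> embedding_map (subtopology (mtop S) A) (mtop M) \<iota>"


section \<open>Free segments\<close>

definition S_stabilizer ::
    "('g, 'b) monoid_scheme \<Rightarrow> ('g \<Rightarrow> 'm \<Rightarrow> 'm) \<Rightarrow> ('s, real) charted \<Rightarrow> ('s \<Rightarrow> 'm) \<Rightarrow> 'g set" where
  "S_stabilizer G \<phi> S \<iota> = (\<Inter>z\<in>pts S. stabilizer G \<phi> (\<iota> z))"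

definition S_class ::
    "('g, 'b) monoid_scheme \<Rightarrow> ('g \<Rightarrow> 'm \<Rightarrow> 'm) \<Rightarrow> ('s, real) charted \<Rightarrow> ('s \<Rightarrow> 'm) \<Rightarrow> 'g \<Rightarrow> 'g set" where
  "S_class G \<phi> S \<iota> g = g <#\<^bsub>G\<^esub> S_stabilizer G \<phi> S \<iota>"

definition sim_o ::
    "('g \<Rightarrow> 'm \<Rightarrow> 'm) \<Rightarrow> ('m, 'e) charted \<Rightarrow> ('s, real) charted \<Rightarrow> ('s \<Rightarrow> 'm) \<Rightarrow>
     'g \<Rightarrow> 's set \<Rightarrow> 's set \<Rightarrow> bool" where
  "sim_o \<phi> M S \<iota> g \<Sigma> \<Sigma>' \<longleftrightarrow>
     (\<exists>V V'. is_seg S V \<and> is_seg S V' \<and> openin (mtop S) V \<and> openin (mtop S) V' \<and>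
        V \<subseteq> \<Sigma> \<and> V' \<subseteq> \<Sigma>' \<and> embeds_on M S \<iota> V \<and> embeds_on M S \<iota> V' \<and>
        \<phi> g ` \<iota> ` V = \<iota> ` V')"

definition free_segs ::
    "('g, 'b) monoid_scheme \<Rightarrow> ('g \<Rightarrow> 'm \<Rightarrow> 'm) \<Rightarrow> ('m, 'e) charted \<Rightarrow> ('s, real) charted \<Rightarrow>
     ('s \<Rightarrow> 'm) \<Rightarrow> 's set set" where
  "free_segs G \<phi> M S \<iota> = {\<Sigma>. is_seg S \<Sigma> \<and>
     (\<forall>g\<in>carrier G. sim_o \<phi> M S \<iota> g \<Sigma> \<Sigma> \<longleftrightarrow> g \<in> S_stabilizer G \<phi> S \<iota>)}"

definition max_segs ::
    "('g, 'b) monoid_scheme \<Rightarrow> ('g \<Rightarrow> 'm \<Rightarrow> 'm) \<Rightarrow> ('m, 'e) charted \<Rightarrow> ('s, real) charted \<Rightarrow>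
     ('s \<Rightarrow> 'm) \<Rightarrow> 's set set" where
  "max_segs G \<phi> M S \<iota> = {\<Sigma> \<in> free_segs G \<phi> M S \<iota>. \<forall>\<Sigma>'\<in>free_segs G \<phi> M S \<iota>. \<not> \<Sigma> \<subset> \<Sigma>'}"

definition free_submanifold ::
    "('g, 'b) monoid_scheme \<Rightarrow> ('g \<Rightarrow> 'm \<Rightarrow> 'm) \<Rightarrow> ('m, 'e) charted \<Rightarrow> ('s, real) charted \<Rightarrow>
     ('s \<Rightarrow> 'm) \<Rightarrow> bool" where
  "free_submanifold G \<phi> M S \<iota> \<longleftrightarrow> free_segs G \<phi> M S \<iota> \<noteq> {}"


section \<open>Negative submanifolds\<close>

text \<open>
  The class \<open>[g\<^sub>z]\<close> attached to a boundary point \<open>z\<close> of a compact maximal segment. As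
  \<^term>\<open>S_stabilizer G \<phi> S \<iota>\<close> is contained in the stabilizer of \<open>\<iota> z\<close>, the condition \<open>g\<^sub>z \<in> G\<^sub>z\<close> does
  not depend on the representative and says that the whole coset lies in that stabilizer.
\<close>

definition gluing_class ::
    "('g, 'b) monoid_scheme \<Rightarrow> ('g \<Rightarrow> 'm \<Rightarrow> 'm) \<Rightarrow> ('m, 'e) charted \<Rightarrow> ('s, real) charted \<Rightarrow>
     ('s \<Rightarrow> 'm) \<Rightarrow> 's set \<Rightarrow> 's \<Rightarrow> 'g set" where
  "gluing_class G \<phi> M S \<iota> \<Sigma> z = (THE c. c \<noteq> S_class G \<phi> S \<iota> \<one>\<^bsub>G\<^esub> \<and>
     (\<exists>g\<in>carrier G. c = S_class G \<phi> S \<iota> g \<and>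
        (\<exists>\<Sigma>b \<Sigma>z b. is_seg S \<Sigma>b \<and> compactin (mtop S) \<Sigma>b \<and> \<Sigma>b \<subseteq> \<Sigma> \<and>
           b \<in> seg_bd S \<Sigma> \<inter> seg_bd S \<Sigma>b \<and>
           \<Sigma>z \<in> free_segs G \<phi> M S \<iota> \<and> compactin (mtop S) \<Sigma>z \<and>
           \<Sigma> \<inter> \<Sigma>z = {z} \<and> seg_bd S \<Sigma> \<inter> seg_bd S \<Sigma>z = {z} \<and>
           \<phi> g ` \<iota> ` \<Sigma>b = \<iota> ` \<Sigma>z \<and> \<phi> g (\<iota> b) = \<iota> z)))"

definition negative_seg ::
    "('g, 'b) monoid_scheme \<Rightarrow> ('g \<Rightarrow> 'm \<Rightarrow> 'm) \<Rightarrow> ('m, 'e) charted \<Rightarrow> ('s, real) charted \<Rightarrow>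
     ('s \<Rightarrow> 'm) \<Rightarrow> 's set \<Rightarrow> bool" where
  "negative_seg G \<phi> M S \<iota> \<Sigma> \<longleftrightarrow>
     (\<forall>z \<in> seg_bd S \<Sigma> \<inter> seg_int S (pts S).
        gluing_class G \<phi> M S \<iota> \<Sigma> z \<subseteq> stabilizer G \<phi> (\<iota> z))"

definition z_decomposition ::
    "('g, 'b) monoid_scheme \<Rightarrow> ('g \<Rightarrow> 'm \<Rightarrow> 'm) \<Rightarrow> ('m, 'e) charted \<Rightarrow> ('s, real) charted \<Rightarrow>
     ('s \<Rightarrow> 'm) \<Rightarrow> 's \<Rightarrow> 'g \<Rightarrow> bool" where
  "z_decomposition G \<phi> M S \<iota> z g \<longleftrightarrow>
     interval_type S \<and> z \<in> seg_int S (pts S) \<and>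
     g \<in> stabilizer G \<phi> (\<iota> z) \<and> S_class G \<phi> S \<iota> g \<noteq> S_class G \<phi> S \<iota> \<one>\<^bsub>G\<^esub> \<and>
     (\<exists>Km Kp \<Sigma>m \<Sigma>p.
        is_seg S Km \<and> compactin (mtop S) Km \<and> is_seg S Kp \<and> compactin (mtop S) Kp \<and>
        \<phi> g ` \<iota> ` Km = \<iota> ` Kp \<and> Km \<inter> Kp = {z} \<and>
        boundary_seg S (pts S) \<Sigma>m \<and> boundary_seg S (pts S) \<Sigma>p \<and>
        pts S = \<Sigma>m \<union> \<Sigma>p \<and> \<Sigma>m \<inter> \<Sigma>p = {z} \<and> Km \<subseteq> \<Sigma>m \<and> Kp \<subseteq> \<Sigma>p \<and>
        \<Sigma>m \<in> free_segs G \<phi> M S \<iota> \<and> \<Sigma>p \<in> free_segs G \<phi> M S \<iota>)"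

definition negative_submanifold ::
    "('g, 'b) monoid_scheme \<Rightarrow> ('g \<Rightarrow> 'm \<Rightarrow> 'm) \<Rightarrow> ('m, 'e) charted \<Rightarrow> ('s, real) charted \<Rightarrow>
     ('s \<Rightarrow> 'm) \<Rightarrow> bool" where
  "negative_submanifold G \<phi> M S \<iota> \<longleftrightarrow>
     \<not> (\<exists>z g. z_decomposition G \<phi> M S \<iota> z g) \<and>
     (\<forall>\<Sigma>\<in>max_segs G \<phi> M S \<iota>. compactin (mtop S) \<Sigma> \<longrightarrow> negative_seg G \<phi> M S \<iota> \<Sigma>)"


section \<open>Decompositions\<close>

text \<open>
  The families of classes are given by representatives \<open>g k\<close>; all conditions are invariant under a
  change of representatives.
\<close>

definition circle_decomposition ::
    "('g, 'b) monoid_scheme \<Rightarrow> ('g \<Rightarrow> 'm \<Rightarrow> 'm) \<Rightarrow> ('m, 'e) charted \<Rightarrow> ('s, real) charted \<Rightarrow>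
     ('s \<Rightarrow> 'm) \<Rightarrow> 's set \<Rightarrow> nat \<Rightarrow> (nat \<Rightarrow> 's set) \<Rightarrow> (nat \<Rightarrow> 'g) \<Rightarrow> bool" where
  "circle_decomposition G \<phi> M S \<iota> \<Sigma> n \<Sigma>s g \<longleftrightarrow>
     circle_type S \<and> \<Sigma> \<in> max_segs G \<phi> M S \<iota> \<and> \<Sigma> \<subset> pts S \<and> n \<ge> 1 \<and>
     (\<forall>k\<le>n. \<Sigma>s k \<in> max_segs G \<phi> M S \<iota> \<and> compactin (mtop S) (\<Sigma>s k) \<and> g k \<in> carrier G) \<and>
     \<Sigma>s 0 = \<Sigma> \<and> pts S = (\<Union>k\<le>n. \<Sigma>s k) \<and>
     (\<forall>k\<le>n. \<phi> (g k) ` \<iota> ` \<Sigma>s 0 = \<iota> ` \<Sigma>s k) \<and>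
     (n = 1 \<longrightarrow>
        \<Sigma>s 0 \<inter> \<Sigma>s 1 = seg_bd S (\<Sigma>s 0) \<inter> seg_bd S (\<Sigma>s 1) \<and>
        \<Sigma>s 0 \<inter> \<Sigma>s 1 = seg_bd S (\<Sigma>s 0) \<and> \<Sigma>s 0 \<inter> \<Sigma>s 1 = seg_bd S (\<Sigma>s 1) \<and>
        card (\<Sigma>s 0 \<inter> \<Sigma>s 1) = 2) \<and>
     (n \<ge> 2 \<longrightarrow>
        (\<forall>p\<le>n. \<forall>q\<le>n.
           (\<bar>int p - int q\<bar> \<in> {1, int n} \<longrightarrow>
              \<Sigma>s p \<inter> \<Sigma>s q = seg_bd S (\<Sigma>s p) \<inter> seg_bd S (\<Sigma>s q) \<and> is_singleton (\<Sigma>s p \<inter> \<Sigma>s q)) \<and>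
           (2 \<le> \<bar>int p - int q\<bar> \<and> \<bar>int p - int q\<bar> \<le> int n - 1 \<longrightarrow>
              \<Sigma>s p \<inter> \<Sigma>s q = seg_bd S (\<Sigma>s p) \<inter> seg_bd S (\<Sigma>s q) \<and> \<Sigma>s p \<inter> \<Sigma>s q = {})))"

definition index_range :: "int extended \<Rightarrow> int extended \<Rightarrow> int set" where
  "index_range a b = {n. a \<le> Fin n \<and> Fin n \<le> b}"

definition interval_decomposition ::
    "('g, 'b) monoid_scheme \<Rightarrow> ('g \<Rightarrow> 'm \<Rightarrow> 'm) \<Rightarrow> ('m, 'e) charted \<Rightarrow> ('s, real) charted \<Rightarrow>
     ('s \<Rightarrow> 'm) \<Rightarrow> 's set \<Rightarrow> int extended \<Rightarrow> int extended \<Rightarrow> (int \<Rightarrow> 's set) \<Rightarrow> (int \<Rightarrow> 'g) \<Rightarrow> bool" where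
  "interval_decomposition G \<phi> M S \<iota> \<Sigma> a b \<Sigma>s g \<longleftrightarrow>
     interval_type S \<and> \<Sigma> \<in> max_segs G \<phi> M S \<iota> \<and> compactin (mtop S) \<Sigma> \<and>
     \<Sigma> \<subset> seg_int S (pts S) \<and> a < Fin 0 \<and> Fin 0 < b \<and>
     (\<forall>n\<in>index_range a b. is_seg S (\<Sigma>s n) \<and> embeds_on M S \<iota> (\<Sigma>s n) \<and> g n \<in> carrier G) \<and>
     \<Sigma>s 0 = \<Sigma> \<and>
     (\<forall>n. Fin n = a \<or> Fin n = b \<longrightarrow> boundary_seg S (pts S) (\<Sigma>s n)) \<and>
     (\<forall>p\<in>index_range a b. \<forall>q\<in>index_range a b.
        (\<bar>p - q\<bar> = 1 \<longrightarrow>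
           \<Sigma>s p \<inter> \<Sigma>s q = seg_bd S (\<Sigma>s p) \<inter> seg_bd S (\<Sigma>s q) \<and> is_singleton (\<Sigma>s p \<inter> \<Sigma>s q)) \<and>
        (\<bar>p - q\<bar> \<ge> 2 \<longrightarrow>
           \<Sigma>s p \<inter> \<Sigma>s q = seg_bd S (\<Sigma>s p) \<inter> seg_bd S (\<Sigma>s q) \<and> \<Sigma>s p \<inter> \<Sigma>s q = {})) \<and>
     (\<forall>n. a < Fin n \<and> Fin n < b \<longrightarrow> \<phi> (g n) ` \<iota> ` \<Sigma>s 0 = \<iota> ` \<Sigma>s n) \<and>
     (\<forall>n. Fin n = a \<or> Fin n = b \<longrightarrow>
        (\<exists>\<Sigma>'. boundary_seg S (\<Sigma>s 0) \<Sigma>' \<and> \<phi> (g n) ` \<iota> ` \<Sigma>' = \<iota> ` \<Sigma>s n))"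

text \<open>Only the values at \<open>n \<noteq> 0\<close> are meaningful.\<close>

definition sigma :: "int \<Rightarrow> int" where
  "sigma n = (if n > 0 then (-1) ^ nat (n - 1) else (-1) ^ nat (- n))"

text \<open>
  The ordered product of the \<open>\<bar>n\<bar>\<close> factors \<open>g (sigma j)\<close>, with \<open>j\<close> running through
  \<open>sgn n, 2 * sgn n, \<dots>, n\<close>.
\<close>

definition sigma_prod :: "('g, 'b) monoid_scheme \<Rightarrow> (int \<Rightarrow> 'g) \<Rightarrow> int \<Rightarrow> 'g" where
  "sigma_prod G g n =
     foldr (\<lambda>x y. x \<otimes>\<^bsub>G\<^esub> y) (map (\<lambda>i. g (sigma (sgn n * i))) [1..\<bar>n\<bar>]) \<one>\<^bsub>G\<^esub>"

end

(* If g carries a segment ending at x to a segment ending at y, and the curve continues beyond x and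
   beyond y, then by analytic continuation g also carries a small piece of the curve beyond x to a
   piece beyond y. By freeness, an element that carries a piece of Sigma into Sigma lies in G_S.
   Negativity says that g_1 and g_{-1} fix the two ends of Sigma. Hence, if p carries Sigma to Sigma_k
   and sends the end fixed by h (h = g_1 or g_{-1}) to the outer end of Sigma_k, then continuing p
   beyond that end shows that p h and g_{k+1} carry pieces of Sigma to overlapping pieces of
   Sigma_{k+1}, so that [g_{k+1}] = [p h]; and p h sends the other end of Sigma to the outer end of
   Sigma_{k+1}. *)

theory Submission
  imports Defs "HOL-Complex_Analysis.Complex_Analysis"
begin

section \<open>Germs of analytic curves\<close>

text \<open>Analytic continuation goes through complexification: \<open>holo_germ\<close> asks every
  scalar component of a curve to extend holomorphically near 0, so that the identity theorem and
  local inversion for functions of one complex variable apply; testing against every vector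
  \<open>v\<close> gives both the basis coordinates and the component along the velocity. Two
  obstacles shape the rest. First, \<iota> need not be an embedding, so a point of the curve close
  to \<iota> y in M may come from a far part of S; \<open>carries\<close> therefore records
  embedding on both segments. Second, negativity concerns a class given by a definite description,
  so using it requires existence and uniqueness. Uniqueness, like several other steps, comes from a
  curve having only two directions at a point (\<open>no_triod\<close>). Circle and interval, and
  both signs of the index, then become instances of one chain statement about segments that meet in
  single points; the parametrization of S supplies the fact that \<Sigma> has at most two
  ends.\<close>

definition holo_germ :: "(real \<Rightarrow> 'e::euclidean_space) \<Rightarrow> bool" where
  "holo_germ \<gamma> \<longleftrightarrow> (\<forall>v. \<exists>r>0. \<exists>H. H holomorphic_on ball 0 r \<and>
     (\<forall>t. \<bar>t\<bar> < r \<longrightarrow> H (of_real t) = of_real (\<gamma> t \<bullet> v)))"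

lemma holo_germE:
  assumes "holo_germ \<gamma>"
  obtains r H where "r > 0" "H holomorphic_on ball 0 r"
    "\<And>t. \<bar>t\<bar> < r \<Longrightarrow> H (of_real t) = of_real (\<gamma> t \<bullet> v)"
  using assms unfolding holo_germ_def by meson

lemma holo_germ_uniform:
  fixes \<gamma> :: "real \<Rightarrow> 'e::euclidean_space"
  assumes "holo_germ \<gamma>"
  obtains r H where "r > 0" "\<And>b. b \<in> Basis \<Longrightarrow> H b holomorphic_on ball 0 r"
    "\<And>b t. b \<in> Basis \<Longrightarrow> \<bar>t\<bar> < r \<Longrightarrow> H b (of_real t) = of_real (\<gamma> t \<bullet> b)"
proof -
  have "\<forall>b. \<exists>r H. r > 0 \<and> H holomorphic_on ball 0 r \<and>
     (\<forall>t. \<bar>t\<bar> < r \<longrightarrow> H (of_real t) = of_real (\<gamma> t \<bullet> b))"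
    using assms unfolding holo_germ_def by blast
  then obtain r H where rH: "\<And>b. r b > 0 \<and> H b holomorphic_on ball 0 (r b) \<and>
     (\<forall>t. \<bar>t\<bar> < r b \<longrightarrow> H b (of_real t) = of_real (\<gamma> t \<bullet> b))" by metis
  define \<rho> where "\<rho> = Min (r ` (Basis :: 'e set))"
  have \<rho>: "\<rho> > 0" "\<And>b. b \<in> Basis \<Longrightarrow> \<rho> \<le> r b"
    unfolding \<rho>_def using rH by (auto simp: Min_gr_iff)
  show thesis
  proof (rule that[of \<rho> H])
    fix b :: 'e assume b: "b \<in> Basis"
    show "H b holomorphic_on ball 0 \<rho>"
      by (rule holomorphic_on_subset[of _ "ball 0 (r b)"]) (use rH in \<open>auto intro: less_le_trans[OF _ \<rho>(2)[OF b]]\<close>)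
    fix t assume "\<bar>t\<bar> < \<rho>"
    then show "H b (of_real t) = of_real (\<gamma> t \<bullet> b)" using rH[of b] \<rho>(2)[OF b] by auto
  qed (rule \<rho>)
qed

lemma holo_germ_isCont:
  fixes \<gamma> :: "real \<Rightarrow> 'e::euclidean_space"
  assumes "holo_germ \<gamma>"
  shows "isCont \<gamma> 0"
proof -
  obtain r H where r: "r > 0" and H: "\<And>b. b \<in> Basis \<Longrightarrow> H b holomorphic_on ball 0 r"
    and eq: "\<And>b t. b \<in> Basis \<Longrightarrow> \<bar>t\<bar> < r \<Longrightarrow> H b (of_real t) = of_real (\<gamma> t \<bullet> b)"
    using holo_germ_uniform[OF assms] by blast
  have "isCont (\<lambda>t. \<gamma> t \<bullet> b) 0" if b: "b \<in> Basis" for b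
  proof -
    have "continuous_on (ball 0 r) (H b)" using H[OF b] by (rule holomorphic_on_imp_continuous_on)
    then have "isCont (H b) (of_real 0)"
      using r by (simp add: continuous_on_eq_continuous_at)
    then have "isCont (\<lambda>t. Re (H b (of_real t))) 0"
      by (intro isCont_Re isCont_o2[of 0 complex_of_real "H b"] isCont_of_real) simp_all
    moreover have "\<forall>\<^sub>F t in nhds (0::real). Re (H b (of_real t)) = \<gamma> t \<bullet> b"
      using eventually_nhds_in_open[of "ball 0 r" "0::real"] r
      by (auto elim!: eventually_mono simp: eq[OF b])
    ultimately show ?thesis using isCont_cong by force
  qed
  then show ?thesis
    unfolding isCont_def using tendsto_componentwise_iff by blast
qed

text \<open>On a slightly larger polydisc than the one reached by the curve the series converges absolutely,
  so it may be evaluated at the holomorphic extensions of the coordinates of the curve.\<close>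

lemma holo_germ_compose:
  fixes \<gamma> :: "real \<Rightarrow> 'a::euclidean_space" and F :: "'a \<Rightarrow> 'b::euclidean_space"
  assumes F: "real_analytic_on F X" and \<gamma>: "holo_germ \<gamma>"
    and "\<delta> > 0" and X: "\<And>t. \<bar>t\<bar> < \<delta> \<Longrightarrow> \<gamma> t \<in> X"
  shows "holo_germ (\<lambda>t. F (\<gamma> t))"
  unfolding holo_germ_def
proof
  fix v :: 'b
  let ?I = "(Basis :: 'a set) \<rightarrow>\<^sub>E (UNIV :: nat set)"
  have "\<gamma> 0 \<in> X" using X \<open>\<delta> > 0\<close> by simp
  from bspec[OF F[unfolded real_analytic_on_def] this] obtain r c F' where r: "r > 0"
    and "\<forall>y\<in>ball (\<gamma> 0) r.
      ((\<lambda>\<alpha>. (\<Prod>b\<in>Basis. ((y - \<gamma> 0) \<bullet> b) ^ \<alpha> b) *\<^sub>R c \<alpha>) has_sum F' y) ?I"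
    and "\<forall>y\<in>X \<inter> ball (\<gamma> 0) r. F y = F' y"
    by (elim exE conjE)
  note sums = bspec[OF this(2)] and F' = bspec[OF this(3)]
  obtain s H where s: "s > 0" and H: "\<And>b. b \<in> Basis \<Longrightarrow> H b holomorphic_on ball 0 s"
    and eqH: "\<And>b t. b \<in> Basis \<Longrightarrow> \<bar>t\<bar> < s \<Longrightarrow> H b (of_real t) = of_real (\<gamma> t \<bullet> b)"
    using holo_germ_uniform[OF \<gamma>] by blast
  define w where "w b z = H b z - of_real (\<gamma> 0 \<bullet> b)" for b z
  \<comment> \<open>Displacing all \<open>DIM('a)\<close> coordinates by \<rho> at once moves a
    point by at most r / 2, so \<open>y0\<close> stays in the ball of convergence.\<close>
  define \<rho> where "\<rho> = r / (2 * DIM('a))"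
  have \<rho>: "\<rho> > 0" using r by (simp add: \<rho>_def)
  define y0 where "y0 = \<gamma> 0 + (\<Sum>b\<in>Basis. \<rho> *\<^sub>R b)"
  have "norm (\<Sum>b\<in>(Basis::'a set). \<rho> *\<^sub>R b) \<le> (\<Sum>b\<in>(Basis::'a set). \<rho>)"
    by (rule sum_norm_le) (use \<rho> in auto)
  also have "\<dots> < r" using r by (simp add: \<rho>_def)
  finally have y0: "y0 \<in> ball (\<gamma> 0) r"
    unfolding y0_def mem_ball by (simp add: dist_norm)
  \<comment> \<open>Convergence at the single point \<open>y0\<close>, all of whose coordinates
    relative to \<gamma> 0 equal \<rho>, is absolute because the summation is unordered. Its terms
    are the majorants for the Weierstrass test wherever every \<open>w b z\<close> has norm at most
    \<rho>.\<close>
  define M where "M \<alpha> = norm ((\<Prod>b\<in>(Basis::'a set). \<rho> ^ \<alpha> b) *\<^sub>R (c \<alpha> \<bullet> v))" for \<alpha>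
  have "((\<lambda>\<alpha>. (\<Prod>b\<in>Basis. \<rho> ^ \<alpha> b) *\<^sub>R c \<alpha>) has_sum F' y0) ?I"
    using sums[OF y0] by (simp add: y0_def cong: prod.cong)
  then have "((\<lambda>\<alpha>. ((\<Prod>b\<in>Basis. \<rho> ^ \<alpha> b) *\<^sub>R c \<alpha>) \<bullet> v) has_sum (F' y0 \<bullet> v)) ?I"
    by (rule has_sum_bounded_linear[OF bounded_linear_inner_left, unfolded o_def])
  then have "(\<lambda>\<alpha>. (\<Prod>b\<in>Basis. \<rho> ^ \<alpha> b) *\<^sub>R (c \<alpha> \<bullet> v)) summable_on ?I"
    by (auto simp: summable_on_def)
  then have M: "M summable_on ?I"
    unfolding M_def by (rule summable_on_iff_abs_summable_on_real[THEN iffD1])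
  have "\<exists>q>0. \<forall>z. norm z < q \<longrightarrow> norm (w b z) < \<rho>" if b: "b \<in> Basis" for b
  proof -
    have "continuous_on (ball 0 s) (w b)"
      unfolding w_def by (intro continuous_intros holomorphic_on_imp_continuous_on[OF H[OF b]])
    then have "isCont (w b) 0" using s by (simp add: continuous_on_eq_continuous_at)
    moreover have "w b 0 = 0" using eqH[OF b, of 0] s by (simp add: w_def)
    ultimately show ?thesis
      using \<rho> by (force simp: continuous_at_eps_delta)
  qed
  then obtain q where q: "\<And>b. b \<in> Basis \<Longrightarrow> q b > 0 \<and> (\<forall>z. norm z < q b \<longrightarrow> norm (w b z) < \<rho>)"
    by metis
  define Q where "Q = Min (q ` (Basis :: 'a set))"
  have Q: "Q > 0" "\<And>b. b \<in> Basis \<Longrightarrow> Q \<le> q b"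
    unfolding Q_def using q by (auto simp: Min_gr_iff)
  obtain \<eta> where \<eta>: "\<eta> > 0" "\<And>t. \<bar>t\<bar> < \<eta> \<Longrightarrow> \<gamma> t \<in> ball (\<gamma> 0) r"
    using holo_germ_isCont[OF \<gamma>] r by (auto simp: continuous_at_eps_delta dist_commute)
  \<comment> \<open>Halving keeps the closed disc of radius \<open>R\<close>, on which the
    convergence is uniform, strictly inside all four radii.\<close>
  define R where "R = Min {Q, s, \<eta>, \<delta>} / 2"
  have R: "R > 0" "R < Q" "R < s" "R < \<eta>" "R < \<delta>"
    using Q(1) s \<eta> \<open>\<delta> > 0\<close> by (auto simp: R_def min_def)
  define K where "K z = (\<Sum>\<^sub>\<infinity>\<alpha>\<in>?I. (\<Prod>b\<in>Basis. w b z ^ \<alpha> b) * complex_of_real (c \<alpha> \<bullet> v))" for z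
  have wle: "norm (w b z) \<le> \<rho>" if "b \<in> Basis" "z \<in> cball 0 R" for b z
  proof -
    have "norm z < q b" using that R Q(2)[OF that(1)] by auto
    then show ?thesis using q[OF that(1)] by force
  qed
  have ul: "uniform_limit (cball 0 R)
      (\<lambda>Y z. \<Sum>\<alpha>\<in>Y. (\<Prod>b\<in>Basis. w b z ^ \<alpha> b) * complex_of_real (c \<alpha> \<bullet> v)) K
      (finite_subsets_at_top ?I)"
    unfolding K_def
  proof (rule Weierstrass_m_test_general[OF _ M])
    fix \<alpha> z assume z: "z \<in> cball (0::complex) R"
    have "(\<Prod>b\<in>Basis. norm (w b z) ^ \<alpha> b) \<le> (\<Prod>b\<in>(Basis::'a set). \<rho> ^ \<alpha> b)"
      by (intro prod_mono conjI power_mono) (use wle z in auto)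
    then show "norm ((\<Prod>b\<in>Basis. w b z ^ \<alpha> b) * complex_of_real (c \<alpha> \<bullet> v)) \<le> M \<alpha>"
      unfolding M_def using \<rho>
      by (auto simp: norm_mult abs_mult prod_norm[symmetric] norm_power abs_prod intro!: mult_right_mono)
  qed
  have "K holomorphic_on ball 0 R"
  proof (rule holomorphic_uniform_limit[OF _ ul])
    have wh: "w b holomorphic_on cball 0 R" if "b \<in> Basis" for b
      unfolding w_def
      by (intro holomorphic_intros holomorphic_on_subset[OF H[OF that]]) (use R in auto)
    have "(\<lambda>z. \<Sum>\<alpha>\<in>Y. (\<Prod>b\<in>Basis. w b z ^ \<alpha> b) * complex_of_real (c \<alpha> \<bullet> v)) holomorphic_on cball 0 R" for Y
      by (intro holomorphic_intros wh) auto
    then show "\<forall>\<^sub>F Y in finite_subsets_at_top ?I.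
        continuous_on (cball 0 R) (\<lambda>z. \<Sum>\<alpha>\<in>Y. (\<Prod>b\<in>Basis. w b z ^ \<alpha> b) * complex_of_real (c \<alpha> \<bullet> v)) \<and>
        (\<lambda>z. \<Sum>\<alpha>\<in>Y. (\<Prod>b\<in>Basis. w b z ^ \<alpha> b) * complex_of_real (c \<alpha> \<bullet> v)) holomorphic_on ball 0 R"
      using holomorphic_on_imp_continuous_on holomorphic_on_subset[OF _ ball_subset_cball]
      by (blast intro: always_eventually)
  qed auto
  moreover have "K (of_real t) = of_real (F (\<gamma> t) \<bullet> v)" if t: "\<bar>t\<bar> < R" for t
  proof -
    have "\<gamma> t \<in> X \<inter> ball (\<gamma> 0) r" using X \<eta> R t by auto
    then have FF: "F (\<gamma> t) = F' (\<gamma> t)" and b: "\<gamma> t \<in> ball (\<gamma> 0) r" using F' by auto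
    have "((\<lambda>\<alpha>. complex_of_real (((\<Prod>b\<in>Basis. ((\<gamma> t - \<gamma> 0) \<bullet> b) ^ \<alpha> b) *\<^sub>R c \<alpha>) \<bullet> v)) has_sum
        complex_of_real (F' (\<gamma> t) \<bullet> v)) ?I"
      unfolding has_sum_of_real_iff
      using has_sum_bounded_linear[OF bounded_linear_inner_left sums[OF b], of v]
      by (simp add: o_def)
    then have "((\<lambda>\<alpha>. (\<Prod>b\<in>Basis. w b t ^ \<alpha> b) * complex_of_real (c \<alpha> \<bullet> v)) has_sum
        complex_of_real (F' (\<gamma> t) \<bullet> v)) ?I"
      using t R by (simp add: w_def eqH inner_diff_left cong: prod.cong)
    then show ?thesis unfolding K_def FF by (rule infsumI)
  qed
  ultimately show "\<exists>r>0. \<exists>H. H holomorphic_on ball 0 r \<and>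
     (\<forall>t. \<bar>t\<bar> < r \<longrightarrow> H (of_real t) = of_real (F (\<gamma> t) \<bullet> v))"
    using R(1) by blast
qed

lemma holo_germ_affine: "holo_germ (\<lambda>t::real. a + s * t :: real)"
  unfolding holo_germ_def
  by (intro allI exI[of _ 1] conjI exI[of _ "\<lambda>z. of_real v * (of_real a + of_real s * z)" for v])
    (auto intro!: holomorphic_intros)

lemma islimpt_of_real_right:
  assumes "0 < (d::real)"
  shows "(0::complex) islimpt complex_of_real ` {0..<d}"
proof (rule islimptI)
  fix V assume "(0::complex) \<in> V" "open V"
  then obtain e where e: "e > 0" "ball 0 e \<subseteq> V" by (meson openE)
  define y where "y = min e d / 2"
  have y: "0 < y" "y < e" "y < d" using e(1) assms by (auto simp: y_def)
  then have "of_real y \<in> complex_of_real ` {0..<d}" "complex_of_real y \<in> ball 0 e"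
      "complex_of_real y \<noteq> 0"
    by auto
  then show "\<exists>z\<in>complex_of_real ` {0..<d}. z \<in> V \<and> z \<noteq> 0" using e by blast
qed

text \<open>Schwarz reflection: \<open>T z - cnj (T (cnj z))\<close> is holomorphic on the disc and
  vanishes on [0, d), which accumulates at 0. A complex reparametrization known to be real only to
  the right of 0 thus becomes a real function on both sides.\<close>

lemma holomorphic_cnj_symmetric:
  assumes T: "T holomorphic_on ball 0 r" and "0 < d" "d \<le> r"
    and real: "\<And>t. 0 \<le> t \<Longrightarrow> t < d \<Longrightarrow> T (of_real t) \<in> \<real>"
    and t: "\<bar>t\<bar> < r"
  shows "T (of_real t) \<in> \<real>"
proof -
  have cb: "cnj ` ball 0 r = ball 0 r" by (auto simp: image_cnj_conv_vimage_cnj)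
  have "T (of_real t) - cnj (T (cnj (of_real t))) = 0"
  proof (rule analytic_continuation[where f="\<lambda>z. T z - cnj (T (cnj z))" and w="of_real t" and S="ball 0 r" and U="complex_of_real ` {0..<d}" and \<xi>=0])
    show "(\<lambda>z. T z - cnj (T (cnj z))) holomorphic_on ball 0 r"
      using T holomorphic_on_compose_cnj_cnj[of T "ball 0 r"] cb
      by (intro holomorphic_intros) (auto simp: o_def)
    show "(0::complex) islimpt complex_of_real ` {0..<d}"
      using \<open>0 < d\<close> by (rule islimpt_of_real_right)
  next
    fix z assume "z \<in> complex_of_real ` {0..<d}"
    then obtain u where "z = of_real u" "0 \<le> u" "u < d" by auto
    then show "T z - cnj (T (cnj z)) = 0" using real[of u] by (auto elim: Reals_cases)
  qed (use t \<open>0 < d\<close> \<open>d \<le> r\<close> in auto)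
  then have "cnj (T (of_real t)) = T (of_real t)" by simp
  then show ?thesis by (simp add: Reals_cnj_iff)
qed

lemma holomorphic_eq_if_eq_right:
  assumes f: "f holomorphic_on ball 0 r" and g: "g holomorphic_on ball 0 r" and "0 < d" "d \<le> r"
    and eq: "\<And>t. 0 \<le> t \<Longrightarrow> t < d \<Longrightarrow> f (complex_of_real t) = g (of_real t)"
    and z: "z \<in> ball 0 r"
  shows "f z = g z"
proof -
  have "f z - g z = 0"
  proof (rule analytic_continuation[where f="\<lambda>z. f z - g z" and w=z and S="ball 0 r" and U="complex_of_real ` {0..<d}" and \<xi>=0])
    show "(\<lambda>z. f z - g z) holomorphic_on ball 0 r" using f g by (intro holomorphic_intros)
    show "(0::complex) islimpt complex_of_real ` {0..<d}"
      using \<open>0 < d\<close> by (rule islimpt_of_real_right)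
  qed (use z \<open>0 < d\<close> \<open>d \<le> r\<close> eq in auto)
  then show ?thesis by simp
qed

text \<open>Near \<open>0\<close> the curve \<open>\<beta>\<close> is recovered from its component along its velocity, so \<open>\<tau>\<close> is
  a local inverse of that component applied to \<open>\<alpha>\<close>; the identity theorem carries \<open>\<alpha> = \<beta> \<circ> \<tau>\<close> from
  the right of \<open>0\<close> to both sides.\<close>

lemma germ_continuation:
  fixes \<alpha> \<beta> :: "real \<Rightarrow> 'e::euclidean_space"
  assumes \<alpha>: "holo_germ \<alpha>" and \<beta>: "holo_germ \<beta>"
    and D: "(\<beta> has_vector_derivative D) (at 0)" "D \<noteq> 0"
    and right: "\<And>\<eta>. \<eta> > 0 \<Longrightarrow> \<exists>\<delta>>0. \<forall>u. 0 \<le> u \<and> u < \<delta> \<longrightarrow> (\<exists>v. 0 \<le> v \<and> v < \<eta> \<and> \<alpha> u = \<beta> v)"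
  obtains \<tau> \<epsilon> where "\<epsilon> > 0" "continuous_on {-\<epsilon><..<\<epsilon>} \<tau>" "\<tau> 0 = 0"
    "\<And>u. \<bar>u\<bar> < \<epsilon> \<Longrightarrow> \<alpha> u = \<beta> (\<tau> u)" "\<And>u. 0 \<le> u \<Longrightarrow> u < \<epsilon> \<Longrightarrow> 0 \<le> \<tau> u"
proof -
  \<comment> \<open>At u = 0 the hypothesis \<open>right\<close> gives arbitrarily small parameters
    v with \<alpha> 0 = \<beta> v, so continuity of \<beta> decides.\<close>
  have eq0: "\<alpha> 0 = \<beta> 0"
  proof (rule ccontr)
    assume "\<alpha> 0 \<noteq> \<beta> 0"
    then obtain \<eta> where \<eta>: "\<eta> > 0" "\<forall>v. dist v 0 < \<eta> \<longrightarrow> dist (\<beta> v) (\<beta> 0) < dist (\<alpha> 0) (\<beta> 0)"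
      using holo_germ_isCont[OF \<beta>, unfolded continuous_at_eps_delta, rule_format, of "dist (\<alpha> 0) (\<beta> 0)"]
      by auto
    obtain \<delta> where "\<delta> > 0" "\<forall>u. 0 \<le> u \<and> u < \<delta> \<longrightarrow> (\<exists>v. 0 \<le> v \<and> v < \<eta> \<and> \<alpha> u = \<beta> v)"
      using right[OF \<eta>(1)] by blast
    then obtain v where v: "0 \<le> v" "v < \<eta>" "\<alpha> 0 = \<beta> v" by auto
    then have "dist v 0 < \<eta>" by simp
    then have "dist (\<beta> v) (\<beta> 0) < dist (\<alpha> 0) (\<beta> 0)" using \<eta>(2) by blast
    with v(3) show False by simp
  qed
  obtain r1 B where r1: "r1 > 0" and B: "B holomorphic_on ball 0 r1"
    and eqB: "\<And>t. \<bar>t\<bar> < r1 \<Longrightarrow> B (of_real t) = of_real (\<beta> t \<bullet> D)" by (rule holo_germE[OF \<beta>, of D]) blast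
  obtain r2 A where r2: "r2 > 0" and A: "A holomorphic_on ball 0 r2"
    and eqA: "\<And>t. \<bar>t\<bar> < r2 \<Longrightarrow> A (of_real t) = of_real (\<alpha> t \<bullet> D)" by (rule holo_germE[OF \<alpha>, of D]) blast
  obtain r3 Bs where r3: "r3 > 0" and Bs: "\<And>b. b \<in> Basis \<Longrightarrow> Bs b holomorphic_on ball 0 r3"
    and eqBs: "\<And>b t. b \<in> Basis \<Longrightarrow> \<bar>t\<bar> < r3 \<Longrightarrow> Bs b (of_real t) = of_real (\<beta> t \<bullet> b)"
    using holo_germ_uniform[OF \<beta>] by blast
  obtain r4 As where r4: "r4 > 0" and As: "\<And>b. b \<in> Basis \<Longrightarrow> As b holomorphic_on ball 0 r4"
    and eqAs: "\<And>b t. b \<in> Basis \<Longrightarrow> \<bar>t\<bar> < r4 \<Longrightarrow> As b (of_real t) = of_real (\<alpha> t \<bullet> b)"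
    using holo_germ_uniform[OF \<alpha>] by blast
  \<comment> \<open>The component of \<beta> along its own velocity has derivative
    \<open>D \<bullet> D\<close> at 0, which is nonzero; hence \<open>B\<close> is invertible near
    0.\<close>
  have dB: "deriv B 0 \<noteq> 0"
  proof
    assume 0: "deriv B 0 = 0"
    have "(B has_field_derivative deriv B 0) (at (of_real 0))"
      using holomorphic_derivI[OF B open_ball, of 0] r1 by simp
    then have "((\<lambda>t. B (of_real t)) has_vector_derivative deriv B 0) (at 0)"
      by (rule has_vector_derivative_real_field)
    then have "((\<lambda>t. complex_of_real (\<beta> t \<bullet> D)) has_vector_derivative deriv B 0) (at 0)"
      by (rule has_vector_derivative_transform_within_open[where S="ball 0 r1"])
        (use r1 in \<open>auto simp: eqB\<close>)
    moreover have "((\<lambda>t. \<beta> t \<bullet> D) has_vector_derivative D \<bullet> D) (at 0)"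
      using bounded_linear.has_vector_derivative[OF bounded_linear_inner_left D(1)] .
    then have "((\<lambda>t. complex_of_real (\<beta> t \<bullet> D)) has_vector_derivative of_real (D \<bullet> D)) (at 0)"
      by (rule bounded_linear.has_vector_derivative[OF bounded_linear_of_real])
    ultimately have "deriv B 0 = of_real (D \<bullet> D)" by (rule vector_derivative_unique_at)
    then show False using 0 D(2) by simp
  qed
  have "0 \<in> ball (0::complex) r1" using r1 by simp
  then obtain q where q: "q > 0" "ball (0::complex) q \<subseteq> ball 0 r1" "open (B ` ball 0 q)" "inj_on B (ball 0 q)"
    by (rule has_complex_derivative_locally_invertible[OF B _ open_ball dB]) (rule that)
  have "B holomorphic_on ball 0 q" using B q(2) by (rule holomorphic_on_subset)
  then obtain g where g: "g holomorphic_on B ` ball 0 q" and gB: "\<And>z. z \<in> ball 0 q \<Longrightarrow> g (B z) = z"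
    using holomorphic_has_inverse[OF _ open_ball q(4)] by metis
  have "q \<le> r1" using q by (simp add: ball_subset_ball_iff)
  have AB0: "A 0 = B 0" using eqA[of 0] eqB[of 0] r1 r2 eq0 by simp
  then have A0: "A 0 \<in> B ` ball 0 q" using q(1) by simp
  have contA: "isCont A 0"
    using holomorphic_on_imp_continuous_on[OF A] r2 by (simp add: continuous_on_eq_continuous_at)
  obtain e where e: "e > 0" "ball (A 0) e \<subseteq> B ` ball 0 q" using q(3) A0 by (rule openE)
  obtain p where p0: "p > 0" "\<forall>z. dist z 0 < p \<longrightarrow> dist (A z) (A 0) < e"
    using contA[unfolded continuous_at_eps_delta, rule_format, OF e(1)] by blast
  have p: "A z \<in> B ` ball 0 q" if "norm z < p" for z
    using p0 e(2) that by (auto simp: dist_commute subset_eq)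
  define p1 where "p1 = min p r2"
  have p1: "p1 > 0" "p1 \<le> p" "p1 \<le> r2" using p0 r2 by (auto simp: p1_def)
  define T where "T = g \<circ> A"
  have T: "T holomorphic_on ball 0 p1" unfolding T_def
    by (rule holomorphic_on_compose_gen[OF holomorphic_on_subset[OF A] g]) (use p p1 in \<open>auto intro: p\<close>)
  have T0: "T 0 = 0" using gB[of 0] q by (simp add: T_def AB0)
  have contT: "isCont T 0"
    using holomorphic_on_imp_continuous_on[OF T] p1 by (simp add: continuous_on_eq_continuous_at)
  obtain p2 where "p2 > 0" "\<forall>z. dist z 0 < p2 \<longrightarrow> dist (T z) (T 0) < r3"
    using contT[unfolded continuous_at_eps_delta, rule_format, OF r3] by blast
  then have p2: "p2 > 0" "\<And>z. norm z < p2 \<Longrightarrow> norm (T z) < r3" by (auto simp: T0)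
  define \<epsilon> where "\<epsilon> = Min {p1, p2, r4}"
  have \<epsilon>: "\<epsilon> > 0" "\<epsilon> \<le> p1" "\<epsilon> \<le> p2" "\<epsilon> \<le> r4" using p1 p2 r4 by (auto simp: \<epsilon>_def)
  \<comment> \<open>A parameter v below \<open>q\<close> lies in the disc where \<open>g\<close>
    inverts \<open>B\<close>, which gives T u = v; a parameter below \<open>r3\<close> lies where
    the coordinate extensions \<open>Bs\<close> are defined.\<close>
  obtain \<delta> where \<delta>: "\<delta> > 0" and rt: "\<And>u. 0 \<le> u \<Longrightarrow> u < \<delta> \<Longrightarrow> (\<exists>v. 0 \<le> v \<and> v < min q r3 \<and> \<alpha> u = \<beta> v)"
    using right[of "min q r3"] q(1) r3 by auto
  define d where "d = min \<delta> \<epsilon>"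
  have d: "d > 0" "d \<le> \<delta>" "d \<le> \<epsilon>" using \<delta> \<epsilon> by (auto simp: d_def)
  have Tv: "\<exists>v. 0 \<le> v \<and> v < min q r3 \<and> \<alpha> u = \<beta> v \<and> T (of_real u) = of_real v" if u: "0 \<le> u" "u < d" for u
  proof -
    obtain v where v: "0 \<le> v" "v < min q r3" "\<alpha> u = \<beta> v" using rt[of u] u d by auto
    have "A (of_real u) = of_real (\<alpha> u \<bullet> D)" using u d \<epsilon> p1 by (intro eqA) auto
    also have "\<dots> = B (of_real v)" using v \<open>q \<le> r1\<close> by (subst eqB) auto
    finally have "T (of_real u) = of_real v" using gB[of "of_real v"] v by (simp add: T_def)
    then show ?thesis using v by blast
  qed
  have T\<epsilon>: "T holomorphic_on ball 0 \<epsilon>" using T \<epsilon> by (auto elim: holomorphic_on_subset)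
  have Treal: "T (of_real u) \<in> \<real>" if "\<bar>u\<bar> < \<epsilon>" for u
    by (rule holomorphic_cnj_symmetric[OF T\<epsilon> d(1) d(3) _ that]) (use Tv in force)
  define \<tau> where "\<tau> u = Re (T (of_real u))" for u
  have T\<tau>: "T (of_real u) = of_real (\<tau> u)" if "\<bar>u\<bar> < \<epsilon>" for u
    using Treal[OF that] by (simp add: \<tau>_def)
  \<comment> \<open>\<open>T\<close> was built from the single component along \<open>D\<close>.
    Equality of all coordinates is known to the right of 0 and spreads by the identity
    theorem.\<close>
  have AB: "As b z = Bs b (T z)" if b: "b \<in> Basis" and z: "z \<in> ball 0 \<epsilon>" for b z
  proof (rule holomorphic_eq_if_eq_right[OF _ _ d(1) d(3) _ z])
    show "As b holomorphic_on ball 0 \<epsilon>" using As[OF b] \<epsilon> by (auto elim: holomorphic_on_subset)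
    show "(\<lambda>z. Bs b (T z)) holomorphic_on ball 0 \<epsilon>"
    proof -
      have "T ` ball 0 \<epsilon> \<subseteq> ball 0 r3"
      proof
        fix y assume "y \<in> T ` ball 0 \<epsilon>"
        then obtain z where "norm z < \<epsilon>" "y = T z" by auto
        then show "y \<in> ball 0 r3" using p2(2)[of z] \<epsilon>(3) by simp
      qed
      from holomorphic_on_compose_gen[OF T\<epsilon> Bs[OF b] this] show ?thesis by (simp add: o_def)
    qed
    fix u assume u: "0 \<le> u" "u < d"
    then obtain v where v: "0 \<le> v" "v < min q r3" "\<alpha> u = \<beta> v" "T (of_real u) = of_real v" using Tv by blast
    then show "As b (of_real u) = Bs b (T (of_real u))"
      using u d \<epsilon> by (simp add: eqAs[OF b] eqBs[OF b])
  qed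
  have \<alpha>\<tau>: "\<alpha> u = \<beta> (\<tau> u)" if u: "\<bar>u\<bar> < \<epsilon>" for u
  proof (rule euclidean_eqI)
    fix b :: 'e assume b: "b \<in> Basis"
    have "norm (T (of_real u)) < r3" using p2(2)[of "of_real u"] u \<epsilon> by simp
    then have "\<bar>\<tau> u\<bar> < r3" using T\<tau>[OF u] by simp
    have "complex_of_real (\<alpha> u \<bullet> b) = As b (of_real u)" using eqAs[OF b] u \<epsilon> by simp
    also have "\<dots> = Bs b (T (of_real u))" using AB[OF b] u by simp
    also have "\<dots> = of_real (\<beta> (\<tau> u) \<bullet> b)" using eqBs[OF b] \<open>\<bar>\<tau> u\<bar> < r3\<close> T\<tau>[OF u] by simp
    finally show "\<alpha> u \<bullet> b = \<beta> (\<tau> u) \<bullet> b" by (simp only: of_real_eq_iff)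
  qed
  have c\<tau>: "continuous_on {-d<..<d} \<tau>" unfolding \<tau>_def
    by (intro continuous_intros continuous_on_compose2[OF holomorphic_on_imp_continuous_on[OF T\<epsilon>]])
      (use d in auto)
  show thesis
  proof (rule that[OF d(1) c\<tau>])
    show "\<tau> 0 = 0" using T0 by (simp add: \<tau>_def)
    show "\<alpha> u = \<beta> (\<tau> u)" if "\<bar>u\<bar> < d" for u using \<alpha>\<tau> that d by simp
    show "0 \<le> \<tau> u" if "0 \<le> u" "u < d" for u using Tv[OF that] by (auto simp: \<tau>_def)
  qed
qed

section \<open>Carrying segments by group elements\<close>

lemma is_segD:
  assumes "is_seg S A"
  shows "connectedin (mtop S) A" "A \<subseteq> pts S"
  using assms connectedin_subset_topspace unfolding is_seg_def by blast+

lemma embeds_on_mono: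
  assumes "embeds_on M S \<iota> B" "A \<subseteq> B"
  shows "embeds_on M S \<iota> A"
proof -
  let ?A = "pts S \<inter> A" and ?B = "pts S \<inter> B"
  have "homeomorphic_map (subtopology (mtop S) B) (subtopology (mtop M) (\<iota> ` ?B)) \<iota>"
    using assms(1) by (simp add: embeds_on_def embedding_map_def)
  moreover have "\<iota> ` (topspace (subtopology (mtop S) B) \<inter> A)
      = topspace (subtopology (mtop M) (\<iota> ` ?B)) \<inter> \<iota> ` ?A"
  proof -
    have "topspace (subtopology (mtop S) B) \<inter> A = ?A" "\<iota> ` ?A \<subseteq> \<iota> ` ?B"
      using assms(2) by auto
    moreover have "topspace (subtopology (mtop M) (\<iota> ` ?B)) = \<iota> ` ?B"
      using homeomorphic_imp_surjective_map[OF \<open>homeomorphic_map _ _ _\<close>]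
      unfolding topspace_subtopology by (rule sym)
    ultimately show ?thesis by blast
  qed
  ultimately have "homeomorphic_map (subtopology (subtopology (mtop S) B) A)
      (subtopology (subtopology (mtop M) (\<iota> ` ?B)) (\<iota> ` ?A)) \<iota>"
    by (rule homeomorphic_map_subtopologies)
  moreover have "B \<inter> A = A" "\<iota> ` ?B \<inter> \<iota> ` ?A = \<iota> ` ?A" using assms(2) by auto
  ultimately show ?thesis
    by (simp add: embeds_on_def embedding_map_def subtopology_subtopology)
qed

locale curve_action =
  fixes G :: "('g, 'b) monoid_scheme" (structure)
    and M :: "('m, 'e::euclidean_space) charted"
    and S :: "('s, real) charted"
    and \<phi> :: "'g \<Rightarrow> 'm \<Rightarrow> 'm"
    and \<iota> :: "'s \<Rightarrow> 'm"
  assumes action: "group_action G (pts M) \<phi>"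
    and manifold: "analytic_manifold M"
    and analytic: "analytic_in_M G \<phi> M"
    and curve: "analytic_1_submanifold M S \<iota>"
begin

sublocale group_action G "pts M" \<phi> by (rule action)

sublocale group G using group_hom group_hom.axioms(1) by blast

lemma Hausdorff: "Hausdorff_space (mtop S)" "Hausdorff_space (mtop M)"
  and atlas_S: "analytic_atlas S" and model_S: "model S = {0..}" and atlas_M: "analytic_atlas M"
  and inj_\<iota>: "inj_on \<iota> (pts S)"
  and analytic_\<iota>: "analytic_map S M \<iota>" and continuous_\<iota>: "continuous_map (mtop S) (mtop M) \<iota>"
  using curve manifold
  unfolding analytic_1_submanifold_def analytic_1_manifold_with_boundary_def analytic_manifold_def
    analytic_map_def by auto

lemma continuous_\<phi>: "g \<in> carrier G \<Longrightarrow> continuous_map (mtop M) (mtop M) (\<phi> g)"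
  using analytic unfolding analytic_in_M_def analytic_map_def by blast

lemma \<iota>_pts: "z \<in> pts S \<Longrightarrow> \<iota> z \<in> pts M"
  using continuous_\<iota> by (auto simp: continuous_map_def)

lemma \<phi>_\<iota>_pts: "g \<in> carrier G \<Longrightarrow> z \<in> pts S \<Longrightarrow> \<phi> g (\<iota> z) \<in> pts M"
  using element_image \<iota>_pts by blast

lemma \<phi>_one_pts: "x \<in> pts M \<Longrightarrow> \<phi> \<one> x = x"
  using fun_cong[OF id_eq_one, of x] by simp

lemma \<phi>_inv:
  assumes "g \<in> carrier G" "x \<in> pts M"
  shows "\<phi> (inv g) (\<phi> g x) = x" "\<phi> g (\<phi> (inv g) x) = x"
  using composition_rule[OF assms(2), of "inv g" g] composition_rule[OF assms(2), of g "inv g"]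
    assms by (auto simp: \<phi>_one_pts)

lemma \<phi>_mult: "g \<in> carrier G \<Longrightarrow> h \<in> carrier G \<Longrightarrow> z \<in> pts S \<Longrightarrow> \<phi> (g \<otimes> h) (\<iota> z) = \<phi> g (\<phi> h (\<iota> z))"
  using composition_rule \<iota>_pts by blast

lemma \<phi>_one: "z \<in> pts S \<Longrightarrow> \<phi> \<one> (\<iota> z) = \<iota> z"
  using \<phi>_one_pts \<iota>_pts by blast

lemma \<phi>_\<iota>_inject:
  assumes "g \<in> carrier G" "y \<in> pts S" "z \<in> pts S" "\<phi> g (\<iota> y) = \<phi> g (\<iota> z)"
  shows "y = z"
  using assms \<phi>_inv(1) \<iota>_pts inj_\<iota> by (metis inj_on_eq_iff)

definition carries :: "'g \<Rightarrow> 's set \<Rightarrow> 's set \<Rightarrow> bool" where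
  "carries g A B \<longleftrightarrow> g \<in> carrier G \<and> is_seg S A \<and> is_seg S B \<and>
     embeds_on M S \<iota> A \<and> embeds_on M S \<iota> B \<and> \<phi> g ` \<iota> ` A = \<iota> ` B"

lemma carriesD:
  assumes "carries g A B"
  shows "g \<in> carrier G" "is_seg S A" "is_seg S B" "A \<subseteq> pts S" "B \<subseteq> pts S"
    "embeds_on M S \<iota> A" "embeds_on M S \<iota> B"
    "a \<in> A \<Longrightarrow> \<exists>b\<in>B. \<phi> g (\<iota> a) = \<iota> b" "b \<in> B \<Longrightarrow> \<exists>a\<in>A. \<phi> g (\<iota> a) = \<iota> b"
proof -
  show "g \<in> carrier G" "is_seg S A" "is_seg S B" "embeds_on M S \<iota> A" "embeds_on M S \<iota> B"
    using assms by (simp_all add: carries_def)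
  then show "A \<subseteq> pts S" "B \<subseteq> pts S" using is_segD(2) by blast+
  have eq: "\<phi> g ` \<iota> ` A = \<iota> ` B" using assms by (simp add: carries_def)
  show "\<exists>b\<in>B. \<phi> g (\<iota> a) = \<iota> b" if "a \<in> A"
  proof -
    have "\<phi> g (\<iota> a) \<in> \<phi> g ` \<iota> ` A" using that by blast
    then show ?thesis unfolding eq by blast
  qed
  show "\<exists>a\<in>A. \<phi> g (\<iota> a) = \<iota> b" if "b \<in> B"
  proof -
    have "\<iota> b \<in> \<phi> g ` \<iota> ` A" unfolding eq using that by blast
    then show ?thesis by force
  qed
qed

lemma carries_mem_iff:
  assumes "carries g A B" "x \<in> pts S" "y \<in> pts S" "\<phi> g (\<iota> x) = \<iota> y"
  shows "x \<in> A \<longleftrightarrow> y \<in> B"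
proof
  assume "x \<in> A"
  then obtain b where "b \<in> B" "\<phi> g (\<iota> x) = \<iota> b" using carriesD(8)[OF assms(1)] by blast
  then show "y \<in> B" using assms carriesD(5)[OF assms(1)] inj_\<iota> by (metis inj_on_eq_iff subsetD)
next
  assume "y \<in> B"
  then obtain a where "a \<in> A" "\<phi> g (\<iota> a) = \<iota> y" using carriesD(9)[OF assms(1)] by blast
  then show "x \<in> A"
    using assms(2-4) carriesD(1,4)[OF assms(1)] \<phi>_\<iota>_inject[of g a x] by auto
qed

lemma carries_inv:
  assumes "carries g A B"
  shows "carries (inv g) B A"
proof -
  have "\<phi> (inv g) ` \<iota> ` B = \<phi> (inv g) ` \<phi> g ` \<iota> ` A"
    using assms unfolding carries_def by simp
  also have "\<dots> = \<iota> ` A"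
    using carriesD(1,4)[OF assms] \<phi>_inv(1) \<iota>_pts by (force simp: image_iff)
  finally show ?thesis using assms unfolding carries_def by simp
qed

lemma carries_compose:
  assumes "carries g A B" "carries h B C"
  shows "carries (h \<otimes> g) A C"
proof -
  have "\<phi> (h \<otimes> g) ` \<iota> ` A = \<phi> h ` \<phi> g ` \<iota> ` A"
    unfolding image_image
    by (rule image_cong) (use assms carriesD(1,4) \<phi>_mult in blast)+
  then show ?thesis using assms unfolding carries_def by simp
qed

text \<open>Only points of \<open>B\<close> are tested against \<open>V\<close>: other parts of the
  curve may accumulate at \<iota> b, so an open set of M can detect \<open>N\<close> only within a
  segment on which \<iota> is an embedding.\<close>

lemma embeds_on_openin:
  assumes B: "embeds_on M S \<iota> B" "B \<subseteq> pts S" and N: "openin (mtop S) N"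
  obtains V where "openin (mtop M) V" "\<And>b. b \<in> B \<Longrightarrow> b \<in> N \<longleftrightarrow> \<iota> b \<in> V"
proof -
  have hom: "homeomorphic_map (subtopology (mtop S) B) (subtopology (mtop M) (\<iota> ` B)) \<iota>"
    using B unfolding embeds_on_def embedding_map_def by (simp add: Int_absorb1)
  have "openin (subtopology (mtop S) B) (N \<inter> B)"
    using N openin_subtopology by blast
  then have "openin (subtopology (mtop M) (\<iota> ` B)) (\<iota> ` (N \<inter> B))"
    using homeomorphic_map_openness_eq[OF hom] by blast
  then obtain V where V: "openin (mtop M) V" "\<iota> ` (N \<inter> B) = V \<inter> \<iota> ` B"
    unfolding openin_subtopology by blast
  have "b \<in> N \<longleftrightarrow> \<iota> b \<in> V" if b: "b \<in> B" for b
  proof -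
    have "\<iota> b \<in> \<iota> ` (N \<inter> B) \<longleftrightarrow> b \<in> N \<inter> B"
      using inj_on_image_mem_iff[OF inj_\<iota>] b B(2) by blast
    then show ?thesis using V(2) b by blast
  qed
  then show thesis using that V(1) by blast
qed

text \<open>The image of \<open>A1\<close> in M is connected, and compact if \<open>A1\<close> is;
  the homeomorphism from \<open>B\<close> onto its image pulls these properties back to S.\<close>

lemma carries_restrict:
  assumes gAB: "carries g A B" and A1: "A1 \<subseteq> A" "is_seg S A1"
  obtains B1 where "B1 \<subseteq> B" "carries g A1 B1" "compactin (mtop S) A1 \<longrightarrow> compactin (mtop S) B1"
proof -
  note D = carriesD[OF gAB]
  define B1 where "B1 = {b\<in>B. \<iota> b \<in> \<phi> g ` \<iota> ` A1}"
  have B1: "B1 \<subseteq> B" by (auto simp: B1_def)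
  have im: "\<iota> ` B1 = \<phi> g ` \<iota> ` A1"
    using A1(1) D(8) unfolding B1_def by force
  have hom: "homeomorphic_map (subtopology (mtop S) B) (subtopology (mtop M) (\<iota> ` B)) \<iota>"
    using D(5,7) unfolding embeds_on_def embedding_map_def by (simp add: Int_absorb1)
  have B1t: "B1 \<subseteq> topspace (subtopology (mtop S) B)" using B1 D(5) by auto
  have "connectedin (mtop M) (\<iota> ` B1)"
    unfolding im using is_segD(1)[OF A1(2)] D(1) continuous_\<iota> continuous_\<phi>
    by (blast intro: connectedin_continuous_map_image)
  then have "connectedin (subtopology (mtop M) (\<iota> ` B)) (\<iota> ` B1)"
    using B1 by (auto simp: connectedin_subtopology)
  then have conn: "connectedin (mtop S) B1"
    using homeomorphic_map_connectedness[OF hom B1t] by (simp add: connectedin_subtopology)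
  have comp: "compactin (mtop S) B1" if "compactin (mtop S) A1"
  proof -
    have "compactin (mtop M) (\<iota> ` B1)"
      unfolding im using that D(1) continuous_\<iota> continuous_\<phi> by (blast intro: image_compactin)
    then have "compactin (subtopology (mtop M) (\<iota> ` B)) (\<iota> ` B1)"
      using B1 by (auto simp: compactin_subtopology)
    then show ?thesis
      using homeomorphic_map_compactness[OF hom B1t] by (simp add: compactin_subtopology)
  qed
  obtain a a' where a: "a \<in> A1" "a' \<in> A1" "a \<noteq> a'" using A1(2) unfolding is_seg_def by blast
  obtain b b' where b: "b \<in> B" "b' \<in> B" "\<phi> g (\<iota> a) = \<iota> b" "\<phi> g (\<iota> a') = \<iota> b'"
    using D(8) a A1(1) by (metis subsetD)
  have "b \<noteq> b'" using \<phi>_\<iota>_inject[OF D(1), of a a'] a b A1(1) D(4) by auto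
  moreover have "b \<in> B1" "b' \<in> B1" unfolding B1_def using a b(1,2) by (auto simp flip: b(3,4))
  ultimately have "is_seg S B1" using conn unfolding is_seg_def by blast
  then have "carries g A1 B1"
    using D(1) A1(2) im embeds_on_mono[OF D(6) A1(1)] embeds_on_mono[OF D(7) B1]
    by (simp add: carries_def)
  then show thesis using that B1 comp by blast
qed

lemma embeds_on_compact:
  assumes "compactin (mtop S) A"
  shows "embeds_on M S \<iota> A"
proof -
  have A: "A \<subseteq> pts S" using assms by (rule compactin_subset_topspace)
  have cont: "continuous_map (subtopology (mtop S) A) (mtop M) \<iota>"
    using continuous_\<iota> by (rule continuous_map_from_subtopology)
  have "closed_map (subtopology (mtop S) A) (mtop M) \<iota>"
    by (rule continuous_imp_closed_map_gen[OF _ Hausdorff_imp_kc_space[OF Hausdorff(2)] cont])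
      (use assms compact_space_subtopology in blast)
  moreover have "inj_on \<iota> (topspace (subtopology (mtop S) A))"
    using inj_\<iota> by (rule inj_on_subset) auto
  ultimately show ?thesis
    unfolding embeds_on_def using cont by (intro injective_closed_imp_embedding_map)
qed

subsection \<open>Charts and one-sided neighbourhoods\<close>

lemma chart:
  assumes "(U, f) \<in> atlas S"
  shows "openin (mtop S) U" "openin (top_of_set {0..}) (f ` U)" "inj_on f U" "U \<subseteq> pts S"
    "homeomorphic_map (top_of_set (f ` U)) (subtopology (mtop S) U) (inv_into U f)"
proof -
  show U: "openin (mtop S) U" and "openin (top_of_set {0..}) (f ` U)"
    using assms atlas_S model_S unfolding analytic_atlas_def by auto
  show Us: "U \<subseteq> pts S" using U by (rule openin_subset)
  have hom: "homeomorphic_map (subtopology (mtop S) U) (top_of_set (f ` U)) f"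
    using assms atlas_S unfolding analytic_atlas_def by auto
  then show inj: "inj_on f U"
    using homeomorphic_imp_injective_map[OF hom] Us by (simp add: Int_absorb1)
  obtain g where g: "homeomorphic_maps (subtopology (mtop S) U) (top_of_set (f ` U)) f g"
    using hom homeomorphic_map_maps by blast
  have "homeomorphic_map (top_of_set (f ` U)) (subtopology (mtop S) U) g"
    using g homeomorphic_maps_sym homeomorphic_map_maps by blast
  moreover have "g y = inv_into U f y" if "y \<in> topspace (top_of_set (f ` U))" for y
  proof -
    obtain x where "x \<in> U" "y = f x" using \<open>y \<in> _\<close> by auto
    then show ?thesis using g inj Us unfolding homeomorphic_maps_def by auto
  qed
  ultimately show "homeomorphic_map (top_of_set (f ` U)) (subtopology (mtop S) U) (inv_into U f)"
    by (rule homeomorphic_map_eq)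
qed

lemma chart_at:
  assumes "x \<in> pts S"
  obtains U f where "(U, f) \<in> atlas S" "x \<in> U"
  using assms atlas_S unfolding analytic_atlas_def by blast

lemma chart_continuous_inv:
  assumes "(U, f) \<in> atlas S"
  shows "continuous_map (top_of_set (f ` U)) (mtop S) (inv_into U f)"
  using homeomorphic_imp_continuous_map[OF chart(5)[OF assms]] continuous_map_in_subtopology by blast

lemma chart_openin:
  assumes c: "(U, f) \<in> atlas S" and I: "I \<subseteq> f ` U" "openin (top_of_set {0..}) I"
  shows "openin (mtop S) (inv_into U f ` I)"
proof -
  have "openin (top_of_set (f ` U)) I"
    using openin_subset_trans[OF I(2,1)] openin_imp_subset[OF chart(2)[OF c]] .
  then have "openin (subtopology (mtop S) U) (inv_into U f ` I)"
    using homeomorphic_map_openness_eq[OF chart(5)[OF c]] by blast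
  then show ?thesis using chart(1)[OF c] openin_trans_full by blast
qed

lemma chart_compactin:
  assumes c: "(U, f) \<in> atlas S" and I: "I \<subseteq> f ` U" "compact I"
  shows "compactin (mtop S) (inv_into U f ` I)"
  using image_compactin[OF _ chart_continuous_inv[OF c]] I by (simp add: compactin_subtopology)

lemma chart_seg:
  assumes c: "(U, f) \<in> atlas S" and I: "I \<subseteq> f ` U" "connected I" and ab: "a \<in> I" "b \<in> I" "a \<noteq> b"
  shows "is_seg S (inv_into U f ` I)"
proof -
  have "connectedin (mtop S) (inv_into U f ` I)"
    using connectedin_continuous_map_image[OF chart_continuous_inv[OF c]] I
    by (simp add: connectedin_subtopology)
  moreover have "inv_into U f a \<noteq> inv_into U f b"
    using inv_into_injective[of U f a b] I ab by blast
  ultimately show ?thesis unfolding is_seg_def using ab by blast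
qed

lemma chart_radius:
  assumes c: "(U, f) \<in> atlas S" and x: "x \<in> U"
  obtains \<delta> where "\<delta> > 0" "\<And>t. 0 \<le> t \<Longrightarrow> \<bar>t - f x\<bar> < \<delta> \<Longrightarrow> t \<in> f ` U" "0 \<le> f x"
proof -
  obtain W where W: "open W" "f ` U = {0..} \<inter> W" using chart(2)[OF c] by (auto simp: openin_open)
  have "f x \<in> {0..} \<inter> W" using W(2) x by blast
  then obtain \<delta> where \<delta>: "\<delta> > 0" "ball (f x) \<delta> \<subseteq> W" using W(1) openE by blast
  show thesis
  proof (rule that[OF \<delta>(1)])
    show "t \<in> f ` U" if "0 \<le> t" "\<bar>t - f x\<bar> < \<delta>" for t
      using that \<delta>(2) unfolding W(2) by (auto simp: dist_real_def abs_minus_commute)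
    show "0 \<le> f x" using \<open>f x \<in> _\<close> by simp
  qed
qed

text \<open>A compact one-sided neighbourhood of x read in the chart: s = 1 or s = -1 is the
  direction, e the length. Since chart images lie in [0, \<infinity>), \<open>is_arm\<close>
  excludes s = -1 when \<open>f x = 0\<close>. The local shape of a segment at one of its points is
  thereby reduced to the question which signs s occur.\<close>

definition arm :: "'s set \<Rightarrow> ('s \<Rightarrow> real) \<Rightarrow> 's \<Rightarrow> real \<Rightarrow> real \<Rightarrow> 's set" where
  "arm U f x s e = (\<lambda>u. inv_into U f (f x + s * u)) ` {0..e}"

definition is_arm :: "'s set \<Rightarrow> ('s \<Rightarrow> real) \<Rightarrow> 's \<Rightarrow> real \<Rightarrow> real \<Rightarrow> bool" where
  "is_arm U f x s e \<longleftrightarrow> 0 < e \<and> s \<in> {1, -1} \<and> (\<forall>u\<in>{0..e}. f x + s * u \<in> f ` U)"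

lemma arm_mono: "e \<le> e' \<Longrightarrow> arm U f x s e \<subseteq> arm U f x s e'"
  unfolding arm_def by (intro image_mono) auto

lemma is_arm_mono: "is_arm U f x s e \<Longrightarrow> 0 < e' \<Longrightarrow> e' \<le> e \<Longrightarrow> is_arm U f x s e'"
  unfolding is_arm_def by auto

lemma arm_image: "arm U f x s e = inv_into U f ` ((\<lambda>u. f x + s * u) ` {0..e})"
  unfolding arm_def by (simp add: image_image)

lemma arm_seg:
  assumes c: "(U, f) \<in> atlas S" and x: "x \<in> U" and ok: "is_arm U f x s e"
  shows "is_seg S (arm U f x s e)" "compactin (mtop S) (arm U f x s e)" "x \<in> arm U f x s e"
proof -
  have I: "(\<lambda>u. f x + s * u) ` {0..e} \<subseteq> f ` U" using ok unfolding is_arm_def by blast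
  show "is_seg S (arm U f x s e)"
    unfolding arm_image
  proof (rule chart_seg[OF c I])
    show "connected ((\<lambda>u. f x + s * u) ` {0..e})"
      by (intro connected_continuous_image continuous_intros) auto
    show "f x + s * 0 \<in> (\<lambda>u. f x + s * u) ` {0..e}" "f x + s * e \<in> (\<lambda>u. f x + s * u) ` {0..e}"
      using ok unfolding is_arm_def by (intro imageI; simp)+
    show "f x + s * 0 \<noteq> f x + s * e" using ok unfolding is_arm_def by auto
  qed
  show "compactin (mtop S) (arm U f x s e)"
    unfolding arm_image
    by (intro chart_compactin[OF c I] compact_continuous_image continuous_intros) auto
  have "inv_into U f (f x + s * 0) = x" using chart(3)[OF c] x by simp
  then show "x \<in> arm U f x s e" unfolding arm_def using ok by (force simp: is_arm_def)
qed

lemma arm_opposite: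
  assumes c: "(U, f) \<in> atlas S" and x: "x \<in> U" and ok: "is_arm U f x s e" "is_arm U f x (- s) e'"
  shows "arm U f x s e \<inter> arm U f x (- s) e' = {x}"
proof -
  have "y = x" if y: "y \<in> arm U f x s e" "y \<in> arm U f x (- s) e'" for y
  proof -
    obtain u where u: "u \<in> {0..e}" "y = inv_into U f (f x + s * u)" using y(1) unfolding arm_def by auto
    obtain v where v: "v \<in> {0..e'}" "y = inv_into U f (f x + - s * v)" using y(2) unfolding arm_def by auto
    have "f x + s * u \<in> f ` U" "f x + - s * v \<in> f ` U" using ok u v unfolding is_arm_def by blast+
    then have "f x + s * u = f x + - s * v"
      using u(2) v(2) inv_into_injective[of U f "f x + s * u" "f x + - s * v"] by simp
    then have "u = 0" using ok(1) u v by (auto simp: is_arm_def)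
    then show "y = x" using u chart(3)[OF c] x by simp
  qed
  then show ?thesis using arm_seg(3)[OF c x ok(1)] arm_seg(3)[OF c x ok(2)] by blast
qed

text \<open>Otherwise a small chart interval around \<open>x\<close> with endpoints outside \<open>A\<close> would cut out a proper
  clopen part of \<open>A\<close>.\<close>

lemma seg_contains_arm:
  assumes c: "(U, f) \<in> atlas S" and x: "x \<in> U" and A: "is_seg S A" "x \<in> A"
  obtains s e where "is_arm U f x s e" "arm U f x s e \<subseteq> A"
proof (rule ccontr)
  note found = that
  assume "\<not> thesis"
  then have no: "\<exists>u\<in>{0..e}. inv_into U f (f x + s * u) \<notin> A" if "is_arm U f x s e" for s e
    using found[OF that] unfolding arm_def by blast
  obtain a where a: "a \<in> A" "a \<noteq> x" using A unfolding is_seg_def by metis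
  have px: "inv_into U f (f x) = x" using chart(3)[OF c] x by simp
  obtain \<delta>0 where \<delta>0: "\<delta>0 > 0" "\<And>t. 0 \<le> t \<Longrightarrow> \<bar>t - f x\<bar> < \<delta>0 \<Longrightarrow> t \<in> f ` U" "0 \<le> f x"
    using chart_radius[OF c x] by blast
  \<comment> \<open>Keeps the second point \<open>a\<close> of A out of the chart interval, so that
    the part of A inside it is proper.\<close>
  define \<delta> where "\<delta> = (if a \<in> U then min \<delta>0 \<bar>f a - f x\<bar> else \<delta>0)"
  have "a \<in> U \<Longrightarrow> f a \<noteq> f x" using chart(3)[OF c] x a by (auto dest: inj_onD)
  then have \<delta>: "\<delta> > 0" "\<delta> \<le> \<delta>0" "a \<in> U \<Longrightarrow> \<delta> \<le> \<bar>f a - f x\<bar>" using \<delta>0(1) by (auto simp: \<delta>_def)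
  have \<delta>U: "t \<in> f ` U" if "0 \<le> t" "\<bar>t - f x\<bar> < \<delta>" for t using \<delta>0(2) \<delta>(2) that by auto
  have "is_arm U f x 1 (\<delta> / 2)" unfolding is_arm_def using \<delta> \<delta>U \<delta>0(3) by auto
  from no[OF this] obtain u where u: "0 \<le> u" "u \<le> \<delta> / 2" "inv_into U f (f x + u) \<notin> A" by auto
  define r where "r = f x + u"
  have "u \<noteq> 0" using u px A by auto
  then have r: "f x < r" "r < f x + \<delta>" "inv_into U f r \<notin> A" using u \<delta> by (auto simp: r_def)
  \<comment> \<open>If \<open>f x = 0\<close> there is no left side to leave; l is then taken
    negative, which makes the condition on l vacuous.\<close>
  obtain l where l: "l < f x" "f x - \<delta> < l" "0 \<le> l \<Longrightarrow> inv_into U f l \<notin> A"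
  proof (cases "f x > 0")
    case True
    then have "is_arm U f x (-1) (min (\<delta> / 2) (f x))" unfolding is_arm_def using \<delta> \<delta>U by auto
    from no[OF this] obtain v where v: "0 \<le> v" "v \<le> \<delta> / 2" "inv_into U f (f x - v) \<notin> A" by auto
    have "v \<noteq> 0" using v px A by auto
    then show thesis using v \<delta> by (intro that[of "f x - v"]) auto
  next
    case False
    then show thesis using \<delta> \<delta>0(3) by (intro that[of "- \<delta> / 2"]) auto
  qed
  define V where "V = inv_into U f ` ({l<..<r} \<inter> {0..})"
  define K where "K = inv_into U f ` ({l..r} \<inter> {0..})"
  have sub: "{l..r} \<inter> {0..} \<subseteq> f ` U" using \<delta>U l r by auto
  have V: "openin (mtop S) V"
    unfolding V_def by (rule chart_openin[OF c]) (use sub in \<open>auto simp: openin_open\<close>)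
  have "compactin (mtop S) K"
    unfolding K_def by (rule chart_compactin[OF c sub]) (simp add: compact_Int_closed)
  then have K: "openin (mtop S) (pts S - K)"
    using compactin_imp_closedin[OF Hausdorff(1)] by blast
  have VK: "V \<subseteq> K" unfolding V_def K_def by (intro image_mono) auto
  \<comment> \<open>A misses the endpoints l and r of the interval, so the open \<open>V\<close> and
    the compact \<open>K\<close> cut the same part out of A, which is therefore clopen in A.\<close>
  have AK: "A \<inter> K \<subseteq> V"
  proof
    fix y assume y: "y \<in> A \<inter> K"
    then obtain t where t: "t \<in> {l..r}" "0 \<le> t" "y = inv_into U f t" unfolding K_def by auto
    have "t \<noteq> l" "t \<noteq> r" using y t l(3) r(3) by auto
    then show "y \<in> V" unfolding V_def using t by auto
  qed
  have xV: "x \<in> V" unfolding V_def using px l r \<delta>0(3) by (intro image_eqI[of _ _ "f x"]) auto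
  have aK: "a \<notin> K"
  proof
    assume "a \<in> K"
    then obtain t where t: "t \<in> {l..r}" "0 \<le> t" "a = inv_into U f t" unfolding K_def by auto
    then have "t \<in> f ` U" using sub by auto
    then have "a \<in> U" "f a = t" using t by (auto simp: inv_into_into f_inv_into_f)
    then show False using \<delta>(3) t l r by auto
  qed
  show False
    using connectedinD[OF is_segD(1)[OF A(1)] V K] VK AK xV aK A a is_segD(2)[OF A(1)] by blast
qed

text \<open>An arm without its two endpoints is an open interval in the chart that avoids 0, so it
  is open in S even when the arm starts at a boundary point of S.\<close>

lemma seg_contains_open_seg:
  assumes A: "is_seg S A"
  obtains V where "is_seg S V" "openin (mtop S) V" "V \<subseteq> A"
proof -
  obtain x where x: "x \<in> A" "x \<in> pts S" using A is_segD(2)[OF A] unfolding is_seg_def by blast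
  obtain U f where c: "(U, f) \<in> atlas S" "x \<in> U" using chart_at[OF x(2)] by blast
  obtain s e where se: "is_arm U f x s e" "arm U f x s e \<subseteq> A"
    using seg_contains_arm[OF c A x(1)] by blast
  define I where "I = (if s = 1 then {f x<..<f x + e} else {f x - e<..<f x})"
  have s: "s = 1 \<or> s = -1" and e: "e > 0" using se(1) by (auto simp: is_arm_def)
  have "t \<in> (\<lambda>u. f x + s * u) ` {0..e}" if "t \<in> I" for t
  proof (rule image_eqI)
    show "t = f x + s * (s * (t - f x))" using s by auto
    show "s * (t - f x) \<in> {0..e}" using s that by (auto simp: I_def split: if_splits)
  qed
  then have I: "I \<subseteq> (\<lambda>u. f x + s * u) ` {0..e}" by blast
  then have IU: "I \<subseteq> f ` U" using se(1) unfolding is_arm_def by blast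
  have "f ` U \<subseteq> {0..}" using chart(2)[OF c(1)] openin_imp_subset by blast
  then have "I = {0..} \<inter> I" using IU by blast
  moreover have "open I" by (simp add: I_def)
  ultimately have "openin (top_of_set {0..}) I" unfolding openin_open by blast
  then have "openin (mtop S) (inv_into U f ` I)" using chart_openin[OF c(1) IU] by blast
  moreover have "is_seg S (inv_into U f ` I)"
    by (rule chart_seg[OF c(1) IU, of "f x + s * (e/2)" "f x + s * (e/3)"])
      (use s e in \<open>auto simp: I_def\<close>)
  moreover have "inv_into U f ` I \<subseteq> A" using se(2) I unfolding arm_image by blast
  ultimately show thesis using that by blast
qed

section \<open>Local shape of segments at a common point\<close>

lemma arm_Int:
  assumes c: "(U, f) \<in> atlas S" "x \<in> U" and ok: "is_arm U f x s e" "is_arm U f x s e'"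
  shows "is_arm U f x s (min e e')" "arm U f x s (min e e') \<subseteq> arm U f x s e \<inter> arm U f x s e'"
    "\<not> arm U f x s e \<inter> arm U f x s e' \<subseteq> {x}"
proof -
  show 1: "is_arm U f x s (min e e')" using ok by (auto simp: is_arm_def min_def)
  show 2: "arm U f x s (min e e') \<subseteq> arm U f x s e \<inter> arm U f x s e'" by (simp add: arm_mono)
  show "\<not> arm U f x s e \<inter> arm U f x s e' \<subseteq> {x}"
    using arm_seg(1)[OF c 1] 2 unfolding is_seg_def by blast
qed

text \<open>At x there are only two directions. A uses one of them; B and C meet A only in x, so
  both use the other one and share an arm.\<close>

lemma no_triod:
  assumes A: "is_seg S A" and B: "is_seg S B" and C: "is_seg S C"
    and AB: "A \<inter> B = {x}" and AC: "A \<inter> C = {x}"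
  obtains D where "is_seg S D" "compactin (mtop S) D" "x \<in> D" "D \<subseteq> B \<inter> C"
proof -
  have x: "x \<in> A" "x \<in> B" "x \<in> C" using AB AC by blast+
  then have "x \<in> pts S" using is_segD(2)[OF A] by blast
  then obtain U f where c: "(U, f) \<in> atlas S" "x \<in> U" using chart_at by blast
  obtain sa ea where a: "is_arm U f x sa ea" "arm U f x sa ea \<subseteq> A"
    using seg_contains_arm[OF c A x(1)] by blast
  obtain sb eb where b: "is_arm U f x sb eb" "arm U f x sb eb \<subseteq> B"
    using seg_contains_arm[OF c B x(2)] by blast
  obtain sc ec where cc: "is_arm U f x sc ec" "arm U f x sc ec \<subseteq> C"
    using seg_contains_arm[OF c C x(3)] by blast
  have "sb \<noteq> sa" using arm_Int(3)[OF c a(1), of eb] b a(2) AB by blast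
  moreover have "sc \<noteq> sa" using arm_Int(3)[OF c a(1), of ec] cc a(2) AC by blast
  ultimately have s: "sb = sc" using a(1) b(1) cc(1) by (auto simp: is_arm_def)
  note I = arm_Int[OF c b(1) cc(1)[folded s]]
  show thesis
  proof (rule that[OF arm_seg[OF c I(1)]])
    show "arm U f x sb (min eb ec) \<subseteq> B \<inter> C" using I(2) b(2) cc(2) s by blast
  qed
qed

text \<open>P1 and P2 leave x in opposite directions, so one of them leaves opposite to Q. At an
  interior point of a segment this supplies the second side that \<open>carries_across\<close> asks
  for.\<close>

lemma opposite_seg:
  assumes P: "is_seg S P1" "is_seg S P2" "P1 \<inter> P2 = {x}" and Q: "is_seg S Q" "x \<in> Q"
  obtains P' Q' where "is_seg S P'" "is_seg S Q'" "P' \<subseteq> P1 \<union> P2" "Q' \<subseteq> Q" "P' \<inter> Q' = {x}"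
proof -
  have "x \<in> pts S" "x \<in> P1" "x \<in> P2" using Q P(3) is_segD(2) by blast+
  obtain U f where c: "(U, f) \<in> atlas S" "x \<in> U" using chart_at[OF \<open>x \<in> pts S\<close>] by blast
  obtain s1 e1 where 1: "is_arm U f x s1 e1" "arm U f x s1 e1 \<subseteq> P1"
    using seg_contains_arm[OF c P(1) \<open>x \<in> P1\<close>] by blast
  obtain s2 e2 where 2: "is_arm U f x s2 e2" "arm U f x s2 e2 \<subseteq> P2"
    using seg_contains_arm[OF c P(2) \<open>x \<in> P2\<close>] by blast
  obtain s e where q: "is_arm U f x s e" "arm U f x s e \<subseteq> Q"
    using seg_contains_arm[OF c Q] by blast
  have "s1 \<noteq> s2" using arm_Int(3)[OF c 1(1), of e2] 1 2 P(3) by blast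
  then consider "s2 = - s" | "s1 = - s" using 1(1) 2(1) q(1) by (auto simp: is_arm_def)
  then obtain e' where "is_arm U f x (- s) e'" "arm U f x (- s) e' \<subseteq> P1 \<union> P2"
    using 1 2 by cases blast+
  then show thesis
    using that[of "arm U f x (- s) e'" "arm U f x s e"] q(2) arm_seg(1)[OF c] q(1)
      arm_opposite[OF c q(1), of e'] by blast
qed

text \<open>\<open>sim_o\<close> demands open segments on both sides. An open \<open>V'\<close> is
  chosen inside the image \<open>W\<close> of an open \<open>V1\<close>. Within \<open>W\<close> it
  is cut out by an open set of M, so its preimage \<open>V\<close> in \<open>V1\<close> is open by
  continuity of \<phi> g after \<iota>.\<close>

lemma carries_imp_sim_o:
  assumes gAB: "carries g A B" and "A \<subseteq> \<Sigma>" "B \<subseteq> \<Sigma>'"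
  shows "sim_o \<phi> M S \<iota> g \<Sigma> \<Sigma>'"
proof -
  note D = carriesD[OF gAB]
  obtain V1 where V1: "is_seg S V1" "openin (mtop S) V1" "V1 \<subseteq> A" using seg_contains_open_seg[OF D(2)] .
  obtain W where W: "W \<subseteq> B" "carries g V1 W" using carries_restrict[OF gAB V1(3,1)] .
  obtain V' where V': "is_seg S V'" "openin (mtop S) V'" "V' \<subseteq> W"
    using seg_contains_open_seg[OF carriesD(3)[OF W(2)]] .
  obtain V where V: "V \<subseteq> V1" "carries (inv g) V' V"
    using carries_restrict[OF carries_inv[OF W(2)] V'(3,1)] .
  then have gV: "carries g V V'" using carries_inv[OF V(2)] D(1) by simp
  obtain N where N: "openin (mtop M) N" "\<And>b. b \<in> W \<Longrightarrow> b \<in> V' \<longleftrightarrow> \<iota> b \<in> N"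
    using embeds_on_openin[OF carriesD(7,5)[OF W(2)] V'(2)] by blast
  have "V = V1 \<inter> {a \<in> pts S. (\<phi> g \<circ> \<iota>) a \<in> N}"
  proof -
    have "a \<in> V \<longleftrightarrow> \<phi> g (\<iota> a) \<in> N" if a: "a \<in> V1" for a
    proof -
      obtain b where b: "b \<in> W" "\<phi> g (\<iota> a) = \<iota> b" using carriesD(8)[OF W(2) a] by blast
      have "a \<in> V \<longleftrightarrow> b \<in> V'"
        by (rule carries_mem_iff[OF gV _ _ b(2)]) (use a b carriesD(4,5)[OF W(2)] in auto)
      then show ?thesis using N(2)[OF b(1)] b(2) by simp
    qed
    then show ?thesis using V(1) carriesD(4)[OF W(2)] by auto
  qed
  moreover have "openin (mtop S) {a \<in> pts S. (\<phi> g \<circ> \<iota>) a \<in> N}"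
    using openin_continuous_map_preimage[OF continuous_map_compose[OF continuous_\<iota> continuous_\<phi>[OF D(1)]] N(1)] .
  ultimately have oV: "openin (mtop S) V" using V1(2) by auto
  have "V \<subseteq> \<Sigma>" "V' \<subseteq> \<Sigma>'" using V(1) V1(3) V'(3) W(1) assms(2,3) by blast+
  then show ?thesis
    unfolding sim_o_def using carriesD(2,3,6,7)[OF gV] oV V'(2) gV
    by (intro exI[of _ V] exI[of _ V']) (simp add: carries_def)
qed

end

lemma holo_germ_cong:
  assumes "holo_germ \<gamma>" "\<delta> > 0" "\<And>t. \<bar>t\<bar> < \<delta> \<Longrightarrow> \<gamma> t = \<gamma>' t"
  shows "holo_germ \<gamma>'"
  unfolding holo_germ_def
proof
  fix v
  obtain r H where rH: "r > 0" "H holomorphic_on ball 0 r"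
    "\<And>t. \<bar>t\<bar> < r \<Longrightarrow> H (of_real t) = of_real (\<gamma> t \<bullet> v)"
    by (rule holo_germE[OF assms(1), of v]) blast
  have "H holomorphic_on ball 0 (min r \<delta>)" using rH(2) by (rule holomorphic_on_subset) auto
  then show "\<exists>r>0. \<exists>H. H holomorphic_on ball 0 r \<and>
     (\<forall>t. \<bar>t\<bar> < r \<longrightarrow> H (of_real t) = of_real (\<gamma>' t \<bullet> v))"
    using rH(1,3) assms(2,3) by (intro exI[of _ "min r \<delta>"]) auto
qed

lemma continuous_map_near_0:
  fixes e :: real
  assumes q: "continuous_map (top_of_set {-e..e}) X q" and "e > 0" and N: "openin X N" "q 0 \<in> N"
  obtains \<delta> where "0 < \<delta>" "\<delta> \<le> e" "\<And>u. \<bar>u\<bar> < \<delta> \<Longrightarrow> q u \<in> N"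
proof -
  have "openin (top_of_set {-e..e}) {u \<in> {-e..e}. q u \<in> N}"
    using openin_continuous_map_preimage[OF q N(1)] by simp
  then obtain T where T: "open T" "{u \<in> {-e..e}. q u \<in> N} = {-e..e} \<inter> T" by (auto simp: openin_open)
  have "0 \<in> {u \<in> {-e..e}. q u \<in> N}" using N(2) \<open>e > 0\<close> by simp
  then have "0 \<in> T" using T(2) by blast
  then obtain d where d: "d > 0" "ball 0 d \<subseteq> T" using T(1) openE by blast
  show thesis
  proof (rule that[of "min d e"])
    fix u :: real assume u: "\<bar>u\<bar> < min d e"
    then have "u \<in> {-e..e} \<inter> T" using d(2) by (auto simp: subset_eq)
    then show "q u \<in> N" using T(2) by blast
  qed (use d \<open>e > 0\<close> in auto)
qed

context curve_action
begin

subsection \<open>Continuation across a point\<close>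

lemma M_chart:
  assumes "(Z, h) \<in> atlas M"
  shows "openin (mtop M) Z" "inj_on h Z"
proof -
  show "openin (mtop M) Z" using assms atlas_M unfolding analytic_atlas_def by auto
  then have Z: "Z \<subseteq> pts M" by (rule openin_subset)
  have "homeomorphic_map (subtopology (mtop M) Z) (top_of_set (h ` Z)) h"
    using assms atlas_M unfolding analytic_atlas_def by auto
  from homeomorphic_imp_injective_map[OF this] show "inj_on h Z" using Z by (simp add: Int_absorb1)
qed

lemma chart_line_continuous:
  assumes c: "(U, f) \<in> atlas S" and two: "\<And>u. \<bar>u\<bar> \<le> e \<Longrightarrow> f x + s * u \<in> f ` U"
  shows "continuous_map (top_of_set {-e..e}) (mtop S) (\<lambda>u. inv_into U f (f x + s * u))"
proof -
  have "continuous_map (top_of_set {-e..e}) (top_of_set (f ` U)) (\<lambda>u. f x + s * u)"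
    using two by (auto intro!: continuous_intros)
  from continuous_map_compose[OF this chart_continuous_inv[OF c]] show ?thesis by (simp add: o_def)
qed

text \<open>The hypothesis \<open>two\<close> puts parameters of both signs into the chart image, so
  the derivative within the chart image, one-sided at a boundary point, is here an ordinary one. It
  is nonzero because \<iota> is an immersion.\<close>

lemma curve_germ:
  assumes c: "(U, f) \<in> atlas S" "x \<in> U" and e: "e > 0"
    and two: "\<And>u. \<bar>u\<bar> \<le> e \<Longrightarrow> f x + s * u \<in> f ` U"
    and Z: "(Z, h) \<in> atlas M" "\<iota> x \<in> Z"
  shows "holo_germ (\<lambda>u. h (\<iota> (inv_into U f (f x + s * u))))"
    and "s \<noteq> 0 \<Longrightarrow>
      \<exists>D. D \<noteq> 0 \<and> ((\<lambda>u. h (\<iota> (inv_into U f (f x + s * u)))) has_vector_derivative D) (at 0)"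
proof -
  let ?p = "\<lambda>u. inv_into U f (f x + s * u)" and ?F = "h \<circ> \<iota> \<circ> inv_into U f"
  let ?X = "f ` {z \<in> U. \<iota> z \<in> Z}"
  have p0: "?p 0 = x" using chart(3)[OF c(1)] c(2) by simp
  have "continuous_map (top_of_set {-e..e}) (mtop M) (\<iota> \<circ> ?p)"
    by (intro continuous_map_compose[OF _ continuous_\<iota>] chart_line_continuous[OF c(1)] two)
  then obtain \<delta> where \<delta>: "0 < \<delta>" "\<delta> \<le> e" "\<And>u. \<bar>u\<bar> < \<delta> \<Longrightarrow> (\<iota> \<circ> ?p) u \<in> Z"
    using continuous_map_near_0[OF _ e M_chart(1)[OF Z(1)]] p0 Z(2)
    by (metis (no_types, lifting) comp_apply)
  have X: "f x + s * u \<in> ?X" if u: "\<bar>u\<bar> < \<delta>" for u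
  proof -
    have "f x + s * u \<in> f ` U" using two u \<delta>(2) by simp
    then have "?p u \<in> U" "f (?p u) = f x + s * u" by (auto simp: inv_into_into f_inv_into_f)
    moreover have "\<iota> (?p u) \<in> Z" using \<delta>(3)[OF u] by simp
    ultimately show ?thesis by (metis (mono_tags, lifting) imageI mem_Collect_eq)
  qed
  have "real_analytic_on ?F ?X"
    using analytic_\<iota> c(1) Z(1) unfolding analytic_map_def by fast
  from holo_germ_compose[OF this holo_germ_affine \<delta>(1) X]
  show "holo_germ (\<lambda>u. h (\<iota> (?p u)))" by simp
  assume s: "s \<noteq> 0"
  have "x \<in> pts S" using c chart(4) by blast
  have "\<forall>z\<in>pts S. \<forall>(U, f)\<in>atlas S. \<forall>(W, h)\<in>atlas M. z \<in> U \<and> \<iota> z \<in> W \<longrightarrow>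
      (\<exists>D. D \<noteq> 0 \<and> ((h \<circ> \<iota> \<circ> inv_into U f) has_vector_derivative D)
        (at (f z) within f ` {x \<in> U. \<iota> x \<in> W}))"
    using curve by (simp add: analytic_1_submanifold_def)
  from bspec[OF bspec[OF this \<open>x \<in> pts S\<close>] c(1)]
  have "\<forall>(W, h)\<in>atlas M. x \<in> U \<and> \<iota> x \<in> W \<longrightarrow>
      (\<exists>D. D \<noteq> 0 \<and> ((h \<circ> \<iota> \<circ> inv_into U f) has_vector_derivative D)
        (at (f x) within f ` {x \<in> U. \<iota> x \<in> W}))"
    by simp
  from bspec[OF this Z(1)] obtain D
    where D: "D \<noteq> 0" "(?F has_vector_derivative D) (at (f x) within ?X)"
    unfolding prod.case using c(2) Z(2) by blast
  have "ball (f x) (\<bar>s\<bar> * \<delta>) \<subseteq> ?X"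
  proof
    fix t assume "t \<in> ball (f x) (\<bar>s\<bar> * \<delta>)"
    then have "\<bar>(t - f x) / s\<bar> < \<delta>" using s
      by (simp add: dist_real_def abs_minus_commute abs_divide pos_divide_less_eq mult.commute)
    from X[OF this] show "t \<in> ?X" using s by simp
  qed
  with D(2) have "(?F has_vector_derivative D) (at (f x) within ball (f x) (\<bar>s\<bar> * \<delta>))"
    by (rule has_vector_derivative_within_subset)
  then have "(?F has_vector_derivative D) (at (f x + s * 0))"
    using at_within_open[of "f x" "ball (f x) (\<bar>s\<bar> * \<delta>)"] s \<delta>(1) by simp
  moreover have "((\<lambda>u. f x + s * u) has_vector_derivative s) (at 0)"
    by (auto intro!: derivative_eq_intros)
  ultimately have "(?F \<circ> (\<lambda>u. f x + s * u) has_vector_derivative s *\<^sub>R D) (at 0)"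
    by (intro vector_diff_chain_at)
  then show "\<exists>D. D \<noteq> 0 \<and> ((\<lambda>u. h (\<iota> (?p u))) has_vector_derivative D) (at 0)"
    using D(1) s by (intro exI[of _ "s *\<^sub>R D"]) (simp add: o_def)
qed

lemma transported_curve_germ:
  assumes g: "g \<in> carrier G" and c: "(U, f) \<in> atlas S" "x \<in> U" and e: "e > 0"
    and two: "\<And>u. \<bar>u\<bar> \<le> e \<Longrightarrow> f x + s * u \<in> f ` U"
    and Z: "(Z, h) \<in> atlas M" "\<phi> g (\<iota> x) \<in> Z"
  shows "holo_germ (\<lambda>u. h (\<phi> g (\<iota> (inv_into U f (f x + s * u)))))"
proof -
  let ?p = "\<lambda>u. inv_into U f (f x + s * u)"
  have p0: "?p 0 = x" using chart(3)[OF c(1)] c(2) by simp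
  have "\<iota> x \<in> pts M" using c chart(4) \<iota>_pts by blast
  then obtain Z0 h0 where Z0: "(Z0, h0) \<in> atlas M" "\<iota> x \<in> Z0"
    using atlas_M unfolding analytic_atlas_def by blast
  \<comment> \<open>A chart \<open>h0\<close> around \<iota> x splits the transported curve into the
    analytic local expression of \<phi> g and the germ of \<iota>.\<close>
  let ?F = "h \<circ> \<phi> g \<circ> inv_into Z0 h0" and ?X = "h0 ` {z \<in> Z0. \<phi> g z \<in> Z}"
  have "continuous_map (top_of_set {-e..e}) (mtop M) (\<iota> \<circ> ?p)"
    by (intro continuous_map_compose[OF _ continuous_\<iota>] chart_line_continuous[OF c(1)] two)
  moreover have "openin (mtop M) (Z0 \<inter> {z \<in> pts M. \<phi> g z \<in> Z})"
    using M_chart(1)[OF Z0(1)] openin_continuous_map_preimage[OF continuous_\<phi>[OF g] M_chart(1)[OF Z(1)]]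
    by blast
  moreover have "(\<iota> \<circ> ?p) 0 \<in> Z0 \<inter> {z \<in> pts M. \<phi> g z \<in> Z}"
    using p0 Z Z0 \<open>\<iota> x \<in> pts M\<close> by simp
  ultimately obtain \<delta> where \<delta>: "0 < \<delta>" "\<And>u. \<bar>u\<bar> < \<delta> \<Longrightarrow> (\<iota> \<circ> ?p) u \<in> Z0 \<inter> {z \<in> pts M. \<phi> g z \<in> Z}"
    using continuous_map_near_0[OF _ e] by blast
  have germ: "holo_germ (\<lambda>u. h0 (\<iota> (?p u)))"
    by (rule curve_germ(1)[OF c e two Z0])
  have "real_analytic_on ?F ?X"
    using analytic g Z(1) Z0(1) unfolding analytic_in_M_def analytic_map_def by fast
  moreover have "h0 (\<iota> (?p u)) \<in> ?X" if "\<bar>u\<bar> < \<delta>" for u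
    using \<delta>(2)[OF that] by simp
  ultimately have "holo_germ (\<lambda>u. ?F (h0 (\<iota> (?p u))))"
    using holo_germ_compose[OF _ germ \<delta>(1)] by blast
  moreover have "?F (h0 (\<iota> (?p u))) = h (\<phi> g (\<iota> (?p u)))" if "\<bar>u\<bar> < \<delta>" for u
    using \<delta>(2)[OF that] M_chart(2)[OF Z0(1)] by simp
  ultimately show ?thesis by (rule holo_germ_cong[OF _ \<delta>(1)])
qed

text \<open>The transition function between the two curves in a chart of \<open>M\<close> is continued analytically from
  the \<open>A\<close>-side of \<open>x\<close> to the \<open>A'\<close>-side; being injective there, it reaches the \<open>B'\<close>-side of \<open>y\<close>.\<close>

lemma carries_across:
  assumes gAB: "carries g A B" and xA: "x \<in> A" and yB: "y \<in> B" and gx: "\<phi> g (\<iota> x) = \<iota> y"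
    and A': "is_seg S A'" "A \<inter> A' = {x}" and B': "is_seg S B'" "B \<inter> B' = {y}"
  obtains A'' B'' where "carries g A'' B''" "x \<in> A''" "y \<in> B''" "A'' \<subseteq> A'" "B'' \<subseteq> B'"
proof -
  note D = carriesD[OF gAB]
  have xS: "x \<in> pts S" and yS: "y \<in> pts S" using xA yB D(4,5) by blast+
  have xA': "x \<in> A'" and yB': "y \<in> B'" using A'(2) B'(2) by blast+
  obtain U f where c: "(U, f) \<in> atlas S" "x \<in> U" using chart_at[OF xS] by blast
  obtain W k where d: "(W, k) \<in> atlas S" "y \<in> W" using chart_at[OF yS] by blast
  obtain s ea where a: "is_arm U f x s ea" "arm U f x s ea \<subseteq> A"
    using seg_contains_arm[OF c D(2) xA] by blast
  obtain s' ea' where a': "is_arm U f x s' ea'" "arm U f x s' ea' \<subseteq> A'"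
    using seg_contains_arm[OF c A'(1) xA'] by blast
  obtain r eb where b: "is_arm W k y r eb" "arm W k y r eb \<subseteq> B"
    using seg_contains_arm[OF d D(3) yB] by blast
  obtain r' eb' where b': "is_arm W k y r' eb'" "arm W k y r' eb' \<subseteq> B'"
    using seg_contains_arm[OF d B'(1) yB'] by blast
  \<comment> \<open>Arms with the same direction would overlap beyond x. Hence \<open>A\<close> and
    \<open>A'\<close> leave x in opposite directions, and together they give a two-sided parameter
    interval around x.\<close>
  have "s' \<noteq> s" using arm_Int(3)[OF c a(1), of ea'] a a' A'(2) by blast
  then have s': "s' = - s" using a(1) a'(1) by (auto simp: is_arm_def)
  have "r' \<noteq> r" using arm_Int(3)[OF d b(1), of eb'] b b' B'(2) by blast
  then have r': "r' = - r" using b(1) b'(1) by (auto simp: is_arm_def)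
  have s: "s = 1 \<or> s = -1" and r: "r = 1 \<or> r = -1" using a(1) b(1) by (auto simp: is_arm_def)
  define ex where "ex = min ea ea'"
  define ey where "ey = min eb eb'"
  have ex: "0 < ex" "ex \<le> ea" "ex \<le> ea'" using a(1) a'(1) by (auto simp: is_arm_def ex_def)
  have ey: "0 < ey" "ey \<le> eb" "ey \<le> eb'" using b(1) b'(1) by (auto simp: is_arm_def ey_def)
  have twox: "f x + s * u \<in> f ` U" if "\<bar>u\<bar> \<le> ex" for u
  proof (cases "0 \<le> u")
    case True
    then have "u \<in> {0..ea}" using that ex by auto
    then show ?thesis using a(1) unfolding is_arm_def by blast
  next
    case False
    then have "- u \<in> {0..ea'}" using that ex by auto
    then have "f x + s' * (- u) \<in> f ` U" using a'(1) unfolding is_arm_def by blast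
    then show ?thesis by (simp add: s')
  qed
  have twoy: "k y + r * v \<in> k ` W" if "\<bar>v\<bar> \<le> ey" for v
  proof (cases "0 \<le> v")
    case True
    then have "v \<in> {0..eb}" using that ey by auto
    then show ?thesis using b(1) unfolding is_arm_def by blast
  next
    case False
    then have "- v \<in> {0..eb'}" using that ey by auto
    then have "k y + r' * (- v) \<in> k ` W" using b'(1) unfolding is_arm_def by blast
    then show ?thesis by (simp add: r')
  qed
  define pa where "pa u = inv_into U f (f x + s * u)" for u
  define pb where "pb v = inv_into W k (k y + r * v)" for v
  have pa0: "pa 0 = x" and pb0: "pb 0 = y"
    using chart(3)[OF c(1)] chart(3)[OF d(1)] c(2) d(2) by (simp_all add: pa_def pb_def)
  have paS: "pa u \<in> pts S" if "\<bar>u\<bar> \<le> ex" for u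
    using inv_into_into[OF twox[OF that]] chart(4)[OF c(1)] by (auto simp: pa_def)
  have pbS: "pb v \<in> pts S" if "\<bar>v\<bar> \<le> ey" for v
    using inv_into_into[OF twoy[OF that]] chart(4)[OF d(1)] by (auto simp: pb_def)
  have pa_inj: "u = u'" if "\<bar>u\<bar> \<le> ex" "\<bar>u'\<bar> \<le> ex" "pa u = pa u'" for u u'
    using inv_into_injective[OF that(3)[unfolded pa_def] twox[OF that(1)] twox[OF that(2)]] s by auto
  have pb_inj: "v = v'" if "\<bar>v\<bar> \<le> ey" "\<bar>v'\<bar> \<le> ey" "pb v = pb v'" for v v'
    using inv_into_injective[OF that(3)[unfolded pb_def] twoy[OF that(1)] twoy[OF that(2)]] r by auto
  have paA: "pa u \<in> A" if "0 \<le> u" "u \<le> ex" for u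
  proof -
    have "pa u \<in> arm U f x s ea" unfolding arm_def pa_def using that ex by (intro imageI) auto
    then show ?thesis using a(2) by blast
  qed
  have paA': "pa u \<in> A'" if "- ex \<le> u" "u \<le> 0" for u
  proof -
    have "pa u \<in> arm U f x s' ea'"
      unfolding arm_def pa_def s' using that ex by (intro image_eqI[of _ _ "- u"]) auto
    then show ?thesis using a'(2) by blast
  qed
  have pbB': "pb v \<in> B'" if "- ey \<le> v" "v \<le> 0" for v
  proof -
    have "pb v \<in> arm W k y r' eb'"
      unfolding arm_def pb_def r' using that ey by (intro image_eqI[of _ _ "- v"]) auto
    then show ?thesis using b'(2) by blast
  qed
  have "\<iota> y \<in> pts M" using yS \<iota>_pts by blast
  then obtain Z h where Z: "(Z, h) \<in> atlas M" "\<iota> y \<in> Z"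
    using atlas_M unfolding analytic_atlas_def by blast
  define \<alpha> where "\<alpha> u = h (\<phi> g (\<iota> (pa u)))" for u
  define \<beta> where "\<beta> v = h (\<iota> (pb v))" for v
  have \<alpha>: "holo_germ \<alpha>"
    unfolding \<alpha>_def pa_def by (rule transported_curve_germ[OF D(1) c ex(1) twox Z(1)]) (simp_all add: gx Z(2))
  have \<beta>: "holo_germ \<beta>"
    unfolding \<beta>_def pb_def by (rule curve_germ(1)[OF d ey(1) twoy Z])
  have "\<exists>D. D \<noteq> 0 \<and> (\<beta> has_vector_derivative D) (at 0)"
    unfolding \<beta>_def pb_def by (rule curve_germ(2)[OF d ey(1) twoy Z]) (use r in auto)
  then obtain E where E: "(\<beta> has_vector_derivative E) (at 0)" "E \<noteq> 0" by blast
  have conta: "continuous_map (top_of_set {-ex..ex}) (mtop M) (\<phi> g \<circ> \<iota> \<circ> pa)"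
    unfolding o_assoc[symmetric] pa_def
    by (intro continuous_map_compose[OF _ continuous_\<phi>[OF D(1)]] continuous_map_compose[OF _ continuous_\<iota>]
        chart_line_continuous[OF c(1)] twox)
  have contb: "continuous_map (top_of_set {-ey..ey}) (mtop M) (\<iota> \<circ> pb)"
    unfolding pb_def
    by (intro continuous_map_compose[OF _ continuous_\<iota>] chart_line_continuous[OF d(1)] twoy)
  have right: "\<exists>\<delta>>0. \<forall>u. 0 \<le> u \<and> u < \<delta> \<longrightarrow> (\<exists>v. 0 \<le> v \<and> v < \<eta> \<and> \<alpha> u = \<beta> v)" if "\<eta> > 0" for \<eta>
  proof -
    define \<zeta> where "\<zeta> = min \<eta> ey"
    have \<zeta>: "0 < \<zeta>" "\<zeta> \<le> \<eta>" "\<zeta> \<le> ey" using that ey by (auto simp: \<zeta>_def)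
    \<comment> \<open>Since \<iota> is an embedding on B, images of points of A that are close to
      \<iota> y in M come from points of B with coordinate in \<open>I\<close>, and not from another
      stretch of the curve.\<close>
    define I where "I = {k y - \<zeta> <..< k y + \<zeta>}"
    have I: "\<exists>v. \<bar>v\<bar> < \<zeta> \<and> t = k y + r * v" if "t \<in> I" for t
      using that r by (intro exI[of _ "r * (t - k y)"]) (auto simp: I_def)
    have IW: "I \<subseteq> k ` W"
    proof
      fix t assume "t \<in> I"
      then obtain v where "\<bar>v\<bar> < \<zeta>" "t = k y + r * v" using I by blast
      then show "t \<in> k ` W" using twoy[of v] \<zeta> by simp
    qed
    then have "I = {0..} \<inter> I" using openin_imp_subset[OF chart(2)[OF d(1)]] by blast
    moreover have "open I" by (simp add: I_def)
    ultimately have "openin (top_of_set {0..}) I" unfolding openin_open by blast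
    from chart_openin[OF d(1) IW this]
    obtain V where V: "openin (mtop M) V" "\<And>b. b \<in> B \<Longrightarrow> b \<in> inv_into W k ` I \<longleftrightarrow> \<iota> b \<in> V"
      using embeds_on_openin[OF D(7,5)] by blast
    have "y \<in> inv_into W k ` I"
      using chart(3)[OF d(1)] d(2) \<zeta>(1) by (intro image_eqI[of _ _ "k y"]) (auto simp: I_def)
    then have "(\<phi> g \<circ> \<iota> \<circ> pa) 0 \<in> V" using V(2)[OF yB] by (simp add: pa0 gx)
    then obtain \<delta> where \<delta>: "0 < \<delta>" "\<delta> \<le> ex" "\<And>u. \<bar>u\<bar> < \<delta> \<Longrightarrow> (\<phi> g \<circ> \<iota> \<circ> pa) u \<in> V"
      using continuous_map_near_0[OF conta ex(1) V(1)] by blast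
    have "\<exists>v. 0 \<le> v \<and> v < \<eta> \<and> \<alpha> u = \<beta> v" if u: "0 \<le> u" "u < \<delta>" for u
    proof -
      have "pa u \<in> A" using paA u \<delta>(2) by simp
      then obtain w where w: "w \<in> B" "\<phi> g (\<iota> (pa u)) = \<iota> w" using D(8) by blast
      then have "w \<in> inv_into W k ` I" using V(2)[OF w(1)] \<delta>(3)[of u] u by simp
      then obtain t where t: "t \<in> I" "w = inv_into W k t" by blast
      obtain v where v: "\<bar>v\<bar> < \<zeta>" "t = k y + r * v" using I[OF t(1)] by blast
      have wv: "w = pb v" using t v by (simp add: pb_def)
      \<comment> \<open>A negative parameter belongs to the arm in \<open>B'\<close>, which meets B
        only in y, that is, at parameter 0.\<close>
      have "0 \<le> v"
      proof (rule ccontr)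
        assume "\<not> 0 \<le> v"
        then have "pb v \<in> B'" using pbB' v(1) \<zeta>(3) by simp
        then have "pb v = pb 0" using w(1) wv B'(2) pb0 by blast
        then show False using pb_inj[of v 0] v(1) \<zeta>(3) \<open>\<not> 0 \<le> v\<close> ey(1) by simp
      qed
      then show ?thesis using v(1) \<zeta>(2) w(2) wv by (intro exI[of _ v]) (simp add: \<alpha>_def \<beta>_def)
    qed
    then show ?thesis using \<delta>(1) by blast
  qed
  obtain \<tau> \<epsilon> where \<epsilon>: "\<epsilon> > 0" and \<tau>: "continuous_on {-\<epsilon><..<\<epsilon>} \<tau>" "\<tau> 0 = 0"
    "\<And>u. \<bar>u\<bar> < \<epsilon> \<Longrightarrow> \<alpha> u = \<beta> (\<tau> u)" "\<And>u. 0 \<le> u \<Longrightarrow> u < \<epsilon> \<Longrightarrow> 0 \<le> \<tau> u"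
    by (rule germ_continuation[OF \<alpha> \<beta> E right]) (assumption, rule that)
  obtain \<delta>1 where \<delta>1: "0 < \<delta>1" "\<delta>1 \<le> ex" "\<And>u. \<bar>u\<bar> < \<delta>1 \<Longrightarrow> (\<phi> g \<circ> \<iota> \<circ> pa) u \<in> Z"
    using continuous_map_near_0[OF conta ex(1) M_chart(1)[OF Z(1)]] Z(2) pa0 gx by auto
  obtain \<delta>2 where \<delta>2: "0 < \<delta>2" "\<delta>2 \<le> ey" "\<And>v. \<bar>v\<bar> < \<delta>2 \<Longrightarrow> (\<iota> \<circ> pb) v \<in> Z"
    using continuous_map_near_0[OF contb ey(1) M_chart(1)[OF Z(1)]] Z(2) pb0 by auto
  have "isCont \<tau> 0" using \<tau>(1) \<epsilon> by (simp add: continuous_on_eq_continuous_at)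
  from this[unfolded continuous_at_eps_delta, rule_format, OF \<delta>2(1)] obtain \<delta>3
    where "0 < \<delta>3" "\<forall>u. dist u 0 < \<delta>3 \<longrightarrow> dist (\<tau> u) (\<tau> 0) < \<delta>2" by blast
  then have \<delta>3: "0 < \<delta>3" "\<And>u. \<bar>u\<bar> < \<delta>3 \<Longrightarrow> \<bar>\<tau> u\<bar> < \<delta>2" by (simp_all add: \<tau>(2))
  define \<rho> where "\<rho> = Min {\<epsilon>, \<delta>1, \<delta>3} / 2"
  have \<rho>: "0 < \<rho>" "\<rho> < \<epsilon>" "\<rho> < \<delta>1" "\<rho> < \<delta>3" using \<epsilon> \<delta>1(1) \<delta>3(1) by (auto simp: \<rho>_def min_def)
  have eq: "\<phi> g (\<iota> (pa u)) = \<iota> (pb (\<tau> u))" if u: "\<bar>u\<bar> \<le> \<rho>" for u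
  proof (rule inj_onD[OF M_chart(2)[OF Z(1)]])
    show "h (\<phi> g (\<iota> (pa u))) = h (\<iota> (pb (\<tau> u)))" using \<tau>(3)[of u] u \<rho>(2) by (simp add: \<alpha>_def \<beta>_def)
    show "\<phi> g (\<iota> (pa u)) \<in> Z" using \<delta>1(3)[of u] u \<rho>(3) by simp
    show "\<iota> (pb (\<tau> u)) \<in> Z" using \<delta>2(3)[of "\<tau> u"] \<delta>3(2)[of u] u \<rho>(4) by simp
  qed
  \<comment> \<open>Injectivity of \<phi> g after \<iota> passes to \<tau>. A continuous injective
    function on an interval is strictly monotone, and \<tau> \<ge> 0 to the right of 0 leaves only
    the increasing case.\<close>
  have "inj_on \<tau> {-\<rho>..\<rho>}"
  proof (rule inj_onI)
    fix u u' assume u: "u \<in> {-\<rho>..\<rho>}" "u' \<in> {-\<rho>..\<rho>}" "\<tau> u = \<tau> u'"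
    then have ab: "\<bar>u\<bar> \<le> \<rho>" "\<bar>u'\<bar> \<le> \<rho>" by auto
    then have le: "\<bar>u\<bar> \<le> ex" "\<bar>u'\<bar> \<le> ex" using \<rho>(3) \<delta>1(2) by auto
    have "\<phi> g (\<iota> (pa u)) = \<phi> g (\<iota> (pa u'))" using eq[OF ab(1)] eq[OF ab(2)] u(3) by simp
    then have "pa u = pa u'" using \<phi>_\<iota>_inject[OF D(1) paS[OF le(1)] paS[OF le(2)]] by blast
    then show "u = u'" using pa_inj[OF le] by blast
  qed
  moreover have c\<tau>: "continuous_on {-\<rho>..\<rho>} \<tau>" using \<tau>(1) by (rule continuous_on_subset) (use \<rho> in auto)
  ultimately have "strict_mono_on {-\<rho>..\<rho>} \<tau> \<or> strict_antimono_on {-\<rho>..\<rho>} \<tau>"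
    using injective_eq_monotone_map[OF is_interval_cc] by blast
  moreover have "\<not> strict_antimono_on {-\<rho>..\<rho>} \<tau>"
  proof
    assume "strict_antimono_on {-\<rho>..\<rho>} \<tau>"
    then have "\<tau> \<rho> < \<tau> 0" using \<rho>(1) by (auto simp: monotone_on_def)
    then show False using \<tau>(2) \<tau>(4)[of \<rho>] \<rho> by simp
  qed
  ultimately have mono: "strict_mono_on {-\<rho>..\<rho>} \<tau>" by blast
  have neg: "- ey \<le> \<tau> u" "\<tau> u \<le> 0" if u: "-\<rho> \<le> u" "u \<le> 0" for u
  proof -
    show "- ey \<le> \<tau> u" using \<delta>3(2)[of u] \<delta>2(2) u \<rho>(4) by auto
    show "\<tau> u \<le> 0"
    proof (cases "u = 0")
      case False
      then have "\<tau> u < \<tau> 0" by (intro strict_mono_onD[OF mono]) (use u \<rho>(1) in auto)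
      then show ?thesis using \<tau>(2) by simp
    qed (simp add: \<tau>(2))
  qed
  define A'' where "A'' = pa ` {-\<rho>..0}"
  define B'' where "B'' = inv_into W k ` (\<lambda>u. k y + r * \<tau> u) ` {-\<rho>..0}"
  have B''_eq: "B'' = (\<lambda>u. pb (\<tau> u)) ` {-\<rho>..0}" by (simp add: B''_def pb_def image_image)
  have A''_eq: "A'' = arm U f x (- s) \<rho>"
  proof -
    have "{-\<rho>..0} = uminus ` {0..\<rho>}" by simp
    then show ?thesis by (simp add: A''_def arm_def pa_def image_image del: image_uminus_atLeastAtMost)
  qed
  have ok: "is_arm U f x (- s) \<rho>"
    using a'(1) is_arm_mono[of U f x "- s" ea' \<rho>] \<rho> \<delta>1(2) ex(3) by (simp add: s')
  have c0: "continuous_on {-\<rho>..0} \<tau>" using c\<tau> by (rule continuous_on_subset) (use \<rho> in auto)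
  have IW: "(\<lambda>u. k y + r * \<tau> u) ` {-\<rho>..0} \<subseteq> k ` W"
  proof
    fix t assume "t \<in> (\<lambda>u. k y + r * \<tau> u) ` {-\<rho>..0}"
    then obtain u where u: "-\<rho> \<le> u" "u \<le> 0" "t = k y + r * \<tau> u" by auto
    then show "t \<in> k ` W" using twoy[of "\<tau> u"] neg[OF u(1,2)] by simp
  qed
  have cB'': "compactin (mtop S) B''"
    unfolding B''_def by (intro chart_compactin[OF d(1) IW] compact_continuous_image continuous_intros c0) auto
  have "\<tau> (-\<rho>) < \<tau> 0" using mono \<rho>(1) by (auto simp: monotone_on_def)
  then have sB'': "is_seg S B''"
    unfolding B''_def
    by (intro chart_seg[OF d(1) IW, of "k y + r * \<tau> (-\<rho>)" "k y + r * \<tau> 0"]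
        connected_continuous_image continuous_intros c0) (use \<rho> r in auto)
  have "\<phi> g ` \<iota> ` A'' = \<iota> ` B''"
    unfolding A''_def B''_eq image_image by (intro image_cong refl eq) auto
  then have "carries g A'' B''"
    unfolding carries_def A''_eq
    using D(1) arm_seg[OF c ok] sB'' cB'' embeds_on_compact by (simp add: A''_eq)
  moreover have "x \<in> A''" using arm_seg(3)[OF c ok] by (simp add: A''_eq)
  moreover have "y \<in> B''" unfolding B''_eq using pb0 \<tau>(2) \<rho>(1) by (intro image_eqI[of _ _ 0]) auto
  moreover have "A'' \<subseteq> A'" unfolding A''_def using paA' \<rho> \<delta>1(2) by auto
  moreover have "B'' \<subseteq> B'" unfolding B''_eq using pbB' neg by auto
  ultimately show thesis using that by blast
qed

end

section \<open>Interior points and ends of segments\<close>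

lemma seg_int_mono: "A \<subseteq> B \<Longrightarrow> seg_int S A \<subseteq> seg_int S B"
proof
  fix z assume AB: "A \<subseteq> B" and "z \<in> seg_int S A"
  then consider \<upsilon> where "homeomorphic_map (top_of_set U1) (mtop S) \<upsilon>"
      "z \<in> \<upsilon> ` (top_of_set U1 interior_of (U1 \<inter> \<upsilon> -` A))"
    | D :: "real set" and \<upsilon> where "nondegenerate_interval D" "homeomorphic_map (top_of_set D) (mtop S) \<upsilon>"
      "z \<in> \<upsilon> ` interior (D \<inter> \<upsilon> -` A)"
    unfolding seg_int_def by blast
  then show "z \<in> seg_int S B"
  proof cases
    case 1
    have "top_of_set U1 interior_of (U1 \<inter> \<upsilon> -` A) \<subseteq> top_of_set U1 interior_of (U1 \<inter> \<upsilon> -` B)"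
      using AB by (intro interior_of_mono) auto
    then show ?thesis unfolding seg_int_def using 1 by blast
  next
    case 2
    have "interior (D \<inter> \<upsilon> -` A) \<subseteq> interior (D \<inter> \<upsilon> -` B)"
      using AB by (intro interior_mono) auto
    then show ?thesis unfolding seg_int_def using 2 by blast
  qed
qed

lemma seg_bd_antimono: "A \<subseteq> B \<Longrightarrow> z \<in> A \<Longrightarrow> z \<in> seg_bd S B \<Longrightarrow> z \<in> seg_bd S A"
  using seg_int_mono unfolding seg_bd_def by blast

text \<open>A parametrization-free substitute for interior points: it is phrased by segments alone,
  so elements that carry segments preserve it, which is not apparent for
  \<open>seg_int\<close>.\<close>

definition two_sided :: "('s, real) charted \<Rightarrow> 's set \<Rightarrow> 's \<Rightarrow> bool" where
  "two_sided S A x \<longleftrightarrow> (\<exists>P Q. is_seg S P \<and> is_seg S Q \<and> P \<subseteq> A \<and> Q \<subseteq> A \<and> P \<inter> Q = {x})"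

lemma two_sided_path:
  fixes a b t :: real
  assumes q: "continuous_map (top_of_set {a..b}) (mtop S) q" "inj_on q {a..b}"
    and sub: "q ` {a..b} \<subseteq> A" and t: "a < t" "t < b"
  shows "two_sided S A (q t)"
  unfolding two_sided_def
proof (intro exI conjI)
  have seg: "is_seg S (q ` {c..d})" if "a \<le> c" "c < d" "d \<le> b" for c d
  proof -
    have "connectedin (top_of_set {a..b}) {c..d}" using that by (simp add: connectedin_subtopology)
    then have "connectedin (mtop S) (q ` {c..d})" using q(1) connectedin_continuous_map_image by blast
    moreover have "q c \<noteq> q d" using inj_onD[OF q(2), of c d] that by auto
    moreover have "q c \<in> q ` {c..d}" "q d \<in> q ` {c..d}" using that by auto
    ultimately show ?thesis unfolding is_seg_def by blast
  qed
  show "is_seg S (q ` {a..t})" "is_seg S (q ` {t..b})" using seg t by auto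
  show "q ` {a..t} \<subseteq> A" "q ` {t..b} \<subseteq> A" using sub t by (auto simp: image_subset_iff)
  have "q ` {a..t} \<inter> q ` {t..b} = q ` ({a..t} \<inter> {t..b})"
    using t by (intro inj_on_image_Int[OF q(2), symmetric]) auto
  also have "{a..t} \<inter> {t..b} = {t}" using t by auto
  finally show "q ` {a..t} \<inter> q ` {t..b} = {q t}" by simp
qed

lemma seg_int_two_sided:
  assumes "x \<in> seg_int S A"
  shows "two_sided S A x"
proof -
  consider \<upsilon> where "homeomorphic_map (top_of_set U1) (mtop S) \<upsilon>"
      "x \<in> \<upsilon> ` (top_of_set U1 interior_of (U1 \<inter> \<upsilon> -` A))"
    | D :: "real set" and \<upsilon> where "homeomorphic_map (top_of_set D) (mtop S) \<upsilon>" "x \<in> \<upsilon> ` interior (D \<inter> \<upsilon> -` A)"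
    using assms unfolding seg_int_def by blast
  then show ?thesis
  proof cases
    case 1
    then obtain c where c: "c \<in> top_of_set U1 interior_of (U1 \<inter> \<upsilon> -` A)" "x = \<upsilon> c" by blast
    then obtain V where V: "openin (top_of_set U1) V" "c \<in> V" "V \<subseteq> U1 \<inter> \<upsilon> -` A"
      unfolding interior_of_def by blast
    then obtain W where W: "open W" "V = U1 \<inter> W" by (auto simp: openin_open)
    have "norm c = 1" using V by auto
    then have "c \<noteq> 0" by auto
    then have "cis (Arg c) = c" using cis_Arg \<open>norm c = 1\<close> by (simp add: sgn_div_norm)
    then obtain t where t: "c = cis t" by metis
    have "isCont cis t"
      using continuous_on_cis[OF continuous_on_id, of UNIV] by (simp add: continuous_on_eq_continuous_at)
    moreover have "open W" "cis t \<in> W" using W V(2) t by auto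
    ultimately obtain T where T: "open T" "t \<in> T" "\<And>s. s \<in> T \<Longrightarrow> cis s \<in> W"
      unfolding continuous_at_open by metis
    obtain e0 where e0: "e0 > 0" "cball t e0 \<subseteq> T" using T(1,2) open_contains_cball by blast
    \<comment> \<open>With radius at most 1 the interval of angles has length at most 2, less than 2
      * pi, so \<open>cis\<close> is injective on it.\<close>
    define e where "e = min e0 1"
    have e: "0 < e" "e \<le> 1" "e \<le> e0" using e0(1) by (auto simp: e_def)
    have cisV: "cis s \<in> V" if "s \<in> {t - e..t + e}" for s
    proof -
      have "s \<in> cball t e0" using that e(3) by (auto simp: dist_real_def)
      then show ?thesis using W(2) T(3) e0(2) by auto
    qed
    have "two_sided S A ((\<upsilon> \<circ> cis) t)"
    proof (rule two_sided_path)
      have "continuous_map (top_of_set {t - e..t + e}) (top_of_set U1) cis"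
        by (auto intro!: continuous_intros)
      then show "continuous_map (top_of_set {t - e..t + e}) (mtop S) (\<upsilon> \<circ> cis)"
        using homeomorphic_imp_continuous_map[OF 1(1)] continuous_map_compose by blast
      show "inj_on (\<upsilon> \<circ> cis) {t - e..t + e}"
      proof (rule comp_inj_on)
        show "inj_on cis {t - e..t + e}"
        proof (rule inj_onI)
          fix r s assume rs: "r \<in> {t - e..t + e}" "s \<in> {t - e..t + e}" "cis r = cis s"
          then have "sin r = sin s \<and> cos r = cos s" by (auto simp: cis.code)
          then obtain n :: int where n: "r = s + 2 * pi * n" unfolding sin_cos_eq_iff by blast
          have "\<bar>r - s\<bar> \<le> 2" using rs e by auto
          then have "2 * pi * \<bar>real_of_int n\<bar> \<le> 2" using n by (simp add: abs_mult)
          moreover have "2 < 2 * pi" using pi_gt3 by simp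
          ultimately have "\<bar>real_of_int n\<bar> < 1"
            using mult_left_mono[of 1 "\<bar>real_of_int n\<bar>" "2 * pi"] by linarith
          then have "n = 0" by linarith
          then show "r = s" using n by simp
        qed
        have "inj_on \<upsilon> U1" using homeomorphic_imp_injective_map[OF 1(1)] by simp
        then show "inj_on \<upsilon> (cis ` {t - e..t + e})" by (rule inj_on_subset) auto
      qed
      show "(\<upsilon> \<circ> cis) ` {t - e..t + e} \<subseteq> A"
      proof
        fix y assume "y \<in> (\<upsilon> \<circ> cis) ` {t - e..t + e}"
        then obtain s where "s \<in> {t - e..t + e}" "y = \<upsilon> (cis s)" by auto
        then show "y \<in> A" using cisV[of s] V(3) by blast
      qed
    qed (use e in auto)
    then show ?thesis using c(2) t by simp
  next
    case 2
    then obtain t where t: "t \<in> interior (D \<inter> \<upsilon> -` A)" "x = \<upsilon> t" by blast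
    then obtain e where e: "e > 0" "cball t e \<subseteq> D \<inter> \<upsilon> -` A"
      unfolding mem_interior_cball by blast
    have sub: "{t - e..t + e} \<subseteq> D \<inter> \<upsilon> -` A" using e(2) by (simp add: cball_eq_atLeastAtMost)
    have "two_sided S A (\<upsilon> t)"
    proof (rule two_sided_path)
      have "continuous_map (subtopology (top_of_set D) {t - e..t + e}) (mtop S) \<upsilon>"
        by (intro continuous_map_from_subtopology homeomorphic_imp_continuous_map[OF 2(1)])
      moreover have "subtopology (top_of_set D) {t - e..t + e} = top_of_set {t - e..t + e}"
        using sub by (simp add: subtopology_subtopology Int_absorb1)
      ultimately show "continuous_map (top_of_set {t - e..t + e}) (mtop S) \<upsilon>" by simp
      have "inj_on \<upsilon> D" using homeomorphic_imp_injective_map[OF 2(1)] by simp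
      then show "inj_on \<upsilon> {t - e..t + e}" by (rule inj_on_subset) (use sub in auto)
      show "\<upsilon> ` {t - e..t + e} \<subseteq> A" using sub by auto
    qed (use e in auto)
    then show ?thesis using t(2) by simp
  qed
qed

text \<open>On the circle the coordinate is the angle measured from a point outside \<open>A\<close>.\<close>

lemma real_coordinate:
  assumes S: "circle_type S \<or> interval_type S" and A: "A \<subseteq> pts S" "A \<noteq> pts S \<or> interval_type S"
  obtains \<rho> :: "'s \<Rightarrow> real"
  where "continuous_map (subtopology (mtop S) A) euclideanreal \<rho>" "inj_on \<rho> A"
proof (cases "interval_type S")
  case True
  then obtain D :: "real set" and \<upsilon> where "homeomorphic_map (top_of_set D) (mtop S) \<upsilon>"
    unfolding interval_type_def homeomorphic_space by blast
  then obtain \<rho> where \<rho>: "homeomorphic_maps (top_of_set D) (mtop S) \<upsilon> \<rho>"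
    using homeomorphic_map_maps by blast
  then have "continuous_map (mtop S) euclideanreal \<rho>"
    unfolding homeomorphic_maps_def using continuous_map_in_subtopology by blast
  then have "continuous_map (subtopology (mtop S) A) euclideanreal \<rho>"
    by (rule continuous_map_from_subtopology)
  moreover have "inj_on \<rho> A"
    by (rule inj_on_inverseI[of _ \<upsilon>]) (use \<rho> A(1) in \<open>auto simp: homeomorphic_maps_def\<close>)
  ultimately show thesis by (rule that)
next
  case False
  then obtain \<upsilon> where "homeomorphic_map (top_of_set U1) (mtop S) \<upsilon>"
    using S unfolding circle_type_def homeomorphic_space by blast
  then obtain \<psi> where \<psi>: "homeomorphic_maps (top_of_set U1) (mtop S) \<upsilon> \<psi>"
    using homeomorphic_map_maps by blast
  obtain s0 where s0: "s0 \<in> pts S" "s0 \<notin> A" using A False by blast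
  have \<psi>U: "norm (\<psi> z) = 1" if "z \<in> pts S" for z
    using \<psi> that unfolding homeomorphic_maps_def continuous_map_def by auto
  have \<psi>i: "z = z'" if "z \<in> pts S" "z' \<in> pts S" "\<psi> z = \<psi> z'" for z z'
    using \<psi> that unfolding homeomorphic_maps_def by metis
  \<comment> \<open>Rotates the omitted point \<open>s0\<close> to 1, the only point of the unit
    circle on the cut of \<open>Arg2pi\<close>.\<close>
  define w where "w z = \<psi> z / \<psi> s0" for z
  have w1: "norm (w z) = 1" if "z \<in> A" for z
    using that A(1) \<psi>U s0 by (auto simp: w_def norm_divide)
  have w: "w z \<notin> \<real>\<^sub>\<ge>\<^sub>0" if z: "z \<in> A" for z
  proof
    assume "w z \<in> \<real>\<^sub>\<ge>\<^sub>0"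
    then have "w z = 1" using w1[OF z] by (auto elim!: nonneg_Reals_cases)
    then have "\<psi> z = \<psi> s0" using \<psi>U[OF s0(1)] by (auto simp: w_def)
    then show False using \<psi>i[of z s0] z A(1) s0 by auto
  qed
  have "continuous_map (mtop S) euclidean \<psi>"
    using \<psi> unfolding homeomorphic_maps_def using continuous_map_in_subtopology by blast
  then have "continuous_map (subtopology (mtop S) A) euclidean \<psi>"
    by (rule continuous_map_from_subtopology)
  moreover have "continuous_map euclidean euclidean (\<lambda>c. c / \<psi> s0)"
    using \<psi>U[OF s0(1)] by (auto intro!: continuous_intros)
  ultimately have "continuous_map (subtopology (mtop S) A) euclidean w"
    unfolding w_def using continuous_map_compose[of _ _ \<psi> _ "\<lambda>c. c / \<psi> s0"] by (simp add: o_def)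
  then have "continuous_map (subtopology (mtop S) A) (top_of_set (- \<real>\<^sub>\<ge>\<^sub>0)) w"
    using w by (simp add: continuous_map_in_subtopology image_subset_iff_funcset[symmetric] image_subset_iff)
  moreover have "continuous_on (- \<real>\<^sub>\<ge>\<^sub>0) Arg2pi"
    using continuous_at_Arg2pi by (intro continuous_at_imp_continuous_on) auto
  then have "continuous_map (top_of_set (- \<real>\<^sub>\<ge>\<^sub>0)) euclideanreal Arg2pi" by simp
  ultimately have "continuous_map (subtopology (mtop S) A) euclideanreal (Arg2pi \<circ> w)"
    by (rule continuous_map_compose)
  moreover have "inj_on (Arg2pi \<circ> w) A"
  proof (rule inj_onI)
    fix z z' assume z: "z \<in> A" "z' \<in> A" "(Arg2pi \<circ> w) z = (Arg2pi \<circ> w) z'"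
    have "w z = w z'" using Arg2pi_eq[of "w z"] Arg2pi_eq[of "w z'"] w1[OF z(1)] w1[OF z(2)] z(3) by simp
    then have "\<psi> z = \<psi> z'" using \<psi>U[OF s0(1)] by (auto simp: w_def)
    then show "z = z'" using \<psi>i z(1,2) A(1) by blast
  qed
  ultimately show thesis by (rule that)
qed

text \<open>By compactness the coordinate identifies A with a closed interval; p and q are the
  points over its endpoints.\<close>

lemma arc_two_ends:
  assumes H: "Hausdorff_space (mtop S)" and A: "is_seg S A" "compactin (mtop S) A"
    and \<rho>: "continuous_map (subtopology (mtop S) A) euclideanreal \<rho>" "inj_on \<rho> A"
  obtains p q where "\<And>x. x \<in> A \<Longrightarrow> x \<noteq> p \<Longrightarrow> x \<noteq> q \<Longrightarrow> two_sided S A x"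
proof -
  have AS: "A \<subseteq> pts S" using is_segD(2)[OF A(1)] .
  then have top: "topspace (subtopology (mtop S) A) = A" by auto
  have comp: "compact_space (subtopology (mtop S) A)" using A(2) compact_space_subtopology by blast
  have "closed_map (subtopology (mtop S) A) euclideanreal \<rho>"
    by (rule continuous_imp_closed_map_gen[OF comp Hausdorff_imp_kc_space \<rho>(1)]) simp
  then have "embedding_map (subtopology (mtop S) A) euclideanreal \<rho>"
    using \<rho> by (intro injective_closed_imp_embedding_map) (simp_all add: AS Int_absorb1)
  then have "homeomorphic_map (subtopology (mtop S) A) (top_of_set (\<rho> ` A)) \<rho>"
    by (simp add: embedding_map_def top del: topspace_subtopology)
  then obtain q where q: "homeomorphic_maps (subtopology (mtop S) A) (top_of_set (\<rho> ` A)) \<rho> q"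
    using homeomorphic_map_maps by blast
  have "compactin euclideanreal (\<rho> ` A)"
    using image_compactin[OF _ \<rho>(1)] comp by (metis compact_space_def top)
  moreover have "connectedin euclideanreal (\<rho> ` A)"
    using connectedin_continuous_map_image[OF \<rho>(1)] is_segD(1)[OF A(1)]
    by (simp add: connectedin_subtopology)
  ultimately obtain l r where lr: "\<rho> ` A = {l..r}"
    using connected_compact_interval_1[of "\<rho> ` A"] by auto
  have q\<rho>: "q (\<rho> x) = x" if "x \<in> A" for x using q that top unfolding homeomorphic_maps_def by auto
  have qA: "q t \<in> A" "\<rho> (q t) = t" if t: "t \<in> {l..r}" for t
  proof -
    obtain x where "x \<in> A" "t = \<rho> x" using t lr by blast
    then show "q t \<in> A" "\<rho> (q t) = t" using q\<rho> by auto
  qed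
  show thesis
  proof (rule that[of "q l" "q r"])
    fix x assume x: "x \<in> A" "x \<noteq> q l" "x \<noteq> q r"
    have "\<rho> x \<in> {l..r}" using x(1) lr by blast
    moreover have "\<rho> x \<noteq> l" "\<rho> x \<noteq> r" using q\<rho>[OF x(1)] x by auto
    ultimately have lt: "l < \<rho> x" "\<rho> x < r" by auto
    have "two_sided S A (q (\<rho> x))"
    proof (rule two_sided_path[OF _ _ _ lt])
      show "continuous_map (top_of_set {l..r}) (mtop S) q"
        using q lr unfolding homeomorphic_maps_def by (auto simp: continuous_map_in_subtopology)
      show "inj_on q {l..r}" by (rule inj_on_inverseI[of _ \<rho>]) (rule qA(2))
      show "q ` {l..r} \<subseteq> A" using qA(1) by blast
    qed
    then show "two_sided S A x" using q\<rho>[OF x(1)] by simp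
  qed
qed

context curve_action
begin

subsection \<open>Classes and negativity\<close>

abbreviation GS :: "'g set" where
  "GS \<equiv> S_stabilizer G \<phi> S \<iota>"

lemma GS_iff: "g \<in> GS \<longleftrightarrow> g \<in> carrier G \<and> (\<forall>z\<in>pts S. \<phi> g (\<iota> z) = \<iota> z)"
proof -
  \<comment> \<open>An intersection over an empty curve would be the whole type instead of lying in
    the carrier.\<close>
  have "pts S \<noteq> {}" using curve unfolding analytic_1_submanifold_def by blast
  then show ?thesis unfolding S_stabilizer_def stabilizer_def by blast
qed

lemma GS_subgroup: "subgroup GS G"
proof (rule subgroupI)
  show "GS \<subseteq> carrier G" using GS_iff by blast
  show "GS \<noteq> {}" using GS_iff[of \<one>] \<phi>_one by auto
  show "inv g \<in> GS" if "g \<in> GS" for g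
    using that \<phi>_inv(1) \<iota>_pts unfolding GS_iff by (metis inv_closed)
  show "g \<otimes> h \<in> GS" if "g \<in> GS" "h \<in> GS" for g h
    using that \<phi>_mult unfolding GS_iff by simp
qed

lemma S_class_self: "g \<in> carrier G \<Longrightarrow> g \<in> S_class G \<phi> S \<iota> g"
  unfolding S_class_def l_coset_def using subgroup.one_closed[OF GS_subgroup] by force

lemma S_class_eq_iff:
  assumes "g \<in> carrier G" "h \<in> carrier G"
  shows "S_class G \<phi> S \<iota> g = S_class G \<phi> S \<iota> h \<longleftrightarrow> inv g \<otimes> h \<in> GS"
proof
  assume "S_class G \<phi> S \<iota> g = S_class G \<phi> S \<iota> h"
  then have "h \<in> S_class G \<phi> S \<iota> g" using S_class_self[OF assms(2)] by simp
  then obtain k where "k \<in> GS" "h = g \<otimes> k" unfolding S_class_def l_coset_def by blast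
  then show "inv g \<otimes> h \<in> GS" using assms GS_iff by (simp add: m_assoc[symmetric])
next
  assume k: "inv g \<otimes> h \<in> GS"
  have "h = g \<otimes> (inv g \<otimes> h)" using assms by (simp add: m_assoc[symmetric])
  then have "h \<in> g <# GS" unfolding l_coset_def using k by blast
  then show "S_class G \<phi> S \<iota> g = S_class G \<phi> S \<iota> h"
    unfolding S_class_def by (rule l_repr_independence[OF _ assms(1) GS_subgroup])
qed

lemma S_class_\<phi>:
  assumes "g \<in> carrier G" "h \<in> carrier G" "S_class G \<phi> S \<iota> g = S_class G \<phi> S \<iota> h" "z \<in> pts S"
  shows "\<phi> g (\<iota> z) = \<phi> h (\<iota> z)"
proof -
  have "h \<in> S_class G \<phi> S \<iota> g" using S_class_self assms(2,3) by simp
  then obtain k where "k \<in> GS" "h = g \<otimes> k" unfolding S_class_def l_coset_def by blast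
  then show ?thesis using assms GS_iff \<phi>_mult by simp
qed

lemma free_segsD:
  assumes "\<Sigma> \<in> free_segs G \<phi> M S \<iota>"
  shows "is_seg S \<Sigma>" "carries g A B \<Longrightarrow> A \<subseteq> \<Sigma> \<Longrightarrow> B \<subseteq> \<Sigma> \<Longrightarrow> g \<in> GS"
  using assms carries_imp_sim_o carriesD(1) unfolding free_segs_def by blast+

text \<open>The preimages of \<open>D\<close> under g and h are segments in \<Sigma>, and
  \<open>inv g \<otimes> h\<close> carries one to the other, so freeness applies. Both the
  uniqueness of the gluing class and the recursion for the classes rest on this criterion.\<close>

lemma carries_common_target:
  assumes \<Sigma>: "\<Sigma> \<in> free_segs G \<phi> M S \<iota>" and g: "carries g A B" "A \<subseteq> \<Sigma>" and h: "carries h A' B'" "A' \<subseteq> \<Sigma>"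
    and D: "is_seg S D" "D \<subseteq> B \<inter> B'"
  shows "inv g \<otimes> h \<in> GS"
proof -
  have "D \<subseteq> B" "D \<subseteq> B'" using D(2) by blast+
  obtain D1 where D1: "D1 \<subseteq> A" "carries (inv g) D D1"
    using carries_restrict[OF carries_inv[OF g(1)] \<open>D \<subseteq> B\<close> D(1)] .
  obtain D2 where D2: "D2 \<subseteq> A'" "carries (inv h) D D2"
    using carries_restrict[OF carries_inv[OF h(1)] \<open>D \<subseteq> B'\<close> D(1)] .
  have "carries h D2 D" using carries_inv[OF D2(2)] carriesD(1)[OF h(1)] by simp
  then have "carries (inv g \<otimes> h) D2 D1" using D1(2) by (rule carries_compose)
  then show ?thesis by (rule free_segsD(2)[OF \<Sigma>]) (use D1(1) D2(1) g(2) h(2) in auto)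
qed

lemma seg_contains_compact_seg:
  assumes "is_seg S A" "x \<in> A"
  obtains B where "is_seg S B" "compactin (mtop S) B" "x \<in> B" "B \<subseteq> A"
proof -
  have "x \<in> pts S" using assms is_segD(2) by blast
  then obtain U f where c: "(U, f) \<in> atlas S" "x \<in> U" using chart_at by blast
  obtain s e where "is_arm U f x s e" "arm U f x s e \<subseteq> A" using seg_contains_arm[OF c assms] by blast
  then show thesis using arm_seg[OF c] that by blast
qed

text \<open>If \<open>h\<close> carries a subsegment of \<open>T\<close> into \<open>T\<close>, then \<open>g\<inverse>hg\<close> fixes \<open>\<iota>\<close> on \<open>\<Sigma>\<close>, so \<open>h\<close> fixes
  \<open>\<iota>\<close> on \<open>T\<close>; continuing across the common point, \<open>h\<close> carries a subsegment of \<open>\<Sigma>\<close> into \<open>\<Sigma>\<close>.\<close>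

lemma adjacent_image_free:
  assumes \<Sigma>: "\<Sigma> \<in> free_segs G \<phi> M S \<iota>" and T: "carries g \<Sigma>' T" "\<Sigma>' \<subseteq> \<Sigma>" "\<Sigma> \<inter> T = {z}"
  shows "T \<in> free_segs G \<phi> M S \<iota>"
proof -
  note D = carriesD[OF T(1)]
  have zT: "z \<in> T" "z \<in> pts S" using T(3) D(5) by blast+
  have "h \<in> GS" if h: "h \<in> carrier G" "sim_o \<phi> M S \<iota> h T T" for h
  proof -
    obtain V V' where V: "carries h V V'" "V \<subseteq> T" "V' \<subseteq> T"
      using h unfolding sim_o_def carries_def by blast
    obtain V0 where V0: "V0 \<subseteq> \<Sigma>'" "carries (inv g) V V0"
      using carries_restrict[OF carries_inv[OF T(1)] V(2) carriesD(2)[OF V(1)]] .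
    obtain V0' where V0': "V0' \<subseteq> \<Sigma>'" "carries (inv g) V' V0'"
      using carries_restrict[OF carries_inv[OF T(1)] V(3) carriesD(3)[OF V(1)]] .
    have "carries g V0 V" using carries_inv[OF V0(2)] D(1) by simp
    then have "carries (inv g \<otimes> (h \<otimes> g)) V0 V0'"
      by (intro carries_compose[OF carries_compose V0'(2)]) (use V(1) in auto)
    then have k: "inv g \<otimes> (h \<otimes> g) \<in> GS"
      by (rule free_segsD(2)[OF \<Sigma>]) (use V0(1) V0'(1) T(2) in auto)
    have fixT: "\<phi> h (\<iota> y) = \<iota> y" if y: "y \<in> T" for y
    proof -
      obtain x where x: "x \<in> \<Sigma>'" "\<phi> g (\<iota> x) = \<iota> y" using D(9)[OF y] by blast
      have xS: "x \<in> pts S" using x(1) D(4) by blast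
      have "\<phi> g (\<phi> (inv g \<otimes> (h \<otimes> g)) (\<iota> x)) = \<phi> g (\<iota> x)" using k xS unfolding GS_iff by simp
      moreover have "\<phi> (inv g \<otimes> (h \<otimes> g)) (\<iota> x) = \<phi> (inv g) (\<phi> h (\<phi> g (\<iota> x)))"
        using composition_rule[of "\<iota> x" "inv g" "h \<otimes> g"] \<phi>_mult[OF h(1) D(1) xS] \<iota>_pts[OF xS] h(1) D(1)
        by simp
      moreover have "\<phi> h (\<phi> g (\<iota> x)) \<in> pts M" using element_image[OF h(1)] \<phi>_\<iota>_pts[OF D(1) xS] by blast
      ultimately show ?thesis using \<phi>_inv(2)[OF D(1)] x(2) by simp
    qed
    have "\<phi> h ` \<iota> ` T = \<iota> ` T" unfolding image_image by (rule image_cong) (auto simp: fixT)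
    then have "carries h T T" unfolding carries_def using h(1) D(3,7) by simp
    then obtain A'' B'' where "carries h A'' B''" "A'' \<subseteq> \<Sigma>" "B'' \<subseteq> \<Sigma>"
      using carries_across[of h T T z z \<Sigma> \<Sigma>] zT(1) fixT free_segsD(1)[OF \<Sigma>] T(3) by (metis inf_commute)
    then show ?thesis by (rule free_segsD(2)[OF \<Sigma>])
  qed
  moreover have "sim_o \<phi> M S \<iota> h T T" if h: "h \<in> GS" for h
  proof -
    have "\<phi> h ` \<iota> ` T = \<iota> ` T"
      unfolding image_image by (rule image_cong) (use h D(5) GS_iff in auto)
    then have "carries h T T" unfolding carries_def using h GS_iff D(3,7) by simp
    then show ?thesis by (rule carries_imp_sim_o) auto
  qed
  ultimately show ?thesis unfolding free_segs_def using D(3) by blast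
qed

text \<open>The class of g turns out to be the gluing class at z, and negativity then says that g
  fixes \<iota> z. The compact segments demanded by \<open>gluing_class\<close> come from shrinking
  to a piece next to the preimage of z, freeness of the target from
  \<open>adjacent_image_free\<close>. Allowing a part \<Sigma>' of \<Sigma> covers a neighbour that
  is only a partial copy of \<Sigma>.\<close>

lemma negative_fixes_junction:
  assumes \<Sigma>: "\<Sigma> \<in> free_segs G \<phi> M S \<iota>" and neg: "negative_seg G \<phi> M S \<iota> \<Sigma>"
    and T: "carries g \<Sigma>' T" "\<Sigma>' \<subseteq> \<Sigma>" "\<Sigma> \<inter> T = {z}"
    and z: "z \<in> seg_bd S \<Sigma>" "z \<in> seg_bd S T" "z \<in> seg_int S (pts S)"
  shows "\<phi> g (\<iota> z) = \<iota> z"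
proof -
  note D = carriesD[OF T(1)]
  note \<Sigma>seg = free_segsD(1)[OF \<Sigma>]
  have zT: "z \<in> T" "z \<in> \<Sigma>" "z \<in> pts S" using T(3) D(5) by blast+
  obtain b where b: "b \<in> \<Sigma>'" "\<phi> g (\<iota> b) = \<iota> z" using D(9)[OF zT(1)] by blast
  have bS: "b \<in> pts S" "b \<in> \<Sigma>" using b(1) D(4) T(2) by blast+
  \<comment> \<open>If b were interior to \<Sigma>, the curve would continue beyond b inside
    \<Sigma>, while beyond z it continues T into \<Sigma>. Continuation would make g carry a piece
    of \<Sigma> into \<Sigma>; then g lies in \<open>GS\<close>, so b = z, and z would be interior
    to \<Sigma>.\<close>
  have bbd: "b \<in> seg_bd S \<Sigma>"
  proof (rule ccontr)
    assume "b \<notin> seg_bd S \<Sigma>"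
    then have bi: "b \<in> seg_int S \<Sigma>" using bS(2) unfolding seg_bd_def by blast
    then obtain P1 P2 where P: "is_seg S P1" "is_seg S P2" "P1 \<subseteq> \<Sigma>" "P2 \<subseteq> \<Sigma>" "P1 \<inter> P2 = {b}"
      using seg_int_two_sided unfolding two_sided_def by metis
    obtain P Q where PQ: "is_seg S P" "is_seg S Q" "P \<subseteq> P1 \<union> P2" "Q \<subseteq> \<Sigma>'" "P \<inter> Q = {b}"
      by (rule opposite_seg[OF P(1,2,5) D(2) b(1)])
    obtain B1 where B1: "B1 \<subseteq> T" "carries g Q B1" using carries_restrict[OF T(1) PQ(4,2)] .
    have bQ: "b \<in> Q" using PQ(5) by blast
    then have zB1: "z \<in> B1" using carries_mem_iff[OF B1(2) bS(1) zT(3) b(2)] by blast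
    have "Q \<inter> P = {b}" "B1 \<inter> \<Sigma> = {z}" using PQ(5) B1(1) zB1 zT(2) T(3) by blast+
    from carries_across[OF B1(2) bQ zB1 b(2) PQ(1) this(1) \<Sigma>seg this(2)]
    obtain A'' B'' where "carries g A'' B''" "A'' \<subseteq> P" "B'' \<subseteq> \<Sigma>" by metis
    then have "g \<in> GS" using free_segsD(2)[OF \<Sigma>] PQ(3) P(3,4) by blast
    then have "\<iota> b = \<iota> z" using b(2) bS(1) GS_iff by simp
    then have "b = z" using inj_onD[OF inj_\<iota>] bS(1) zT(3) by blast
    then show False using bi z(1) unfolding seg_bd_def by blast
  qed
  obtain \<Sigma>b where \<Sigma>b: "is_seg S \<Sigma>b" "compactin (mtop S) \<Sigma>b" "b \<in> \<Sigma>b" "\<Sigma>b \<subseteq> \<Sigma>'"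
    using seg_contains_compact_seg[OF D(2) b(1)] .
  obtain \<Sigma>z where \<Sigma>z: "\<Sigma>z \<subseteq> T" "carries g \<Sigma>b \<Sigma>z" "compactin (mtop S) \<Sigma>b \<longrightarrow> compactin (mtop S) \<Sigma>z"
    using carries_restrict[OF T(1) \<Sigma>b(4,1)] .
  have z\<Sigma>z: "z \<in> \<Sigma>z" using carries_mem_iff[OF \<Sigma>z(2) bS(1) zT(3) b(2)] \<Sigma>b(3) by blast
  have Int: "\<Sigma> \<inter> \<Sigma>z = {z}" using \<Sigma>z(1) z\<Sigma>z zT(2) T(3) by blast
  have b\<Sigma>: "\<Sigma>b \<subseteq> \<Sigma>" using \<Sigma>b(4) T(2) by blast
  \<comment> \<open>Names the predicate under the definite description in
    \<open>gluing_class\<close>, for which existence and uniqueness are proved.\<close>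
  define glues where "glues c \<longleftrightarrow> c \<noteq> S_class G \<phi> S \<iota> \<one> \<and>
     (\<exists>g\<in>carrier G. c = S_class G \<phi> S \<iota> g \<and>
        (\<exists>\<Sigma>b \<Sigma>z b. is_seg S \<Sigma>b \<and> compactin (mtop S) \<Sigma>b \<and> \<Sigma>b \<subseteq> \<Sigma> \<and>
           b \<in> seg_bd S \<Sigma> \<inter> seg_bd S \<Sigma>b \<and>
           \<Sigma>z \<in> free_segs G \<phi> M S \<iota> \<and> compactin (mtop S) \<Sigma>z \<and>
           \<Sigma> \<inter> \<Sigma>z = {z} \<and> seg_bd S \<Sigma> \<inter> seg_bd S \<Sigma>z = {z} \<and>
           \<phi> g ` \<iota> ` \<Sigma>b = \<iota> ` \<Sigma>z \<and> \<phi> g (\<iota> b) = \<iota> z))" for c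
  \<comment> \<open>An element of the trivial class would fix the curve pointwise and leave
    \<open>\<Sigma>z\<close> inside \<Sigma>, which it meets only in z.\<close>
  have "S_class G \<phi> S \<iota> g \<noteq> S_class G \<phi> S \<iota> \<one>"
  proof
    assume eq: "S_class G \<phi> S \<iota> g = S_class G \<phi> S \<iota> \<one>"
    have "\<Sigma>z \<subseteq> \<Sigma>"
    proof
      fix y assume y: "y \<in> \<Sigma>z"
      obtain x where x: "x \<in> \<Sigma>b" "\<phi> g (\<iota> x) = \<iota> y" using carriesD(9)[OF \<Sigma>z(2) y] by blast
      have "x \<in> pts S" "y \<in> pts S" using x y carriesD(4,5)[OF \<Sigma>z(2)] by blast+
      then have "\<iota> x = \<iota> y" using S_class_\<phi>[OF D(1) one_closed eq] \<phi>_one x(2) by simp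
      then have "x = y" using inj_onD[OF inj_\<iota>] \<open>x \<in> pts S\<close> \<open>y \<in> pts S\<close> by blast
      then show "y \<in> \<Sigma>" using x(1) b\<Sigma> by blast
    qed
    then have "\<Sigma>z = {z}" using Int by blast
    then show False using carriesD(3)[OF \<Sigma>z(2)] by (simp add: is_seg_def)
  qed
  moreover have "\<phi> g ` \<iota> ` \<Sigma>b = \<iota> ` \<Sigma>z" using \<Sigma>z(2) by (simp add: carries_def)
  moreover have "b \<in> seg_bd S \<Sigma>b" using seg_bd_antimono[OF b\<Sigma> \<Sigma>b(3) bbd] .
  moreover have "seg_bd S \<Sigma> \<inter> seg_bd S \<Sigma>z = {z}"
    using seg_bd_antimono[OF \<Sigma>z(1) z\<Sigma>z z(2)] z(1) Int unfolding seg_bd_def by blast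
  moreover have "\<Sigma>z \<in> free_segs G \<phi> M S \<iota>" by (rule adjacent_image_free[OF \<Sigma> \<Sigma>z(2) b\<Sigma> Int])
  moreover have "compactin (mtop S) \<Sigma>z" using \<Sigma>z(3) \<Sigma>b(2) by blast
  ultimately have glue: "glues (S_class G \<phi> S \<iota> g)"
    unfolding glues_def using D(1) \<Sigma>b(1,2) b\<Sigma> bbd Int b(2)
    by (intro conjI bexI[of _ g] exI[of _ \<Sigma>b] exI[of _ \<Sigma>z] exI[of _ b]) auto
  \<comment> \<open>A competitor also carries part of \<Sigma> to a segment that leaves \<Sigma> at
    z. There is only one direction in which to leave, so this segment overlaps T.\<close>
  have uniq: "c = S_class G \<phi> S \<iota> g" if c: "glues c" for c
  proof -
    from c obtain h \<Sigma>b' \<Sigma>z' where h: "h \<in> carrier G" "c = S_class G \<phi> S \<iota> h" "is_seg S \<Sigma>b'"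
      "compactin (mtop S) \<Sigma>b'" "\<Sigma>b' \<subseteq> \<Sigma>" "\<Sigma>z' \<in> free_segs G \<phi> M S \<iota>" "compactin (mtop S) \<Sigma>z'"
      "\<Sigma> \<inter> \<Sigma>z' = {z}" "\<phi> h ` \<iota> ` \<Sigma>b' = \<iota> ` \<Sigma>z'"
      unfolding glues_def by blast
    have seg': "is_seg S \<Sigma>z'" using free_segsD(1)[OF h(6)] .
    then have carr: "carries h \<Sigma>b' \<Sigma>z'"
      unfolding carries_def using h embeds_on_compact by simp
    obtain E where "is_seg S E" "E \<subseteq> \<Sigma>z' \<inter> T"
      using no_triod[OF \<Sigma>seg seg' D(3) h(8) T(3)] by metis
    then have "inv h \<otimes> g \<in> GS" using carries_common_target[OF \<Sigma> carr h(5) T(1,2)] by blast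
    then show ?thesis using S_class_eq_iff[OF h(1) D(1)] h(2) by simp
  qed
  have "gluing_class G \<phi> M S \<iota> \<Sigma> z = S_class G \<phi> S \<iota> g"
    unfolding gluing_class_def glues_def[symmetric] using glue uniq by (rule the_equality)
  then have "S_class G \<phi> S \<iota> g \<subseteq> stabilizer G \<phi> (\<iota> z)"
    using neg z(1,3) unfolding negative_seg_def by auto
  then show ?thesis using S_class_self[OF D(1)] unfolding stabilizer_def by blast
qed

end

section \<open>Alternating products\<close>

text \<open>Factors are appended on the right, so that the new one acts first, on \<Sigma> itself,
  before the product already known to carry \<Sigma> to its k-th copy.\<close>

primrec alt_prod :: "('g, 'b) monoid_scheme \<Rightarrow> 'g \<Rightarrow> 'g \<Rightarrow> nat \<Rightarrow> 'g" where
  "alt_prod G x y 0 = \<one>\<^bsub>G\<^esub>"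
| "alt_prod G x y (Suc k) = alt_prod G x y k \<otimes>\<^bsub>G\<^esub> (if even k then x else y)"

context curve_action
begin

lemma alt_prod_closed:
  "x \<in> carrier G \<Longrightarrow> y \<in> carrier G \<Longrightarrow> alt_prod G x y k \<in> carrier G"
  by (induction k) auto

lemma foldr_mult_snoc:
  "set xs \<subseteq> carrier G \<Longrightarrow> y \<in> carrier G \<Longrightarrow>
    foldr (\<lambda>x y. x \<otimes> y) (xs @ [y]) \<one> = foldr (\<lambda>x y. x \<otimes> y) xs \<one> \<otimes> y
    \<and> foldr (\<lambda>x y. x \<otimes> y) xs \<one> \<in> carrier G"
  by (induction xs) (auto simp: m_assoc)

lemma foldr_mult_alternating:
  assumes "x \<in> carrier G" "y \<in> carrier G" "\<And>k. F (int (Suc k)) = (if even k then x else y)"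
  shows "foldr (\<lambda>x y. x \<otimes> y) (map F [1..int k]) \<one> = alt_prod G x y k"
proof (induction k)
  case (Suc k)
  have snoc: "map F [1..int (Suc k)] = map F [1..int k] @ [F (int (Suc k))]"
    by (simp add: upto_rec2)
  have "F i \<in> carrier G" if "i \<in> {1..}" for i
  proof -
    have "i = int (Suc (nat (i - 1)))" using that by simp
    then show ?thesis using assms by metis
  qed
  then have "set (map F [1..int k]) \<subseteq> carrier G" "F (int (Suc k)) \<in> carrier G" by auto
  from foldr_mult_snoc[OF this] show ?case by (simp only: snoc Suc.IH assms(3) alt_prod.simps)
qed simp

text \<open>\<open>sigma\<close> takes the values 1, -1, 1, ... on 1, 2, 3, ... and -1, 1, -1, ...
  on -1, -2, -3, ...; negative indices thus exchange the roles of \<open>g 1\<close> and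
  \<open>g (-1)\<close>.\<close>

lemma sigma_prod_alternating:
  assumes "g 1 \<in> carrier G" "g (-1) \<in> carrier G" "0 < k"
  shows "sigma_prod G g (int k) = alt_prod G (g 1) (g (-1)) k"
    and "sigma_prod G g (- int k) = alt_prod G (g (-1)) (g 1) k"
proof -
  have "sigma (int (Suc j)) = (if even j then 1 else -1)"
    "sigma (- int (Suc j)) = (if even j then -1 else 1)" for j
    by (simp_all add: sigma_def nat_add_distrib)
  then have "g (sigma (1 * int (Suc j))) = (if even j then g 1 else g (-1))"
    "g (sigma (- 1 * int (Suc j))) = (if even j then g (-1) else g 1)" for j
    by (simp_all only: mult_1 mult_minus1 if_distrib[of g])
  note eqs = foldr_mult_alternating[OF assms(1,2) this(1)] foldr_mult_alternating[OF assms(2,1) this(2)]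
  show "sigma_prod G g (int k) = alt_prod G (g 1) (g (-1)) k"
    using eqs(1)[of k] assms(3) by (simp add: sigma_prod_def)
  show "sigma_prod G g (- int k) = alt_prod G (g (-1)) (g 1) k"
    using eqs(2)[of k] assms(3) by (simp add: sigma_prod_def)
qed

text \<open>Two sides P and Q of x inside A together with C would be three directions at x. This
  detects ends of segments without comparing parametrizations.\<close>

lemma junction_not_two_sided:
  assumes "is_seg S C" "A \<inter> C = {x}"
  shows "\<not> two_sided S A x"
proof
  assume "two_sided S A x"
  then obtain P Q where PQ: "is_seg S P" "is_seg S Q" "P \<subseteq> A" "Q \<subseteq> A" "P \<inter> Q = {x}"
    unfolding two_sided_def by blast
  then have "C \<inter> P = {x}" "C \<inter> Q = {x}" using assms(2) by blast+
  then obtain D where "is_seg S D" "D \<subseteq> {x}"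
    using no_triod[OF assms(1) PQ(1,2)] PQ(5) by metis
  then show False unfolding is_seg_def by blast
qed

text \<open>Used contrapositively: a point that is sent to an end of \<open>B\<close> is an end of
  \<open>A\<close>.\<close>

lemma carries_two_sided:
  assumes gAB: "carries g A B" and b: "two_sided S A x" "\<phi> g (\<iota> x) = \<iota> y" "x \<in> pts S" "y \<in> pts S"
  shows "two_sided S B y"
proof -
  obtain P Q where PQ: "is_seg S P" "is_seg S Q" "P \<subseteq> A" "Q \<subseteq> A" "P \<inter> Q = {x}"
    using b(1) unfolding two_sided_def by blast
  obtain P' where P': "P' \<subseteq> B" "carries g P P'" using carries_restrict[OF gAB PQ(3,1)] .
  obtain Q' where Q': "Q' \<subseteq> B" "carries g Q Q'" using carries_restrict[OF gAB PQ(4,2)] .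
  have "y \<in> P'" "y \<in> Q'"
    using carries_mem_iff[OF P'(2) b(3,4,2)] carries_mem_iff[OF Q'(2) b(3,4,2)] PQ(5) by blast+
  moreover have "w = y" if w: "w \<in> P'" "w \<in> Q'" for w
  proof -
    obtain u where u: "u \<in> P" "\<phi> g (\<iota> u) = \<iota> w" using carriesD(9)[OF P'(2) w(1)] by blast
    have uw: "u \<in> pts S" "w \<in> pts S" using u(1) w(1) carriesD(4,5)[OF P'(2)] by blast+
    then have "u \<in> Q" using carries_mem_iff[OF Q'(2) uw u(2)] w(2) by blast
    then have "u = x" using u(1) PQ(5) by blast
    then have "\<iota> w = \<iota> y" using u(2) b(2) by simp
    then show ?thesis using inj_onD[OF inj_\<iota>] uw(2) b(4) by blast
  qed
  ultimately have "P' \<inter> Q' = {y}" by blast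
  then show ?thesis
    unfolding two_sided_def using carriesD(3)[OF P'(2)] carriesD(3)[OF Q'(2)] P'(1) Q'(1) by blast
qed

text \<open>Here s carries \<Sigma> to T and sends the end e to the junction z of T with the next
  segment \<open>T'\<close>, while R is the neighbour of \<Sigma> at e. Working with parts
  \<open>Q\<close> and \<open>Q'\<close> of \<Sigma> admits the incomplete segments at the ends of
  S. That \<gamma> fixes \<iota> e enters only later, in locating the next outer end.\<close>

lemma chain_step:
  assumes \<Sigma>: "\<Sigma> \<in> free_segs G \<phi> M S \<iota>" and s: "carries s \<Sigma> T" and e: "\<phi> s (\<iota> e) = \<iota> z"
    and \<gamma>: "carries \<gamma> Q R" "Q \<subseteq> \<Sigma>" "\<Sigma> \<inter> R = {e}"
    and T': "T \<inter> T' = {z}" and h: "carries h Q' T'" "Q' \<subseteq> \<Sigma>"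
  shows "inv h \<otimes> (s \<otimes> \<gamma>) \<in> GS"
proof -
  have "e \<in> \<Sigma>" "z \<in> T" using \<gamma>(3) T' by blast+
  then obtain A B where AB: "carries s A B" "A \<subseteq> R" "B \<subseteq> T'"
    using carries_across[OF s _ _ e carriesD(3)[OF \<gamma>(1)] \<gamma>(3) carriesD(3)[OF h(1)] T'] by metis
  obtain Q'' where Q'': "Q'' \<subseteq> Q" "carries (inv \<gamma>) A Q''"
    using carries_restrict[OF carries_inv[OF \<gamma>(1)] AB(2) carriesD(2)[OF AB(1)]] .
  have "carries \<gamma> Q'' A" using carries_inv[OF Q''(2)] carriesD(1)[OF \<gamma>(1)] by simp
  then have "carries (s \<otimes> \<gamma>) Q'' B" using AB(1) by (rule carries_compose)
  then show ?thesis
    by (rule carries_common_target[OF \<Sigma> h _ _ carriesD(3)[OF AB(1)]]) (use Q''(1) \<gamma>(2) AB(3) in auto)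
qed

text \<open>The \<open>k\<close>-th alternating product carries \<open>\<Sigma>\<close> to \<open>T k\<close>, and its outer end comes alternately from
  the two ends of \<open>\<Sigma>\<close>; the next factor fixes the relevant end.\<close>

lemma alternating_chain:
  fixes T :: "nat \<Rightarrow> 's set" and g :: "nat \<Rightarrow> 'g"
  assumes \<Sigma>: "\<Sigma> \<in> free_segs G \<phi> M S \<iota>" and neg: "negative_seg G \<phi> M S \<iota> \<Sigma>"
    and comp: "compactin (mtop S) \<Sigma>" and int: "\<Sigma> \<subseteq> seg_int S (pts S)"
    and ends: "\<And>x. x \<in> \<Sigma> \<Longrightarrow> x \<noteq> p \<Longrightarrow> x \<noteq> q \<Longrightarrow> two_sided S \<Sigma> x"
    and T0: "T 0 = \<Sigma>" and N: "0 < N"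
    and adj: "\<And>i. i < N \<Longrightarrow> T i \<inter> T (Suc i) = seg_bd S (T i) \<inter> seg_bd S (T (Suc i))
      \<and> is_singleton (T i \<inter> T (Suc i))"
    and adjR: "\<Sigma> \<inter> R = seg_bd S \<Sigma> \<inter> seg_bd S R" "is_singleton (\<Sigma> \<inter> R)"
    and skip: "\<And>i D. i + 2 \<le> N \<Longrightarrow> is_seg S D \<Longrightarrow> \<not> D \<subseteq> T i \<inter> T (i + 2)"
    and skipR: "\<And>D. is_seg S D \<Longrightarrow> \<not> D \<subseteq> R \<inter> T 1"
    and carr: "\<And>i. 0 < i \<Longrightarrow> i < N \<Longrightarrow> carries (g i) \<Sigma> (T i)"
    and carr1: "carries \<gamma>' Q1 (T 1)" "Q1 \<subseteq> \<Sigma>"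
    and carrN: "carries (g N) QN (T N)" "QN \<subseteq> \<Sigma>"
    and carrR: "carries \<gamma> QR R" "QR \<subseteq> \<Sigma>"
  shows "S_class G \<phi> S \<iota> (g N) = S_class G \<phi> S \<iota> (alt_prod G \<gamma>' \<gamma> N)"
proof -
  note \<Sigma>seg = free_segsD(1)[OF \<Sigma>]
  obtain z where z: "\<And>i. i < N \<Longrightarrow> T i \<inter> T (Suc i) = {z i}"
    using adj unfolding is_singleton_def by metis
  define zp where "zp = z 0"
  have zp: "\<Sigma> \<inter> T 1 = {zp}" using z[of 0] N T0 by (simp add: zp_def)
  obtain zm where zm: "\<Sigma> \<inter> R = {zm}" using adjR(2) unfolding is_singleton_def by blast
  have zpm: "zp \<in> \<Sigma>" "zm \<in> \<Sigma>" using zp zm by blast+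
  have "zp \<in> seg_bd S \<Sigma>" "zp \<in> seg_bd S (T 1)" using adj[of 0] N T0 zp by auto
  then have fixp: "\<phi> \<gamma>' (\<iota> zp) = \<iota> zp"
    using negative_fixes_junction[OF \<Sigma> neg carr1 zp] int zpm(1) by blast
  have "zm \<in> seg_bd S \<Sigma>" "zm \<in> seg_bd S R" using adjR(1) zm by blast+
  then have fixm: "\<phi> \<gamma> (\<iota> zm) = \<iota> zm"
    using negative_fixes_junction[OF \<Sigma> neg carrR zm] int zpm(2) by blast
  note Rseg = carriesD(3)[OF carrR(1)] and T1seg = carriesD(3)[OF carr1(1)]
  have gc: "\<gamma>' \<in> carrier G" "\<gamma> \<in> carrier G" using carriesD(1) carr1(1) carrR(1) by blast+
  \<comment> \<open>Were both neighbours attached at the same end of \<Sigma>, they would overlap in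
    a segment, against \<open>skipR\<close>.\<close>
  have "zp \<noteq> zm"
    using no_triod[OF \<Sigma>seg Rseg T1seg zm] zp skipR by metis
  moreover have "\<not> two_sided S \<Sigma> zp" by (rule junction_not_two_sided[OF T1seg zp])
  moreover have "\<not> two_sided S \<Sigma> zm" by (rule junction_not_two_sided[OF Rseg zm])
  ultimately have two: "two_sided S \<Sigma> x" if "x \<in> \<Sigma>" "x \<noteq> zp" "x \<noteq> zm" for x
    using ends that zpm by metis
  \<comment> \<open>The end of \<Sigma> that goes to the outer end of T k. The factor appended next
    fixes it, so the new product still sends \<open>E k\<close> to z k, which is now the inner end
    of T (k + 1); the outer end must come from the other end of \<Sigma>.\<close>
  define E where "E k = (if even k then zp else zm)" for k :: nat
  let ?\<gamma> = "\<lambda>k. if even k then \<gamma>' else \<gamma>" and ?p = "alt_prod G \<gamma>' \<gamma>"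
  have pc: "?p k \<in> carrier G" for k by (rule alt_prod_closed[OF gc])
  have Tseg: "is_seg S (T i)" if "i \<le> N" for i
  proof -
    consider "i = 0" | "i = N" | "0 < i" "i < N" using \<open>i \<le> N\<close> by linarith
    then show ?thesis using T0 \<Sigma>seg carriesD(3)[OF carrN(1)] carriesD(3)[OF carr] by cases auto
  qed
  \<comment> \<open>Kept apart from the induction because it also serves the last index, where
    \<open>g N\<close> may carry only a part of \<Sigma> to T N and no further junction is
    given.\<close>
  have step: "S_class G \<phi> S \<iota> (g (Suc k)) = S_class G \<phi> S \<iota> (?p (Suc k))"
    if k: "k < N" "carries (?p k) \<Sigma> (T k)" "\<phi> (?p k) (\<iota> (E k)) = \<iota> (z k)" for k
  proof -
    obtain Q' where Q': "carries (g (Suc k)) Q' (T (Suc k))" "Q' \<subseteq> \<Sigma>"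
      using carr[of "Suc k"] carrN k(1) by (cases "Suc k = N") auto
    have "inv (g (Suc k)) \<otimes> (?p k \<otimes> ?\<gamma> k) \<in> GS"
    proof (cases "even k")
      case True
      then show ?thesis
        using chain_step[OF \<Sigma> k(2,3) carr1 _ z[OF k(1)] Q'] zp by (simp add: E_def)
    next
      case False
      then show ?thesis
        using chain_step[OF \<Sigma> k(2,3) carrR _ z[OF k(1)] Q'] zm by (simp add: E_def)
    qed
    then show ?thesis using S_class_eq_iff[OF carriesD(1)[OF Q'(1)] pc[of "Suc k"]] by (simp only: alt_prod.simps)
  qed
  have main: "k < N \<Longrightarrow> carries (?p k) \<Sigma> (T k) \<and> \<phi> (?p k) (\<iota> (E k)) = \<iota> (z k)" for k
  proof (induction k)
    case 0
    have "\<Sigma> \<subseteq> pts S" using is_segD(2)[OF \<Sigma>seg] .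
    then have "\<phi> \<one> ` \<iota> ` \<Sigma> = \<iota> ` \<Sigma>"
      unfolding image_image by (intro image_cong) (auto simp: \<phi>_one)
    then have "carries \<one> \<Sigma> (T 0)"
      using \<Sigma>seg embeds_on_compact[OF comp] by (simp add: carries_def T0)
    then show ?case using zpm \<open>\<Sigma> \<subseteq> pts S\<close> by (auto simp: E_def zp_def[symmetric] \<phi>_one)
  next
    case (Suc k)
    then have k: "k < N" "carries (?p k) \<Sigma> (T k)" "\<phi> (?p k) (\<iota> (E k)) = \<iota> (z k)" by auto
    note cls = step[OF k]
    have g: "carries (g (Suc k)) \<Sigma> (T (Suc k))" using carr Suc.prems by simp
    note D = carriesD[OF g]
    have eq: "\<phi> (?p (Suc k)) (\<iota> x) = \<phi> (g (Suc k)) (\<iota> x)" if "x \<in> pts S" for x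
      using S_class_\<phi>[OF pc D(1) cls[symmetric] that] .
    have "\<phi> (?p (Suc k)) ` \<iota> ` \<Sigma> = \<phi> (g (Suc k)) ` \<iota> ` \<Sigma>"
      unfolding image_image by (intro image_cong refl eq) (use D(4) in blast)
    then have c: "carries (?p (Suc k)) \<Sigma> (T (Suc k))"
      using g pc[of "Suc k"] unfolding carries_def by simp
    have ES: "E j \<in> pts S" "E j \<in> \<Sigma>" for j using zpm D(4) by (auto simp: E_def)
    have "\<phi> (?\<gamma> k) (\<iota> (E k)) = \<iota> (E k)" using fixp fixm by (simp add: E_def)
    then have inner: "\<phi> (?p (Suc k)) (\<iota> (E k)) = \<iota> (z k)"
      using k(3) \<phi>_mult[OF pc _ ES(1), of "?\<gamma> k" k k] gc by simp
    have zS: "z (Suc k) \<in> T (Suc k)" using z[OF Suc.prems] by blast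
    obtain b where b: "b \<in> \<Sigma>" "\<phi> (?p (Suc k)) (\<iota> b) = \<iota> (z (Suc k))"
      using carriesD(9)[OF c zS] by blast
    have "\<not> two_sided S (T (Suc k)) (z (Suc k))"
      by (rule junction_not_two_sided[OF Tseg z[OF Suc.prems]]) (use Suc.prems in simp)
    then have "\<not> two_sided S \<Sigma> b"
      using carries_two_sided[OF c _ b(2)] b(1) D(4,5) zS by blast
    then have "b = zp \<or> b = zm" using two b(1) by blast
    \<comment> \<open>Otherwise T k and T (k + 2) would leave T (k + 1) at the same point and hence
      overlap in a segment, against \<open>skip\<close>.\<close>
    moreover have "b \<noteq> E k"
    proof
      assume "b = E k"
      then have "\<iota> (z k) = \<iota> (z (Suc k))" using b(2) inner by simp
      moreover have "z k \<in> T (Suc k)" using z[OF k(1)] by blast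
      ultimately have "z k = z (Suc k)" using inj_onD[OF inj_\<iota>] zS D(5) by blast
      then have I: "T (Suc k) \<inter> T k = {z k}" "T (Suc k) \<inter> T (Suc (Suc k)) = {z k}"
        using z[OF k(1)] z[OF Suc.prems] by (metis inf_commute)+
      have "is_seg S (T k)" "is_seg S (T (Suc (Suc k)))" using Tseg Suc.prems by auto
        then obtain X where "is_seg S X" "X \<subseteq> T k \<inter> T (Suc (Suc k))"
        by (rule no_triod[OF D(3) _ _ I]) (rule that)
      then show False using skip[of k X] Suc.prems by simp
    qed
    ultimately have "b = E (Suc k)" unfolding E_def by (cases "even k") auto
    then show ?case using c b(2) by blast
  qed
  obtain K where K: "N = Suc K" using N gr0_implies_Suc by blast
  then show ?thesis using step[of K] main[of K] by simp
qed

section \<open>Application to the two kinds of decomposition\<close>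

lemma not_seg_subset_singleton: "is_singleton X \<or> X = {} \<Longrightarrow> is_seg S D \<Longrightarrow> \<not> D \<subseteq> X"
  unfolding is_singleton_def is_seg_def by blast

text \<open>Since g n stands in for index -1, the neighbour of \<Sigma> on the other side is the
  last segment of the circle; the chain runs forward from \<Sigma> to the k-th segment.\<close>

lemma circle_classes:
  assumes \<Sigma>: "\<Sigma> \<in> free_segs G \<phi> M S \<iota>" "negative_seg G \<phi> M S \<iota> \<Sigma>" "compactin (mtop S) \<Sigma>"
      "\<Sigma> \<subseteq> seg_int S (pts S)"
    and ends: "\<And>x. x \<in> \<Sigma> \<Longrightarrow> x \<noteq> p \<Longrightarrow> x \<noteq> q \<Longrightarrow> two_sided S \<Sigma> x"
    and dec: "circle_decomposition G \<phi> M S \<iota> \<Sigma> n \<Sigma>s g" and k: "k \<in> {1..n}"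
  shows "S_class G \<phi> S \<iota> (g k) =
    S_class G \<phi> S \<iota> (sigma_prod G (\<lambda>j. if j = -1 then g n else g (nat j)) (int k))"
proof -
  have n: "1 \<le> n" and mem: "\<forall>i\<le>n. \<Sigma>s i \<in> max_segs G \<phi> M S \<iota> \<and> compactin (mtop S) (\<Sigma>s i) \<and> g i \<in> carrier G"
    and T0: "\<Sigma>s 0 = \<Sigma>" and carr: "\<forall>i\<le>n. \<phi> (g i) ` \<iota> ` \<Sigma>s 0 = \<iota> ` \<Sigma>s i"
    and junctions: "n \<ge> 2 \<longrightarrow>
        (\<forall>p\<le>n. \<forall>q\<le>n.
           (\<bar>int p - int q\<bar> \<in> {1, int n} \<longrightarrow>
              \<Sigma>s p \<inter> \<Sigma>s q = seg_bd S (\<Sigma>s p) \<inter> seg_bd S (\<Sigma>s q) \<and> is_singleton (\<Sigma>s p \<inter> \<Sigma>s q)) \<and>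
           (2 \<le> \<bar>int p - int q\<bar> \<and> \<bar>int p - int q\<bar> \<le> int n - 1 \<longrightarrow>
              \<Sigma>s p \<inter> \<Sigma>s q = seg_bd S (\<Sigma>s p) \<inter> seg_bd S (\<Sigma>s q) \<and> \<Sigma>s p \<inter> \<Sigma>s q = {}))"
    using dec[unfolded circle_decomposition_def] by - ((elim conjE, assumption)+)
  have adj: "\<Sigma>s i \<inter> \<Sigma>s j = seg_bd S (\<Sigma>s i) \<inter> seg_bd S (\<Sigma>s j) \<and> is_singleton (\<Sigma>s i \<inter> \<Sigma>s j)"
    if "2 \<le> n" "i \<le> n" "j \<le> n" "\<bar>int i - int j\<bar> \<in> {1, int n}" for i j
    by (rule junctions[THEN mp, OF that(1), THEN spec, THEN mp, OF that(2), THEN spec, THEN mp, OF that(3),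
          THEN conjunct1, THEN mp, OF that(4)])
  have far: "\<Sigma>s i \<inter> \<Sigma>s j = {}"
    if "2 \<le> n" "i \<le> n" "j \<le> n" "2 \<le> \<bar>int i - int j\<bar>" "\<bar>int i - int j\<bar> \<le> int n - 1" for i j
    using junctions[THEN mp, OF that(1), THEN spec, THEN mp, OF that(2), THEN spec, THEN mp, OF that(3),
          THEN conjunct2, THEN mp, OF conjI[OF that(4,5)]] by (rule conjunct2)
  let ?g = "\<lambda>j::int. if j = -1 then g n else g (nat j)"
  have gc: "g 1 \<in> carrier G" "g n \<in> carrier G" using mem n by auto
  have prod: "sigma_prod G ?g (int k) = alt_prod G (g 1) (g n) k"
    using sigma_prod_alternating(1)[of ?g k] gc k by simp
  show ?thesis
  \<comment> \<open>With n = 1 the two segments meet in two points and do not form a chain with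
    single junctions; but then k = 1 and the product is the single factor
    \<open>g 1\<close>.\<close>
  proof (cases "n = 1")
    case True
    then show ?thesis using prod k gc by simp
  next
    case False
    then have n2: "2 \<le> n" using n by simp
    have c: "carries (g i) \<Sigma> (\<Sigma>s i)" if "i \<le> n" for i
      using that mem carr free_segsD(1) embeds_on_compact free_segsD(1)[OF \<Sigma>(1)] embeds_on_compact[OF \<Sigma>(3)]
      unfolding carries_def max_segs_def by (simp add: T0)
    \<comment> \<open>Segments two apart need not be disjoint: for n = 2 the segments 0 and 2 are
      neighbours across the closing point. A single common point is harmless, as it contains no
      segment.\<close>
    have near: "is_singleton (\<Sigma>s i \<inter> \<Sigma>s j) \<or> \<Sigma>s i \<inter> \<Sigma>s j = {}" if "i \<le> n" "j \<le> n" "i \<noteq> j" for i j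
    proof (cases "\<bar>int i - int j\<bar> \<in> {1, int n}")
      case True
      then show ?thesis using adj[OF n2 that(1,2)] by blast
    next
      case False
      then have "2 \<le> \<bar>int i - int j\<bar>" "\<bar>int i - int j\<bar> \<le> int n - 1" using that by auto
      then show ?thesis using far[OF n2 that(1,2)] by blast
    qed
    have skipR: "is_singleton (\<Sigma>s n \<inter> \<Sigma>s 1) \<or> \<Sigma>s n \<inter> \<Sigma>s 1 = {}" using near[of n 1] n2 by simp
    have "\<bar>int 0 - int n\<bar> \<in> {1, int n}" by simp
    note R = adj[OF n2 le0 order_refl this, unfolded T0]
    have "S_class G \<phi> S \<iota> (g k) = S_class G \<phi> S \<iota> (alt_prod G (g 1) (g n) k)"
    proof (rule alternating_chain[where T=\<Sigma>s and R="\<Sigma>s n" and ?Q1.0=\<Sigma> and QN=\<Sigma> and QR=\<Sigma> and \<gamma>'="g 1" and \<gamma>="g n" and g=g, OF \<Sigma> ends T0])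
      show "\<Sigma> \<inter> \<Sigma>s n = seg_bd S \<Sigma> \<inter> seg_bd S (\<Sigma>s n)" "is_singleton (\<Sigma> \<inter> \<Sigma>s n)"
        using R by (rule conjunct1, rule conjunct2)
      show "\<Sigma>s i \<inter> \<Sigma>s (Suc i) = seg_bd S (\<Sigma>s i) \<inter> seg_bd S (\<Sigma>s (Suc i))
          \<and> is_singleton (\<Sigma>s i \<inter> \<Sigma>s (Suc i))" if "i < k" for i
        by (rule adj[OF n2]) (use that k in auto)
      show "\<not> D \<subseteq> \<Sigma>s i \<inter> \<Sigma>s (i + 2)" if "i + 2 \<le> k" "is_seg S D" for i D
        using not_seg_subset_singleton[OF near that(2), of i "i + 2"] that(1) k by simp
      show "\<not> D \<subseteq> \<Sigma>s n \<inter> \<Sigma>s 1" if "is_seg S D" for D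
        using not_seg_subset_singleton[OF skipR that] .
    qed (use k n in \<open>auto intro: c\<close>)
    then show ?thesis using prod by simp
  qed
qed

text \<open>Both directions are treated together: with s = 1 or s = -1 the chain consists of the
  \<open>\<Sigma>s (s * int i)\<close>, and the neighbour on the other side is
  \<open>\<Sigma>s (- s)\<close>.\<close>

lemma interval_classes:
  assumes \<Sigma>: "\<Sigma> \<in> free_segs G \<phi> M S \<iota>" "negative_seg G \<phi> M S \<iota> \<Sigma>" "compactin (mtop S) \<Sigma>"
      "\<Sigma> \<subseteq> seg_int S (pts S)"
    and ends: "\<And>x. x \<in> \<Sigma> \<Longrightarrow> x \<noteq> p \<Longrightarrow> x \<noteq> q \<Longrightarrow> two_sided S \<Sigma> x"
    and dec: "interval_decomposition G \<phi> M S \<iota> \<Sigma> a b \<Sigma>s g" and n: "n \<in> index_range a b - {0}"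
  shows "S_class G \<phi> S \<iota> (g n) = S_class G \<phi> S \<iota> (sigma_prod G g n)"
proof -
  have ab: "a < Fin 0" "Fin 0 < b"
    and mem: "\<forall>i\<in>index_range a b. is_seg S (\<Sigma>s i) \<and> embeds_on M S \<iota> (\<Sigma>s i) \<and> g i \<in> carrier G"
    and T0: "\<Sigma>s 0 = \<Sigma>"
    and junctions: "\<forall>p\<in>index_range a b. \<forall>q\<in>index_range a b.
        (\<bar>p - q\<bar> = 1 \<longrightarrow>
           \<Sigma>s p \<inter> \<Sigma>s q = seg_bd S (\<Sigma>s p) \<inter> seg_bd S (\<Sigma>s q) \<and> is_singleton (\<Sigma>s p \<inter> \<Sigma>s q)) \<and>
        (\<bar>p - q\<bar> \<ge> 2 \<longrightarrow>
           \<Sigma>s p \<inter> \<Sigma>s q = seg_bd S (\<Sigma>s p) \<inter> seg_bd S (\<Sigma>s q) \<and> \<Sigma>s p \<inter> \<Sigma>s q = {})"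
    and carr: "\<forall>i. a < Fin i \<and> Fin i < b \<longrightarrow> \<phi> (g i) ` \<iota> ` \<Sigma>s 0 = \<iota> ` \<Sigma>s i"
    and carr_end: "\<forall>i. Fin i = a \<or> Fin i = b \<longrightarrow>
        (\<exists>Q. boundary_seg S (\<Sigma>s 0) Q \<and> \<phi> (g i) ` \<iota> ` Q = \<iota> ` \<Sigma>s i)"
    using dec[unfolded interval_decomposition_def] by - ((elim conjE, assumption)+)
  have adj: "\<Sigma>s i \<inter> \<Sigma>s j = seg_bd S (\<Sigma>s i) \<inter> seg_bd S (\<Sigma>s j) \<and> is_singleton (\<Sigma>s i \<inter> \<Sigma>s j)"
    if "i \<in> index_range a b" "j \<in> index_range a b" "\<bar>i - j\<bar> = 1" for i j
    by (rule bspec[OF bspec[OF junctions that(1)] that(2), THEN conjunct1, THEN mp, OF that(3)])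
  have far: "\<Sigma>s i \<inter> \<Sigma>s j = {}"
    if "i \<in> index_range a b" "j \<in> index_range a b" "2 \<le> \<bar>i - j\<bar>" for i j
    using bspec[OF bspec[OF junctions that(1)] that(2), THEN conjunct2, THEN mp, OF that(3)] by (rule conjunct2)
  \<comment> \<open>The condition \<open>0 \<le> i * j\<close> puts j on the same side of 0 as i. A
    strictly smaller absolute value keeps j away from the extreme indices, where only a part of
    \<Sigma> is carried.\<close>
  have lt: "a < Fin j" "Fin j < b" if "i \<in> index_range a b" "\<bar>j\<bar> < \<bar>i\<bar>" "0 \<le> i * j" for i j
    using that ab unfolding index_range_def by (cases a; cases b; auto simp: zero_le_mult_iff)+
  have range: "j \<in> index_range a b" if "i \<in> index_range a b" "\<bar>j\<bar> \<le> \<bar>i\<bar>" "0 \<le> i * j" for i j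
    using that ab unfolding index_range_def by (cases a; cases b; auto simp: zero_le_mult_iff)+
  have r1: "1 \<in> index_range a b" "-1 \<in> index_range a b"
    using ab unfolding index_range_def by (cases a; cases b; auto)+
  have \<Sigma>emb: "embeds_on M S \<iota> \<Sigma>" using embeds_on_compact[OF \<Sigma>(3)] .
  have full: "carries (g i) \<Sigma> (\<Sigma>s i)" if "i \<in> index_range a b" "a < Fin i" "Fin i < b" for i
    using that mem carr free_segsD(1)[OF \<Sigma>(1)] \<Sigma>emb unfolding carries_def
    by (simp add: T0)
  have part: "\<exists>Q. carries (g i) Q (\<Sigma>s i) \<and> Q \<subseteq> \<Sigma>" if i: "i \<in> index_range a b" for i
  proof (cases "Fin i = a \<or> Fin i = b")
    case True
    from carr_end[THEN spec, THEN mp, OF this] obtain Q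
      where "boundary_seg S \<Sigma> Q" and Q: "\<phi> (g i) ` \<iota> ` Q = \<iota> ` \<Sigma>s i"
      unfolding T0 by (elim exE conjE)
    then have "is_seg S Q" "Q \<subseteq> \<Sigma>" by (simp_all add: boundary_seg_def)
    moreover from this(2) have "embeds_on M S \<iota> Q" by (rule embeds_on_mono[OF \<Sigma>emb])
    ultimately have "carries (g i) Q (\<Sigma>s i)"
      unfolding carries_def using bspec[OF mem i] Q by simp
    then show ?thesis using \<open>Q \<subseteq> \<Sigma>\<close> by blast
  next
    case False
    then have "a < Fin i" "Fin i < b" using i unfolding index_range_def by auto
    then show ?thesis using full[OF i] by blast
  qed
  have gc: "g 1 \<in> carrier G" "g (-1) \<in> carrier G" using mem r1 by blast+
  have skipR: "\<not> D \<subseteq> \<Sigma>s 1 \<inter> \<Sigma>s (-1)" if "is_seg S D" for D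
    using far[OF r1] that unfolding is_seg_def by auto
  have chain: "S_class G \<phi> S \<iota> (g (s * int k)) = S_class G \<phi> S \<iota> (alt_prod G (g s) (g (- s)) k)"
    if s: "s = 1 \<or> s = -1" and k: "0 < k" and sk: "s * int k \<in> index_range a b" for s k
  proof -
    have ir: "s * int i \<in> index_range a b" if "i \<le> k" for i
      by (rule range[OF sk]) (use s that in auto)
    have s1: "s \<in> index_range a b" "- s \<in> index_range a b" using s r1 by auto
    obtain Q1 QN QR where Q: "carries (g s) Q1 (\<Sigma>s s)" "Q1 \<subseteq> \<Sigma>"
      "carries (g (s * int k)) QN (\<Sigma>s (s * int k))" "QN \<subseteq> \<Sigma>" "carries (g (- s)) QR (\<Sigma>s (- s))" "QR \<subseteq> \<Sigma>"
      using part[OF s1(1)] part[OF sk] part[OF s1(2)] by blast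
    have "0 \<in> index_range a b" "\<bar>0 - - s\<bar> = 1" using ir[of 0] s by auto
    note R = adj[OF this(1) s1(2) this(2), unfolded T0]
    have "S_class G \<phi> S \<iota> ((\<lambda>i. g (s * int i)) k)
        = S_class G \<phi> S \<iota> (alt_prod G (g s) (g (- s)) k)"
    proof (rule alternating_chain[where T="\<lambda>i. \<Sigma>s (s * int i)" and R="\<Sigma>s (- s)"
          and ?Q1.0=Q1 and QN=QN and QR=QR, OF \<Sigma> ends])
      show "\<Sigma> \<inter> \<Sigma>s (- s) = seg_bd S \<Sigma> \<inter> seg_bd S (\<Sigma>s (- s))" "is_singleton (\<Sigma> \<inter> \<Sigma>s (- s))"
        using R by (rule conjunct1, rule conjunct2)
      show "\<Sigma>s (s * int i) \<inter> \<Sigma>s (s * int (Suc i)) = seg_bd S (\<Sigma>s (s * int i)) \<inter> seg_bd S (\<Sigma>s (s * int (Suc i)))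
          \<and> is_singleton (\<Sigma>s (s * int i) \<inter> \<Sigma>s (s * int (Suc i)))" if "i < k" for i
        by (rule adj[OF ir ir]) (use that s in auto)
      show "\<not> D \<subseteq> \<Sigma>s (s * int i) \<inter> \<Sigma>s (s * int (i + 2))" if "i + 2 \<le> k" "is_seg S D" for i D
      proof -
        have "\<Sigma>s (s * int i) \<inter> \<Sigma>s (s * int (i + 2)) = {}"
          by (rule far[OF ir ir]) (use that(1) s in \<open>auto simp: algebra_simps\<close>)
        then show ?thesis using that(2) unfolding is_seg_def by blast
      qed
      show "\<not> D \<subseteq> \<Sigma>s (- s) \<inter> \<Sigma>s (s * int 1)" if "is_seg S D" for D
        using skipR[OF that] s by auto
      show "carries (g (s * int i)) \<Sigma> (\<Sigma>s (s * int i))" if "0 < i" "i < k" for i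
      proof (rule full[OF ir])
        show "a < Fin (s * int i)" "Fin (s * int i) < b"
          by (rule lt[OF sk]; use s that in auto)+
      qed (use that in simp)
    qed (use Q T0 k in simp_all)
    then show ?thesis by simp
  qed
  have "n \<noteq> 0" "n \<in> index_range a b" using n by auto
  then consider k where "n = int k" "0 < k" | k where "n = - int k" "0 < k"
    by (metis int_cases2 of_nat_0 neg_equal_0_iff_equal gr0I)
  then show ?thesis
  proof cases
    case 1
    then show ?thesis using chain[of 1 k] sigma_prod_alternating(1)[OF gc 1(2)] \<open>n \<in> index_range a b\<close> by simp
  next
    case 2
    then show ?thesis using chain[of "-1" k] sigma_prod_alternating(2)[OF gc 2(2)] \<open>n \<in> index_range a b\<close> by simp
  qed
qed

end

theorem proposition7:
  fixes G :: "('g, 'b) monoid_scheme"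
    and \<Gamma> :: "('g, 'l::euclidean_space) charted"
    and M :: "('m, 'e::euclidean_space) charted"
    and S :: "('s, real) charted"
    and \<phi> :: "'g \<Rightarrow> 'm \<Rightarrow> 'm"
    and \<iota> :: "'s \<Rightarrow> 'm"
    and \<Sigma> :: "'s set"
  assumes "lie_group G \<Gamma>"
    and "analytic_manifold M"
    and "group_action G (pts M) \<phi>"
    and "\<forall>x\<in>pts M. continuous_map (mtop \<Gamma>) (mtop M) (\<lambda>g. \<phi> g x)"
    and "non_contractive G \<phi> M"
    and "analytic_1_submanifold M S \<iota>"
    and "free_submanifold G \<phi> M S \<iota>"
    and "pts S \<notin> free_segs G \<phi> M S \<iota>"
    and "negative_submanifold G \<phi> M S \<iota>"
    and "\<Sigma> \<in> max_segs G \<phi> M S \<iota>"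
    and "compactin (mtop S) \<Sigma>"
    and "\<Sigma> \<subset> seg_int S (pts S)"
  shows "(circle_type S \<longrightarrow>
            (\<forall>n \<Sigma>s g. circle_decomposition G \<phi> M S \<iota> \<Sigma> n \<Sigma>s g \<longrightarrow>
               (\<forall>k\<in>{1..n}. S_class G \<phi> S \<iota> (g k) =
                  S_class G \<phi> S \<iota>
                    (sigma_prod G (\<lambda>j. if j = -1 then g n else g (nat j)) (int k))))) \<and>
         (interval_type S \<longrightarrow>
            (\<forall>a b \<Sigma>s g. interval_decomposition G \<phi> M S \<iota> \<Sigma> a b \<Sigma>s g \<longrightarrow>
               (\<forall>n\<in>index_range a b - {0}. S_class G \<phi> S \<iota> (g n) =
                  S_class G \<phi> S \<iota> (sigma_prod G g n))))"
proof -
  have "analytic_in_M G \<phi> M" using \<open>non_contractive G \<phi> M\<close> by (simp add: non_contractive_def)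
  then interpret curve_action G M S \<phi> \<iota>
    by (rule curve_action.intro[OF assms(3,2) _ assms(6)])
  have \<Sigma>: "\<Sigma> \<in> free_segs G \<phi> M S \<iota>" "negative_seg G \<phi> M S \<iota> \<Sigma>" "compactin (mtop S) \<Sigma>"
      "\<Sigma> \<subseteq> seg_int S (pts S)"
    using assms(9-12) unfolding max_segs_def negative_submanifold_def by auto
  have "seg_int S (pts S) \<subseteq> pts S"
  proof
    fix x assume "x \<in> seg_int S (pts S)"
    from seg_int_two_sided[OF this] show "x \<in> pts S" unfolding two_sided_def by blast
  qed
  \<comment> \<open>\<Sigma> omits a point of S; on a circle this is what makes a real coordinate on
    \<Sigma> possible.\<close>
  then have proper: "\<Sigma> \<subseteq> pts S" "\<Sigma> \<noteq> pts S" using assms(12) by blast+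
  have ends: "\<exists>p q. \<forall>x\<in>\<Sigma>. x \<noteq> p \<longrightarrow> x \<noteq> q \<longrightarrow> two_sided S \<Sigma> x" if S: "circle_type S \<or> interval_type S"
  proof -
    obtain \<rho> :: "'s \<Rightarrow> real"
      where \<rho>: "continuous_map (subtopology (mtop S) \<Sigma>) euclideanreal \<rho>" "inj_on \<rho> \<Sigma>"
      using real_coordinate[OF S proper(1)] proper(2) by blast
    obtain p q where "\<And>x. x \<in> \<Sigma> \<Longrightarrow> x \<noteq> p \<Longrightarrow> x \<noteq> q \<Longrightarrow> two_sided S \<Sigma> x"
      using arc_two_ends[OF Hausdorff(1) free_segsD(1)[OF \<Sigma>(1)] \<Sigma>(3) \<rho>] by blast
    then show ?thesis by blast
  qed
  show ?thesis
  proof (intro conjI impI allI ballI)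
    fix n k :: nat and \<Sigma>s g
    assume "circle_type S" and dec: "circle_decomposition G \<phi> M S \<iota> \<Sigma> n \<Sigma>s g" "k \<in> {1..n}"
    then obtain p q where "\<And>x. x \<in> \<Sigma> \<Longrightarrow> x \<noteq> p \<Longrightarrow> x \<noteq> q \<Longrightarrow> two_sided S \<Sigma> x" using ends by metis
    from circle_classes[OF \<Sigma> this dec]
    show "S_class G \<phi> S \<iota> (g k) =
        S_class G \<phi> S \<iota> (sigma_prod G (\<lambda>j. if j = -1 then g n else g (nat j)) (int k))" .
  next
    fix a b \<Sigma>s g n
    assume "interval_type S" and dec: "interval_decomposition G \<phi> M S \<iota> \<Sigma> a b \<Sigma>s g"
      "n \<in> index_range a b - {0}"
    then obtain p q where "\<And>x. x \<in> \<Sigma> \<Longrightarrow> x \<noteq> p \<Longrightarrow> x \<noteq> q \<Longrightarrow> two_sided S \<Sigma> x" using ends by metis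
    from interval_classes[OF \<Sigma> this dec]
    show "S_class G \<phi> S \<iota> (g n) = S_class G \<phi> S \<iota> (sigma_prod G g n)" .
  qed
qed

end
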